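(* Let $\varepsilon>0$ be fixed and let $\alpha=1.1918\ldots$ be the unique positive root of $e^{-\alpha+\alpha e^{-\alpha}}+1=e^{\alpha e^{-\alpha}}$. Let $p=p(n)\le(\alpha-\varepsilon)n^{-1}$ and $G\in\mathcal{G}(n,p)$. Then with probability tending to $1$, every connected component $F$ of $G$ satisfies $c_F(G)+v(F)\le t_1(G)+1$. Moreover, in this range, with probability tending to $1$, $D(G)=D_1(G)=(e^{-pn}+o(1))\,n$.
   Context: Graphs are finite and simple. $t_1(G)$ is the number of isolated vertices of $G$; for a graph $F$, $c_F(G)$ is the number of connected components of $G$ isomorphic to $F$; $v(F)$ is the number of vertices of $F$. First order sentences about graphs use variables over vertices, relations $=$ and $\sim$ (adjacency), quantifiers $\forall,\exists$ and Boolean connectives; quantifier depth is the maximum number of nested quantifiers. A sentence $A$ defines $G$ if $G\models A$ and $H\not\models A$ for all $H\not\cong G$. $D(G)$ is the minimum depth of a sentence defining $G$. For a sentence with no quantifier in the scope of a negation, the alternation number is the maximum number of changes between $\exists$ and $\forall$ along a chain of nested quantifiers; $D_1(G)$ is the minimum depth of a sentence with alternation number at most $1$ defining $G$. $\mathcal{G}(n,p)$ is the random graph on $\{1,\dots,n\}$ with each edge present independently with probability $p$. *)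

theory Defs
  imports
    "HOL-Probability.Product_PMF"
    "Graph_Theory.Pair_Digraph"
    "Graph_Theory.Digraph_Isomorphism"
begin

section \<open>Finite simple graphs\<close>

text \<open>
  As in Graph Theory, a finite simple graph is a symmetric loop-free digraph on a finite vertex set,
  given by its arc relation (locale \<^locale>\<open>pair_graph\<close>); an edge is a pair of opposite arcs. In a
  symmetric digraph the strongly connected components are the connected components, as induced
  subgraphs.
\<close>

abbreviation graph_components :: "'a pair_pre_digraph \<Rightarrow> ('a, 'a \<times> 'a) pre_digraph set" where
  "graph_components G \<equiv> pre_digraph.sccs (with_proj G)"

definition isolated_count :: "'a pair_pre_digraph \<Rightarrow> nat" where
  "isolated_count G = card {v \<in> pverts G. out_degree (with_proj G) v = 0}"

definition component_count :: "('b, 'c) pre_digraph \<Rightarrow> 'a pair_pre_digraph \<Rightarrow> nat" where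
  "component_count F G = card {C \<in> graph_components G. digraph_iso C F}"


section \<open>First order sentences about graphs\<close>

datatype fo =
    Equal nat nat
  | Adj nat nat
  | Neg fo
  | Conj fo fo
  | Disj fo fo
  | Forall nat fo
  | Exists nat fo

fun fo_free :: "fo \<Rightarrow> nat set" where
  "fo_free (Equal i j) = {i, j}"
| "fo_free (Adj i j) = {i, j}"
| "fo_free (Neg A) = fo_free A"
| "fo_free (Conj A B) = fo_free A \<union> fo_free B"
| "fo_free (Disj A B) = fo_free A \<union> fo_free B"
| "fo_free (Forall i A) = fo_free A - {i}"
| "fo_free (Exists i A) = fo_free A - {i}"

definition fo_sentence :: "fo \<Rightarrow> bool" where
  "fo_sentence A \<longleftrightarrow> fo_free A = {}"

fun sat :: "'a pair_pre_digraph \<Rightarrow> (nat \<Rightarrow> 'a) \<Rightarrow> fo \<Rightarrow> bool" where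
  "sat G s (Equal i j) \<longleftrightarrow> s i = s j"
| "sat G s (Adj i j) \<longleftrightarrow> (s i, s j) \<in> parcs G"
| "sat G s (Neg A) \<longleftrightarrow> \<not> sat G s A"
| "sat G s (Conj A B) \<longleftrightarrow> sat G s A \<and> sat G s B"
| "sat G s (Disj A B) \<longleftrightarrow> sat G s A \<or> sat G s B"
| "sat G s (Forall i A) \<longleftrightarrow> (\<forall>v\<in>pverts G. sat G (s(i := v)) A)"
| "sat G s (Exists i A) \<longleftrightarrow> (\<exists>v\<in>pverts G. sat G (s(i := v)) A)"

text \<open>The truth of a sentence does not depend on the valuation, so the quantifier over all
  (arbitrary, total) valuations is harmless, also for the graph without vertices.\<close>

definition models :: "'a pair_pre_digraph \<Rightarrow> fo \<Rightarrow> bool" (infix \<open>\<Turnstile>\<close> 50) where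
  "G \<Turnstile> A \<longleftrightarrow> (\<forall>s. sat G s A)"

fun quantifier_depth :: "fo \<Rightarrow> nat" where
  "quantifier_depth (Equal i j) = 0"
| "quantifier_depth (Adj i j) = 0"
| "quantifier_depth (Neg A) = quantifier_depth A"
| "quantifier_depth (Conj A B) = max (quantifier_depth A) (quantifier_depth B)"
| "quantifier_depth (Disj A B) = max (quantifier_depth A) (quantifier_depth B)"
| "quantifier_depth (Forall i A) = Suc (quantifier_depth A)"
| "quantifier_depth (Exists i A) = Suc (quantifier_depth A)"

text \<open>No quantifier occurs in the scope of a negation.\<close>

fun negations_quantifier_free :: "fo \<Rightarrow> bool" where
  "negations_quantifier_free (Equal i j) \<longleftrightarrow> True"
| "negations_quantifier_free (Adj i j) \<longleftrightarrow> True"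
| "negations_quantifier_free (Neg A) \<longleftrightarrow> quantifier_depth A = 0"
| "negations_quantifier_free (Conj A B) \<longleftrightarrow> negations_quantifier_free A \<and> negations_quantifier_free B"
| "negations_quantifier_free (Disj A B) \<longleftrightarrow> negations_quantifier_free A \<and> negations_quantifier_free B"
| "negations_quantifier_free (Forall i A) \<longleftrightarrow> negations_quantifier_free A"
| "negations_quantifier_free (Exists i A) \<longleftrightarrow> negations_quantifier_free A"

text \<open>The sequences of quantifiers met on the way from the root of the formula to an atom,
  outermost first.\<close>

datatype quantifier = Q_all | Q_ex

fun quantifier_chains :: "fo \<Rightarrow> quantifier list set" where
  "quantifier_chains (Equal i j) = {[]}"
| "quantifier_chains (Adj i j) = {[]}"
| "quantifier_chains (Neg A) = quantifier_chains A"
| "quantifier_chains (Conj A B) = quantifier_chains A \<union> quantifier_chains B"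
| "quantifier_chains (Disj A B) = quantifier_chains A \<union> quantifier_chains B"
| "quantifier_chains (Forall i A) = (#) Q_all ` quantifier_chains A"
| "quantifier_chains (Exists i A) = (#) Q_ex ` quantifier_chains A"

definition quantifier_changes :: "quantifier list \<Rightarrow> nat" where
  "quantifier_changes qs = card {i. Suc i < length qs \<and> qs ! i \<noteq> qs ! Suc i}"

text \<open>Only meaningful for formulas satisfying \<^const>\<open>negations_quantifier_free\<close>.\<close>

definition alternation_number :: "fo \<Rightarrow> nat" where
  "alternation_number A = Max (quantifier_changes ` quantifier_chains A)"

text \<open>Up to isomorphism every finite graph has its vertices among the natural numbers, so it
  suffices to let \<open>H\<close> range over such graphs.\<close>

definition defines_graph :: "fo \<Rightarrow> 'a pair_pre_digraph \<Rightarrow> bool" where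
  "defines_graph A G \<longleftrightarrow> fo_sentence A \<and> G \<Turnstile> A \<and>
     (\<forall>H :: nat pair_pre_digraph.
        pair_graph H \<and> \<not> digraph_iso (with_proj H) (with_proj G) \<longrightarrow> \<not> H \<Turnstile> A)"

definition fo_depth :: "'a pair_pre_digraph \<Rightarrow> nat" where
  "fo_depth G = (LEAST d. \<exists>A. defines_graph A G \<and> quantifier_depth A = d)"

definition fo_depth1 :: "'a pair_pre_digraph \<Rightarrow> nat" where
  "fo_depth1 G = (LEAST d. \<exists>A. defines_graph A G \<and> negations_quantifier_free A \<and>
     alternation_number A \<le> 1 \<and> quantifier_depth A = d)"


section \<open>The random graph\<close>

definition gnp :: "nat \<Rightarrow> real \<Rightarrow> nat pair_pre_digraph pmf" where
  "gnp n p = map_pmf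
     (\<lambda>f. \<lparr> pverts = {1..n},
            parcs = {(u, v). u \<in> {1..n} \<and> v \<in> {1..n} \<and> u \<noteq> v \<and> f {u, v}} \<rparr>)
     (Pi_pmf {e. e \<subseteq> {1..n} \<and> card e = 2} False (\<lambda>_. bernoulli_pmf p))"

end

theory Submission
  imports Defs "HOL-Probability.Probability" "HOL-Real_Asymp.Real_Asymp"
begin

text \<open>
  Depth: let \<open>t\<close> be the number of isolated vertices. Duplicator cannot lose \<open>t\<close> rounds (\<open>t + 1\<close> if there
  is an edge) between \<open>G\<close> and \<open>G\<close> plus an isolated vertex. Conversely \<open>G\<close> is determined by the
  multiplicities of its component types together with the maximal component size, and ``at least
  \<open>c\<close> components of type \<open>F\<close>'' is an exists-forall sentence of depth \<open>c + v(F)\<close>; so under the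
  component condition the two bounds agree.

  Probability: the numbers of isolated vertices and of isolated edges are concentrated by the second
  moment method. Exploring the component of a vertex bounds the probability that it has exactly
  \<open>m\<close> vertices by \<open>P(Bin(n - 1, 1 - (1 - p)^m) = m - 1)\<close>, which is exponentially small as soon as
  \<open>m/n\<close> exceeds the root of \<open>x = 1 - exp(- c x)\<close>. The constant \<open>\<alpha>\<close> is the value of \<open>c\<close> at which this
  root reaches the density \<open>exp(- c)\<close> of isolated vertices. Types with at least three vertices are
  rare enough by counting vertices, types with two by the count of isolated edges.
\<close>

section \<open>Products of Bernoulli variables\<close>

text \<open>The product \<open>pn\<close> may oscillate or tend to 0, so every estimate is uniform
  in \<open>p\<close> and uses only \<open>pn \<le> c\<close> with \<open>c\<close> below \<alpha>.
  The split by component size rests on the fact that \<open>exp (- \<alpha>)\<close>, about 0.3036,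
  lies between 1/4 and 1/3. If \<open>t\<close> is about \<open>x n\<close>, the vertices that are
  not isolated leave room for at most \<open>(1 - x) n / k\<close> components of size
  \<open>k\<close>. For \<open>k = 3\<close> this stays below \<open>t\<close> once
  \<open>x > 1/4\<close>, but for \<open>k = 2\<close> it would need \<open>x > 1/3\<close>.
  Isolated edges are therefore counted directly: their mean is about
  \<open>(pn / 2) exp (- 2 pn) n\<close>, at most 3/5 of the number of isolated vertices. Beyond a
  constant size \<open>K\<close> there are at most \<open>n / K\<close> copies of a type, so only
  its size matters, and exploration excludes every size from slightly below
  \<open>exp (- \<alpha>) n\<close> upwards. On the logical side, excluding \<open>c + 1\<close>
  copies of \<open>F\<close> costs depth \<open>c + 1 + v(F)\<close>, which the component condition
  caps at \<open>t + 2\<close>. Graphs without edges have depth \<open>t + 1\<close> and need a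
  sentence of their own.\<close>

lemma prob_Pi_pmf_present_absent:
  fixes p :: real
  assumes "finite A" "B \<subseteq> A" "C \<subseteq> A" "B \<inter> C = {}" "0 \<le> p" "p \<le> 1"
  shows "measure_pmf.prob (Pi_pmf A False (\<lambda>_. bernoulli_pmf p))
           {f. (\<forall>e\<in>B. f e) \<and> (\<forall>e\<in>C. \<not> f e)} = p ^ card B * (1 - p) ^ card C"
proof -
  define T where "T = (\<lambda>e. if e \<in> B then {True} else if e \<in> C then {False} else UNIV)"
  have "{f. (\<forall>e\<in>B. f e) \<and> (\<forall>e\<in>C. \<not> f e)} = Pi A T"
    using assms(2-4) by (auto simp: T_def Pi_def)
  then have "measure_pmf.prob (Pi_pmf A False (\<lambda>_. bernoulli_pmf p))
      {f. (\<forall>e\<in>B. f e) \<and> (\<forall>e\<in>C. \<not> f e)} = (\<Prod>e\<in>A. measure_pmf.prob (bernoulli_pmf p) (T e))"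
    using assms(1) by (simp add: measure_Pi_pmf_Pi)
  also have "\<dots> = (\<Prod>e\<in>A. (if e \<in> B then p else 1) * (if e \<in> C then 1 - p else 1))"
    using assms by (intro prod.cong) (auto simp: T_def measure_pmf_single)
  also have "\<dots> = p ^ card B * (1 - p) ^ card C"
    using assms by (simp add: prod.distrib prod.If_cases Int_absorb1)
  finally show ?thesis .
qed

text \<open>The field on \<open>A\<close> is a pair of independent fields on \<open>B\<close> and on
  \<open>A - B\<close>; the first decides \<open>X\<close>, and the second decides \<open>Y\<close>
  because \<open>C\<close> lies in \<open>A - B\<close>.\<close>

lemma prob_Pi_pmf_indep:
  assumes A: "finite A" "B \<subseteq> A" "C \<subseteq> A" "B \<inter> C = {}"
    and X: "\<And>f g. (\<And>e. e \<in> B \<Longrightarrow> f e = g e) \<Longrightarrow> X f \<longleftrightarrow> X g"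
    and Y: "\<And>f g. (\<And>e. e \<in> C \<Longrightarrow> f e = g e) \<Longrightarrow> Y f \<longleftrightarrow> Y g"
  shows "measure_pmf.prob (Pi_pmf A d p) {f. X f \<and> Y f} =
         measure_pmf.prob (Pi_pmf A d p) {f. X f} * measure_pmf.prob (Pi_pmf A d p) {f. Y f}"
proof -
  let ?P = "Pi_pmf B d p" and ?Q = "Pi_pmf (A - B) d p"
  have un: "Pi_pmf A d p = map_pmf (\<lambda>(f,g) x. if x \<in> B then f x else g x) (pair_pmf ?P ?Q)"
    using Pi_pmf_union[of B "A - B" d p] A by (auto simp: Un_absorb1 finite_subset)
  have prod: "measure_pmf.prob (Pi_pmf A d p) {f. X' f \<and> Y' f} =
      measure_pmf.prob ?P {f. X' f} * measure_pmf.prob ?Q {f. Y' f}"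
    if X': "\<And>f g. (\<And>e. e \<in> B \<Longrightarrow> f e = g e) \<Longrightarrow> X' f \<longleftrightarrow> X' g"
      and Y': "\<And>f g. (\<And>e. e \<in> C \<Longrightarrow> f e = g e) \<Longrightarrow> Y' f \<longleftrightarrow> Y' g" for X' Y'
  proof -
    have *: "X' (\<lambda>x. if x \<in> B then f x else g x) \<longleftrightarrow> X' f"
      "Y' (\<lambda>x. if x \<in> B then f x else g x) \<longleftrightarrow> Y' g" for f g
      using A(4) by (auto intro!: X' Y')
    have "measure_pmf.prob (Pi_pmf A d p) {f. X' f \<and> Y' f} =
        measure_pmf.prob (pair_pmf ?P ?Q) ({f. X' f} \<times> {g. Y' g})"
    proof -
      have "(\<lambda>(f,g) x. if x \<in> B then f x else g x) -` {f. X' f \<and> Y' f} = {f. X' f} \<times> {g. Y' g}"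
        by (rule set_eqI) (simp only: vimage_eq mem_Collect_eq case_prod_beta * mem_Times_iff)
      then show ?thesis unfolding un measure_map_pmf by (rule arg_cong)
    qed
    \<comment> \<open>The product rule \<open>measure_pmf_prob_product\<close> asks for countable
      sets, so both events are cut down to the supports.\<close>
    also have "\<dots> = measure_pmf.prob (pair_pmf ?P ?Q)
        (({f. X' f} \<inter> set_pmf ?P) \<times> ({g. Y' g} \<inter> set_pmf ?Q))"
      by (rule measure_prob_cong_0) (auto simp: set_pmf_iff pmf_pair)
    also have "\<dots> = measure_pmf.prob ?P ({f. X' f} \<inter> set_pmf ?P) * measure_pmf.prob ?Q ({g. Y' g} \<inter> set_pmf ?Q)"
      by (rule measure_pmf_prob_product) (auto intro: countable_subset[OF _ countable_set_pmf])
    finally show ?thesis by (simp add: measure_Int_set_pmf)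
  qed
  \<comment> \<open>Taking one of the two events to be trivially true identifies the two factors as
    marginal probabilities under the full field.\<close>
  show ?thesis
    using prod[of X Y, OF X Y] prod[of X "\<lambda>_. True", OF X] prod[of "\<lambda>_. True" Y, OF _ Y] by simp
qed

section \<open>Exploration of the component of a vertex\<close>

text \<open>\<open>A\<close> holds the active vertices, \<open>U\<close> the undiscovered ones.
  Starting from a set of active vertices instead of a single root keeps the state after one
  exploration step within the same notion.\<close>

inductive_set reach :: "'a set \<Rightarrow> 'a set \<Rightarrow> ('a set \<Rightarrow> bool) \<Rightarrow> 'a set" for A U f where
  start: "u \<in> A \<Longrightarrow> w \<in> U \<Longrightarrow> f {u, w} \<Longrightarrow> w \<in> reach A U f"
| step: "u \<in> reach A U f \<Longrightarrow> w \<in> U \<Longrightarrow> f {u, w} \<Longrightarrow> w \<in> reach A U f"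

lemma reach_subset: "reach A U f \<subseteq> U"
  by (auto elim: reach.cases)

lemma reach_empty: "reach {} U f = {}"
proof -
  have False if "w \<in> reach {} U f" for w using that by induction auto
  then show ?thesis by auto
qed

text \<open>The edges not yet exposed. They determine \<open>reach A U\<close>, and they form the
  index set on which independence from the exposed edges is claimed.\<close>

definition edges_into :: "'a set \<Rightarrow> 'a set \<Rightarrow> 'a set set" where
  "edges_into A U = {{u, w} |u w. u \<in> A \<union> U \<and> w \<in> U \<and> u \<noteq> w}"

lemma reach_mono_cong:
  assumes "A \<inter> U = {}" "\<And>e. e \<in> edges_into A U \<Longrightarrow> f e = g e"
  shows "reach A U f \<subseteq> reach A U g"
proof
  fix w assume "w \<in> reach A U f"
  then show "w \<in> reach A U g"
  proof induction
    case (start u w)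
    then have "{u, w} \<in> edges_into A U" using assms(1) by (fastforce simp: edges_into_def)
    then show ?case using start assms(2) by (auto intro: reach.start)
  next
    case (step u w)
    show ?case
    \<comment> \<open>The value of \<open>f\<close> at a singleton is not controlled by
      \<open>edges_into\<close>, but a step from \<open>w\<close> to itself reaches nothing
      new.\<close>
    proof (cases "u = w")
      case False
      then have "{u, w} \<in> edges_into A U" using step reach_subset[of A U g] by (fastforce simp: edges_into_def)
      then show ?thesis using step assms(2) by (auto intro: reach.step)
    qed (use step in simp)
  qed
qed

lemma reach_cong:
  assumes "A \<inter> U = {}" "\<And>e. e \<in> edges_into A U \<Longrightarrow> f e = g e"
  shows "reach A U f = reach A U g"
  using assms by (intro equalityI reach_mono_cong) auto

text \<open>One exploration step: once its neighbours \<open>K\<close> in \<open>U\<close> are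
  known, \<open>a\<close> is done, and \<open>K\<close> moves from the undiscovered to the active
  vertices.\<close>

lemma reach_expand:
  assumes "a \<in> A" and K: "K = {w \<in> U. f {a, w}}"
  shows "reach A U f = K \<union> reach (A - {a} \<union> K) (U - K) f"
proof (intro equalityI subsetI)
  fix w assume "w \<in> reach A U f"
  then show "w \<in> K \<union> reach (A - {a} \<union> K) (U - K) f"
  proof induction
    case (start u w)
    then show ?case unfolding K by (cases "u = a") (auto intro: reach.start)
  next
    case (step u w)
    then show ?case by (cases "w \<in> K") (auto intro: reach.start reach.step)
  qed
next
  have sub: "K \<subseteq> reach A U f" using assms by (auto intro: reach.start)
  fix w assume "w \<in> K \<union> reach (A - {a} \<union> K) (U - K) f"
  then show "w \<in> reach A U f"
  proof
    assume "w \<in> reach (A - {a} \<union> K) (U - K) f"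
    then show ?thesis
      by induction (use sub in \<open>auto intro: reach.start reach.step\<close>)
  qed (use sub in auto)
qed

lemma sum_Pow_power:
  fixes x y :: "'a :: comm_semiring_1"
  assumes "finite J"
  shows "(\<Sum>K\<in>Pow J. x ^ card K * y ^ card (J - K)) = (x + y) ^ card J"
proof -
  have "(x + y) ^ card J = (\<Prod>i\<in>J. x + y)" by simp
  also have "\<dots> = (\<Sum>K\<in>Pow J. x ^ card K * y ^ card (J - K))"
    using prod_add[OF assms, of "\<lambda>_. x" "\<lambda>_. y"] by simp
  finally show ?thesis by simp
qed

text \<open>Process the active vertices one at a time, exposing their edges to the undiscovered vertices.
  If exactly \<open>J\<close> is reached, then \<open>N = card A + card J\<close> vertices are processed; each vertex of \<open>J\<close> is
  hit at least once and every other vertex survives \<open>N\<close> trials.\<close>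

lemma prob_reach_le:
  fixes p :: real
  assumes "finite E" "finite U" "finite A" "A \<inter> U = {}" "edges_into A U \<subseteq> E" "J \<subseteq> U" "0 \<le> p" "p \<le> 1"
  shows "measure_pmf.prob (Pi_pmf E False (\<lambda>_. bernoulli_pmf p)) {f. reach A U f = J}
    \<le> (1 - p) ^ ((card A + card J) * card (U - J)) * (1 - (1 - p) ^ (card A + card J)) ^ card J"
  using assms(2-6)
\<comment> \<open>A step removes \<open>a\<close> from \<open>A\<close> and moves \<open>K\<close>
  from \<open>U\<close> to \<open>A\<close>, so this sum drops by exactly one.\<close>
proof (induction "card A + card U" arbitrary: A U J rule: less_induct)
  case less
  let ?M = "Pi_pmf E False (\<lambda>_. bernoulli_pmf p)" and ?q = "1 - p"
  show ?case
  proof (cases "A = {}")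
    case True
    show ?thesis
    proof (cases "J = {}")
      case False
      then have "{f. reach A U f = J} = {}" using True by (auto simp: reach_empty)
      then show ?thesis using assms by (simp add: power_le_one)
    qed (simp add: True reach_empty)
  next
    case False
    then obtain a where a: "a \<in> A" by auto
    \<comment> \<open>\<open>N\<close> is the number of vertices processed after \<open>a\<close>.
      It equals \<open>card (A - {a} \<union> K) + card (J - K)\<close> for every \<open>K\<close>,
      so the bounds from the induction hypothesis share one base and can be summed over
      \<open>K\<close>.\<close>
    define N where "N = card A + card J - 1"
    have "card A > 0" using a less.prems by (auto simp: card_gt_0_iff)
    then have N: "card A + card J = Suc N" by (simp add: N_def)
    have finJ: "finite J" using less.prems finite_subset by blast
    define nb where "nb f = {w \<in> U. f {a, w}}" for f :: "'a set \<Rightarrow> bool"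
    let ?R = "\<lambda>K. {f. nb f = K \<and> reach (A - {a} \<union> K) (U - K) f = J - K}"
    have sub: "{f. reach A U f = J} \<subseteq> (\<Union>K\<in>Pow J. ?R K)"
    proof safe
      fix f assume J: "J = reach A U f"
      define K where "K = nb f"
      have eq: "reach A U f = K \<union> reach (A - {a} \<union> K) (U - K) f"
        by (rule reach_expand[OF a]) (simp add: K_def nb_def)
      moreover have "K \<inter> reach (A - {a} \<union> K) (U - K) f = {}"
        using reach_subset[of "A - {a} \<union> K" "U - K" f] by auto
      ultimately show "f \<in> (\<Union>K\<in>Pow (reach A U f).
          {fa. nb fa = K \<and> reach (A - {a} \<union> K) (U - K) fa = reach A U f - K})"
        by (intro UN_I[of K]) (auto simp: K_def)
    qed
    have summand: "measure_pmf.prob ?M (?R K) \<le>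
        ?q ^ (Suc N * card (U - J)) * (p ^ card K * (?q * (1 - ?q ^ N)) ^ card (J - K))"
      if "K \<in> Pow J" for K
    proof -
      have K: "K \<subseteq> J" "K \<subseteq> U" "finite K" using that less.prems finite_subset[OF _ finJ] by auto
      \<comment> \<open>\<open>B\<close> consists of the edges exposed at \<open>a\<close>,
        \<open>C\<close> of those that decide the rest of the exploration. All edges in
        \<open>B\<close> contain \<open>a\<close> and none in \<open>C\<close> does, which gives
        independence.\<close>
      define B where "B = (\<lambda>w. {a, w}) ` U"
      define C where "C = edges_into (A - {a} \<union> K) (U - K)"
      have au: "a \<notin> U" using a less.prems by auto
      have BE: "B \<subseteq> E"
      proof -
        have "B \<subseteq> edges_into A U" using a au by (auto simp: B_def edges_into_def)
        then show ?thesis using less.prems by simp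
      qed
      have CE: "C \<subseteq> E"
      proof -
        have "C \<subseteq> edges_into A U" using K by (fastforce simp: C_def edges_into_def)
        then show ?thesis using less.prems by simp
      qed
      have BC: "B \<inter> C = {}"
        using au K by (auto simp: B_def C_def edges_into_def doubleton_eq_iff)
      have inj: "inj_on (\<lambda>w. {a, w}) X" for X by (auto simp: inj_on_def doubleton_eq_iff)
      have "measure_pmf.prob ?M (?R K) = measure_pmf.prob ?M {f. nb f = K} *
          measure_pmf.prob ?M {f. reach (A - {a} \<union> K) (U - K) f = J - K}"
      proof (rule prob_Pi_pmf_indep[OF \<open>finite E\<close> BE CE BC])
        fix f g :: "'a set \<Rightarrow> bool"
        assume "\<And>e. e \<in> B \<Longrightarrow> f e = g e"
        then have "nb f = nb g" by (auto simp: nb_def B_def)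
        then show "nb f = K \<longleftrightarrow> nb g = K" by simp
      next
        fix f g :: "'a set \<Rightarrow> bool"
        assume "\<And>e. e \<in> C \<Longrightarrow> f e = g e"
        then have "reach (A - {a} \<union> K) (U - K) f = reach (A - {a} \<union> K) (U - K) g"
          using less.prems by (intro reach_cong) (auto simp: C_def)
        then show "reach (A - {a} \<union> K) (U - K) f = J - K \<longleftrightarrow> reach (A - {a} \<union> K) (U - K) g = J - K"
          by simp
      qed
      also have "{f. nb f = K} = {f. (\<forall>e\<in>(\<lambda>w. {a, w}) ` K. f e) \<and> (\<forall>e\<in>(\<lambda>w. {a, w}) ` (U - K). \<not> f e)}"
        using K by (auto simp: nb_def)
      also have "measure_pmf.prob ?M \<dots> = p ^ card K * ?q ^ card (U - K)"
        using K BE assms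
        by (subst prob_Pi_pmf_present_absent) (auto simp: B_def card_image[OF inj] doubleton_eq_iff)
      also have "measure_pmf.prob ?M {f. reach (A - {a} \<union> K) (U - K) f = J - K}
          \<le> ?q ^ (N * card (U - J)) * (1 - ?q ^ N) ^ card (J - K)"
      proof -
        have disj: "A \<inter> K = {}" using K less.prems by auto
        have cA: "card (A - {a} \<union> K) = card A - 1 + card K"
          using a K less.prems disj by (subst card_Un_disjoint) auto
        have cU: "card (U - K) = card U - card K" "card K \<le> card U"
          using K less.prems by (auto simp: card_Diff_subset card_mono)
        have cJ: "card (J - K) = card J - card K" "card K \<le> card J"
          using K finJ by (auto simp: card_Diff_subset card_mono)
        have pos: "card A > 0" using a less.prems by (auto simp: card_gt_0_iff)
        have "(U - K) - (J - K) = U - J" using K by auto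
        moreover have "card (A - {a} \<union> K) + card (J - K) = N"
          using cA cJ pos by (simp add: N_def)
        moreover have "measure_pmf.prob ?M {f. reach (A - {a} \<union> K) (U - K) f = J - K} \<le>
            ?q ^ ((card (A - {a} \<union> K) + card (J - K)) * card (U - K - (J - K))) *
            (1 - ?q ^ (card (A - {a} \<union> K) + card (J - K))) ^ card (J - K)"
          by (rule less.hyps) (use cA cU pos less.prems K CE in \<open>auto simp: C_def\<close>)
        ultimately show ?thesis by simp
      qed
      also have "card (U - K) = card (U - J) + card (J - K)"
        using K less.prems finJ by (subst card_Un_disjoint[symmetric]) (auto intro: arg_cong[where f=card])
      finally have "measure_pmf.prob ?M (?R K) \<le> p ^ card K * ?q ^ (card (U - J) + card (J - K)) *
          (?q ^ (N * card (U - J)) * (1 - ?q ^ N) ^ card (J - K))"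
        using assms by (simp add: mult_left_mono)
      then show ?thesis by (simp add: power_add power_mult_distrib mult_ac)
    qed
    have "measure_pmf.prob ?M {f. reach A U f = J} \<le> measure_pmf.prob ?M (\<Union>K\<in>Pow J. ?R K)"
      by (rule measure_pmf.finite_measure_mono[OF sub]) simp
    also have "\<dots> \<le> (\<Sum>K\<in>Pow J. measure_pmf.prob ?M (?R K))"
      by (rule measure_pmf.finite_measure_subadditive_finite) (use finJ in auto)
    also have "\<dots> \<le> (\<Sum>K\<in>Pow J. ?q ^ (Suc N * card (U - J)) * (p ^ card K * (?q * (1 - ?q ^ N)) ^ card (J - K)))"
      by (rule sum_mono) (rule summand)
    \<comment> \<open>The binomial theorem turns the sum over \<open>K\<close> into one factor per
      vertex of \<open>J\<close>: it is hit by \<open>a\<close>, or missed by \<open>a\<close> and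
      hit in one of the \<open>N\<close> later trials. The factor telescopes to
      \<open>1 - ?q ^ Suc N\<close>.\<close>
    also have "\<dots> = ?q ^ (Suc N * card (U - J)) * (p + ?q * (1 - ?q ^ N)) ^ card J"
      by (simp only: sum_distrib_left[symmetric] sum_Pow_power[OF finJ])
    also have "p + ?q * (1 - ?q ^ N) = 1 - ?q ^ Suc N" by (simp add: algebra_simps)
    finally show ?thesis unfolding N .
  qed
qed

section \<open>Components as vertex sets\<close>

abbreviation comps :: "'a pair_pre_digraph \<Rightarrow> 'a set set" where
  "comps G \<equiv> pre_digraph.sccs_verts (with_proj G)"

context pair_graph begin

lemma comps_conv: "comps G = (\<lambda>u. {v. u \<rightarrow>\<^sup>*\<^bsub>with_proj G\<^esub> v}) ` pverts G"
proof -
  have "scc_of u = {v. u \<rightarrow>\<^sup>*\<^bsub>with_proj G\<^esub> v}" for u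
    by (auto simp: scc_of_def intro: symmetric_reachable')
  then show ?thesis by (auto simp: sccs_verts_conv_scc_of)
qed

lemma compsE:
  assumes "S \<in> comps G" "u \<in> S"
  shows "S = {v. u \<rightarrow>\<^sup>*\<^bsub>with_proj G\<^esub> v}"
proof -
  obtain w where w: "w \<in> pverts G" "S = {v. w \<rightarrow>\<^sup>*\<^bsub>with_proj G\<^esub> v}" using assms by (auto simp: comps_conv)
  then have "w \<rightarrow>\<^sup>*\<^bsub>with_proj G\<^esub> u" using assms by auto
  then have "u \<rightarrow>\<^sup>*\<^bsub>with_proj G\<^esub> w" by (rule symmetric_reachable')
  then show ?thesis using w \<open>w \<rightarrow>\<^sup>*\<^bsub>with_proj G\<^esub> u\<close> by (auto intro: reachable_trans)
qed

lemma comps_finite: "finite (comps G)"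
  using pair_finite_verts by (simp add: comps_conv)

lemma comps_subset: "S \<in> comps G \<Longrightarrow> S \<subseteq> pverts G"
  by (rule sccs_verts_subsets)

lemma comps_finite_elem: "S \<in> comps G \<Longrightarrow> finite S"
  using comps_subset finite_subset pair_finite_verts by blast

lemma comps_nonempty: "S \<in> comps G \<Longrightarrow> S \<noteq> {}"
  by (simp add: in_sccs_verts_conv_reachable)

lemma comps_card_pos: "S \<in> comps G \<Longrightarrow> card S > 0"
  using comps_nonempty comps_finite_elem by (auto simp: card_gt_0_iff)

lemma comps_disjoint: "S \<in> comps G \<Longrightarrow> T \<in> comps G \<Longrightarrow> S \<noteq> T \<Longrightarrow> S \<inter> T = {}"
  by (rule sccs_verts_disjoint)

lemma comps_Union: "\<Union>(comps G) = pverts G"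
  using comps_subset by (auto simp: comps_conv)

lemma comps_adj: "S \<in> comps G \<Longrightarrow> u \<in> S \<Longrightarrow> (u, w) \<in> parcs G \<Longrightarrow> w \<in> S"
  using compsE[of S u] by auto

lemma comps_adj_iff: "S \<in> comps G \<Longrightarrow> (u, w) \<in> parcs G \<Longrightarrow> u \<in> S \<longleftrightarrow> w \<in> S"
  using comps_adj arcs_symmetric by blast

text \<open>Induction along a path from \<open>u\<close>. This is how components are bounded from
  above throughout.\<close>

lemma closed_superset_component:
  assumes "S \<in> comps G" "u \<in> S" "u \<in> T" "\<And>x y. x \<in> T \<Longrightarrow> (x, y) \<in> parcs G \<Longrightarrow> y \<in> T"
  shows "S \<subseteq> T"
proof -
  have "v \<in> T" if "u \<rightarrow>\<^sup>*\<^bsub>with_proj G\<^esub> v" for v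
    using that by (induction rule: reachable_induct) (use assms in auto)
  then show ?thesis using compsE[OF assms(1,2)] by auto
qed

lemma comps_sum_card:
  assumes "X \<subseteq> comps G" shows "(\<Sum>S\<in>X. card S) = card (\<Union>X)"
proof (rule card_Union_disjoint[symmetric])
  show "pairwise disjnt X"
    using assms comps_disjoint unfolding pairwise_def disjnt_def by blast
  show "finite S" if "S \<in> X" for S using that assms comps_finite_elem by blast
qed

lemma isolated_count_conv: "isolated_count G = card {S \<in> comps G. card S = 1}"
proof -
  have iso: "out_degree G v = 0 \<longleftrightarrow> {v} \<in> comps G" if v: "v \<in> pverts G" for v
  proof
    assume "out_degree G v = 0"
    then have no: "(v, w) \<notin> parcs G" for w
      using pair_finite_arcs by (auto simp: out_degree_def out_arcs_def)
    obtain S where S: "S \<in> comps G" "v \<in> S" using v comps_Union by blast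
    have "S \<subseteq> {v}" by (rule closed_superset_component[OF S]) (use no in auto)
    then show "{v} \<in> comps G" using S by (simp add: subset_singleton_iff) blast
  next
    assume "{v} \<in> comps G"
    then have "(v, w) \<notin> parcs G" for w
      using comps_adj[of "{v}" v w] no_loops'[of v w] by auto
    then show "out_degree G v = 0" by (auto simp: out_degree_def out_arcs_def)
  qed
  have "{S \<in> comps G. card S = 1} = (\<lambda>v. {v}) ` {v \<in> pverts G. out_degree G v = 0}"
    using comps_subset iso by (auto simp: card_1_singleton_iff)
  then show ?thesis by (simp add: isolated_count_def card_image)
qed

end

section \<open>The random graph as an edge field\<close>

definition vpairs :: "nat \<Rightarrow> nat set set" where
  "vpairs n = {e. e \<subseteq> {1..n} \<and> card e = 2}"

definition edge_field :: "nat \<Rightarrow> real \<Rightarrow> (nat set \<Rightarrow> bool) pmf" where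
  "edge_field n p = Pi_pmf (vpairs n) False (\<lambda>_. bernoulli_pmf p)"

definition graph_of :: "nat \<Rightarrow> (nat set \<Rightarrow> bool) \<Rightarrow> nat pair_pre_digraph" where
  "graph_of n f = \<lparr> pverts = {1..n},
     parcs = {(u, v). u \<in> {1..n} \<and> v \<in> {1..n} \<and> u \<noteq> v \<and> f {u, v}} \<rparr>"

lemma prob_gnp: "measure_pmf.prob (gnp n p) {G. P G} = measure_pmf.prob (edge_field n p) {f. P (graph_of n f)}"
  by (simp add: gnp_def edge_field_def vpairs_def graph_of_def vimage_def)

lemma graph_of_simps [simp]:
  "pverts (graph_of n f) = {1..n}"
  "(u, v) \<in> parcs (graph_of n f) \<longleftrightarrow> u \<in> {1..n} \<and> v \<in> {1..n} \<and> u \<noteq> v \<and> f {u, v}"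
  by (auto simp: graph_of_def)

lemma pair_graph_graph_of: "pair_graph (graph_of n f)"
proof
  have "parcs (graph_of n f) \<subseteq> {1..n} \<times> {1..n}" by auto
  then show "finite (parcs (graph_of n f))" by (rule finite_subset) auto
  show "symmetric (with_proj (graph_of n f))"
    by (auto simp: symmetric_def sym_def insert_commute)
qed (auto simp: graph_of_def)

lemma finite_vpairs: "finite (vpairs n)"
  by (rule finite_subset[of _ "Pow {1..n}"]) (auto simp: vpairs_def)

lemma doubleton_in_vpairs [simp]: "{u, v} \<in> vpairs n \<longleftrightarrow> u \<in> {1..n} \<and> v \<in> {1..n} \<and> u \<noteq> v"
  by (auto simp: vpairs_def card_insert_if)

lemma comps_graph_of_reach:
  assumes S: "S \<in> comps (graph_of n f)" "v \<in> S"
  shows "reach {v} ({1..n} - {v}) f = S - {v}"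
proof -
  interpret pair_graph "graph_of n f" by (rule pair_graph_graph_of)
  have v: "v \<in> {1..n}" using S comps_subset by fastforce
  have "w \<in> S" if "w \<in> reach {v} ({1..n} - {v}) f" for w
    using that
  proof induction
    case (start u w)
    then show ?case using comps_adj[OF S, of w] v by auto
  next
    case (step u w)
    then show ?case using comps_adj[OF S(1) step.IH, of w] reach_subset[of "{v}" "{1..n} - {v}" f]
      by (cases "u = w") auto
  qed
  moreover have "S \<subseteq> insert v (reach {v} ({1..n} - {v}) f)"
    by (rule closed_superset_component[OF S]) (auto intro: reach.intros)
  ultimately show ?thesis using reach_subset[of "{v}" "{1..n} - {v}" f] by auto
qed

text \<open>A union bound over a root \<open>v\<close>, the size \<open>m\<close> and the set
  \<open>J\<close> of the other \<open>m - 1\<close> vertices. With one active vertex,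
  \<open>m\<close> vertices are processed in all, whence the exponent \<open>m\<close> of
  \<open>1 - p\<close>. Each summand is a binomial point mass for \<open>n - 1\<close>
  trials.\<close>

lemma prob_large_component_le_sum:
  fixes p :: real
  assumes "0 \<le> p" "p \<le> 1" "1 \<le> k"
  shows "measure_pmf.prob (edge_field n p) {f. \<exists>S\<in>comps (graph_of n f). k \<le> card S} \<le>
    (\<Sum>v\<in>{1..n}. \<Sum>m\<in>{k..n}. real ((n - 1) choose (m - 1)) * ((1 - p) ^ m) ^ (n - m) * (1 - (1 - p) ^ m) ^ (m - 1))"
proof -
  let ?M = "edge_field n p"
  let ?J = "\<lambda>v m. {J. J \<subseteq> {1..n} - {v} \<and> card J = m - 1}"
  have "{f. \<exists>S\<in>comps (graph_of n f). k \<le> card S} \<subseteq>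
      (\<Union>v\<in>{1..n}. \<Union>m\<in>{k..n}. \<Union>J\<in>?J v m. {f. reach {v} ({1..n} - {v}) f = J})"
  proof safe
    fix f S assume S: "S \<in> comps (graph_of n f)" "k \<le> card S"
    interpret pair_graph "graph_of n f" by (rule pair_graph_graph_of)
    obtain v where v: "v \<in> S" using comps_nonempty[OF S(1)] by auto
    have sub: "S \<subseteq> {1..n}" using comps_subset[OF S(1)] by simp
    then have "card S \<le> n" using card_mono[of "{1..n}" S] by simp
    then show "f \<in> (\<Union>v\<in>{1..n}. \<Union>m\<in>{k..n}. \<Union>J\<in>?J v m. {f. reach {v} ({1..n} - {v}) f = J})"
    proof (intro UN_I)
      show "S - {v} \<in> ?J v (card S)" using v sub by (auto simp: card_Diff_singleton)
      show "f \<in> {f. reach {v} ({1..n} - {v}) f = S - {v}}" using comps_graph_of_reach[OF S(1) v] by simp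
    qed (use v sub S in auto)
  qed
  then have "measure_pmf.prob ?M {f. \<exists>S\<in>comps (graph_of n f). k \<le> card S} \<le>
      measure_pmf.prob ?M (\<Union>v\<in>{1..n}. \<Union>m\<in>{k..n}. \<Union>J\<in>?J v m. {f. reach {v} ({1..n} - {v}) f = J})"
    by (rule measure_pmf.finite_measure_mono) simp
  also have "\<dots> \<le> (\<Sum>v\<in>{1..n}. measure_pmf.prob ?M (\<Union>m\<in>{k..n}. \<Union>J\<in>?J v m. {f. reach {v} ({1..n} - {v}) f = J}))"
    by (rule measure_pmf.finite_measure_subadditive_finite) auto
  also have "\<dots> \<le> (\<Sum>v\<in>{1..n}. \<Sum>m\<in>{k..n}. measure_pmf.prob ?M (\<Union>J\<in>?J v m. {f. reach {v} ({1..n} - {v}) f = J}))"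
    by (intro sum_mono measure_pmf.finite_measure_subadditive_finite) auto
  also have "\<dots> \<le> (\<Sum>v\<in>{1..n}. \<Sum>m\<in>{k..n}. \<Sum>J\<in>?J v m. measure_pmf.prob ?M {f. reach {v} ({1..n} - {v}) f = J})"
    by (intro sum_mono measure_pmf.finite_measure_subadditive_finite) auto
  also have "\<dots> \<le> (\<Sum>v\<in>{1..n}. \<Sum>m\<in>{k..n}. \<Sum>J\<in>?J v m. ((1 - p) ^ m) ^ (n - m) * (1 - (1 - p) ^ m) ^ (m - 1))"
  proof (intro sum_mono)
    fix v m J assume v: "v \<in> {1..n}" and m: "m \<in> {k..n}" and J: "J \<in> ?J v m"
    have fJ: "finite J" using J finite_subset[of J "{1..n} - {v}"] by auto
    have cJ: "card J = m - 1" "J \<subseteq> {1..n} - {v}" using J by auto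
    have "card ({1..n} - {v} - J) = card ({1..n} - {v}) - card J"
      using cJ fJ by (subst card_Diff_subset) auto
    then have "card ({1..n} - {v} - J) = n - m" using cJ v m assms by auto
    moreover have "edges_into {v} ({1..n} - {v}) \<subseteq> vpairs n" using v by (auto simp: edges_into_def)
    moreover have "card {v} + card J = m" using cJ m assms by auto
    ultimately show "measure_pmf.prob ?M {f. reach {v} ({1..n} - {v}) f = J}
        \<le> ((1 - p) ^ m) ^ (n - m) * (1 - (1 - p) ^ m) ^ (m - 1)"
      using prob_reach_le[of "vpairs n" "{1..n} - {v}" "{v}" J p] cJ assms finite_vpairs
      by (simp only: edge_field_def power_mult) auto
  qed
  also have "\<dots> = (\<Sum>v\<in>{1..n}. \<Sum>m\<in>{k..n}. real ((n - 1) choose (m - 1)) * ((1 - p) ^ m) ^ (n - m) * (1 - (1 - p) ^ m) ^ (m - 1))"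
    by (intro sum.cong refl) (simp add: n_subsets)
  finally show ?thesis .
qed

text \<open>A point mass above the mean is at most the upper tail, which Hoeffding's inequality
  bounds.\<close>

lemma pmf_binomial_le_exp:
  fixes g t :: real
  assumes g: "0 \<le> g" "g \<le> 1" and n: "0 < n" and t: "0 \<le> t" "real n * g + t \<le> real k"
  shows "pmf (binomial_pmf n g) k \<le> exp (- (2 * t\<^sup>2 / real n))"
proof -
  have bd: "binomial_distribution g" by (rule binomial_distribution.intro) (use g in auto)
  have "pmf (binomial_pmf n g) k = measure_pmf.prob (binomial_pmf n g) {k}"
    by (simp add: measure_pmf_single)
  also have "\<dots> \<le> measure_pmf.prob (binomial_pmf n g) {x. real x \<ge> real n * g + t}"
    by (intro measure_pmf.finite_measure_mono) (use t in auto)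
  also have "\<dots> \<le> exp (- (2 * t\<^sup>2 / real n))"
    using binomial_distribution.prob_ge[OF bd n t(1)] by simp
  finally show ?thesis .
qed
text \<open>The hypothesis \<open>gap\<close> says that \<open>m - 1\<close> exceeds by
  \<open>t\<close> the mean of the binomial variable whose point mass is the summand for
  \<open>m\<close>. Every summand then obeys the tail bound, and there are at most
  \<open>n ^ 2\<close> of them.\<close>

lemma prob_large_component_le:
  fixes p :: real
  assumes p: "0 \<le> p" "p \<le> 1" and k: "1 \<le> k" and n: "2 \<le> n" and t: "0 \<le> t"
    and gap: "\<And>m. m \<in> {k..n} \<Longrightarrow> real (n - 1) * (1 - (1 - p) ^ m) + t \<le> real (m - 1)"
  shows "measure_pmf.prob (edge_field n p) {f. \<exists>S\<in>comps (graph_of n f). k \<le> card S}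
    \<le> real n ^ 2 * exp (- (2 * t\<^sup>2 / real (n - 1)))"
proof -
  have "real ((n - 1) choose (m - 1)) * ((1 - p) ^ m) ^ (n - m) * (1 - (1 - p) ^ m) ^ (m - 1)
      \<le> exp (- (2 * t\<^sup>2 / real (n - 1)))" if m: "m \<in> {k..n}" for m
  proof -
    define g where "g = 1 - (1 - p) ^ m"
    have g: "0 \<le> g" "g \<le> 1" using p by (auto simp: g_def power_le_one)
    have "1 \<le> m" using m k by simp
    then have nm: "n - 1 - (m - 1) = n - m" by linarith
    have gap': "real (n - 1) * g + t \<le> real (m - 1)" using gap[OF m] unfolding g_def .
    have n': "0 < n - 1" using n by simp
    have le: "pmf (binomial_pmf (n - 1) g) (m - 1) \<le> exp (- (2 * t\<^sup>2 / real (n - 1)))"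
      by (rule pmf_binomial_le_exp[OF g n' t gap'])
    have eq: "pmf (binomial_pmf (n - 1) g) (m - 1) = real ((n - 1) choose (m - 1)) * g ^ (m - 1) * (1 - g) ^ (n - m)"
      unfolding pmf_binomial[OF g] nm ..
    show ?thesis using le unfolding eq by (simp add: g_def mult_ac)
  qed
  then have "(\<Sum>v\<in>{1..n}. \<Sum>m\<in>{k..n}. real ((n - 1) choose (m - 1)) * ((1 - p) ^ m) ^ (n - m) * (1 - (1 - p) ^ m) ^ (m - 1))
      \<le> (\<Sum>v\<in>{1..n}. \<Sum>m\<in>{k..n}. exp (- (2 * t\<^sup>2 / real (n - 1))))"
    by (intro sum_mono)
  also have "\<dots> = real n * (real (n + 1 - k) * exp (- (2 * t\<^sup>2 / real (n - 1))))"
    by (simp del: of_nat_diff)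
  also have "\<dots> \<le> real n * (real n * exp (- (2 * t\<^sup>2 / real (n - 1))))"
    using k by (intro mult_left_mono mult_right_mono) auto
  finally show ?thesis
    using prob_large_component_le_sum[OF p k, of n] by (simp add: power2_eq_square mult_ac)
qed

section \<open>Second moment method\<close>

text \<open>The events need only be pairwise independent up to a factor \<open>1 + \<eta>\<close>.
  In the second moment the diagonal contributes \<mu> and the rest at most
  \<open>(1 + \<eta>) * \<mu>\<^sup>2\<close>, so the variance is at most
  \<open>\<mu> + \<eta> * \<mu>\<^sup>2\<close>, and Chebyshev's inequality applies.\<close>

lemma second_moment_bound:
  fixes M :: "'a pmf" and A :: "'i \<Rightarrow> 'a set" and \<eta> t :: real
  assumes I: "finite I" and \<eta>: "0 \<le> \<eta>" and t: "0 < t"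
    and pairs: "\<And>i j. i \<in> I \<Longrightarrow> j \<in> I \<Longrightarrow> i \<noteq> j \<Longrightarrow> measure_pmf.prob M (A i \<inter> A j)
        \<le> (1 + \<eta>) * (measure_pmf.prob M (A i) * measure_pmf.prob M (A j))"
  defines "\<mu> \<equiv> \<Sum>i\<in>I. measure_pmf.prob M (A i)"
  shows "measure_pmf.prob M {f. t \<le> \<bar>real (card {i \<in> I. f \<in> A i}) - \<mu>\<bar>} \<le> (\<mu> + \<eta> * \<mu>\<^sup>2) / t\<^sup>2"
proof -
  define X where "X f = (\<Sum>i\<in>I. indicator (A i) f :: real)" for f
  have X: "real (card {i \<in> I. f \<in> A i}) = X f" for f
    using I by (simp add: X_def indicator_def sum.If_cases Int_def)
  have intA: "integrable (measure_pmf M) (indicator S :: 'a \<Rightarrow> real)" for S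
    by (rule integrable_real_indicator) (auto simp: measure_pmf.emeasure_eq_measure)
  have EX: "measure_pmf.expectation M X = \<mu>"
    unfolding X_def \<mu>_def by (subst Bochner_Integration.integral_sum) (auto intro: intA)
  have X2: "X f ^ 2 = (\<Sum>i\<in>I. \<Sum>j\<in>I. indicator (A i \<inter> A j) f)" for f
    by (simp add: X_def power2_eq_square sum_product indicator_inter_arith)
  have int2: "integrable (measure_pmf M) (\<lambda>f. X f ^ 2)"
    unfolding X2 by (intro Bochner_Integration.integrable_sum intA)
  have int1: "integrable (measure_pmf M) X"
    unfolding X_def by (intro Bochner_Integration.integrable_sum intA)
  have "measure_pmf.expectation M (\<lambda>f. X f ^ 2) = (\<Sum>i\<in>I. \<Sum>j\<in>I. measure_pmf.prob M (A i \<inter> A j))"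
    unfolding X2 by (simp add: Bochner_Integration.integral_sum Bochner_Integration.integrable_sum intA)
  also have "\<dots> \<le> (\<Sum>i\<in>I. measure_pmf.prob M (A i) +
      (\<Sum>j\<in>I. (1 + \<eta>) * (measure_pmf.prob M (A i) * measure_pmf.prob M (A j))))"
  proof (rule sum_mono)
    fix i assume i: "i \<in> I"
    have "(\<Sum>j\<in>I. measure_pmf.prob M (A i \<inter> A j)) =
        measure_pmf.prob M (A i) + (\<Sum>j\<in>I - {i}. measure_pmf.prob M (A i \<inter> A j))"
      using I i by (subst sum.remove[of I i]) auto
    also have "(\<Sum>j\<in>I - {i}. measure_pmf.prob M (A i \<inter> A j)) \<le>
        (\<Sum>j\<in>I - {i}. (1 + \<eta>) * (measure_pmf.prob M (A i) * measure_pmf.prob M (A j)))"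
      using i by (intro sum_mono pairs) auto
    also have "\<dots> \<le> (\<Sum>j\<in>I. (1 + \<eta>) * (measure_pmf.prob M (A i) * measure_pmf.prob M (A j)))"
      using I \<eta> by (intro sum_mono2) auto
    finally show "(\<Sum>j\<in>I. measure_pmf.prob M (A i \<inter> A j)) \<le> measure_pmf.prob M (A i) +
      (\<Sum>j\<in>I. (1 + \<eta>) * (measure_pmf.prob M (A i) * measure_pmf.prob M (A j)))" by simp
  qed
  also have "\<dots> = \<mu> + (1 + \<eta>) * \<mu>\<^sup>2"
    unfolding \<mu>_def power2_eq_square sum_product by (simp add: sum.distrib sum_distrib_left)
  finally have "measure_pmf.expectation M (\<lambda>f. X f ^ 2) \<le> \<mu> + (1 + \<eta>) * \<mu>\<^sup>2" .
  then have var: "measure_pmf.variance M X \<le> \<mu> + \<eta> * \<mu>\<^sup>2"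
    using measure_pmf.variance_eq[OF int1 int2] by (simp add: EX algebra_simps)
  have "measure_pmf.prob M {f \<in> space M. t \<le> \<bar>X f - measure_pmf.expectation M X\<bar>} \<le> measure_pmf.variance M X / t\<^sup>2"
    by (rule measure_pmf.Chebyshev_inequality) (use int2 t in auto)
  also have "\<dots> \<le> (\<mu> + \<eta> * \<mu>\<^sup>2) / t\<^sup>2"
    using var by (rule divide_right_mono) simp
  finally show ?thesis by (simp add: EX X)
qed

text \<open>Two patterns either contradict each other, and the joint probability is 0, or they
  interact only through edges that both forbid. Such an edge is paid for twice in the product and
  once in the intersection, which costs one factor \<open>1 / (1 - p)\<close>.\<close>

lemma prob_present_absent_pair_le:
  fixes p :: real
  assumes A: "finite A" and p: "0 \<le> p" "p < 1"
    and sub: "B1 \<subseteq> A" "C1 \<subseteq> A" "B2 \<subseteq> A" "C2 \<subseteq> A" "B1 \<inter> C1 = {}" "B2 \<inter> C2 = {}"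
    and disj: "B1 \<inter> B2 = {}" and C: "B1 \<inter> C2 = {} \<Longrightarrow> B2 \<inter> C1 = {} \<Longrightarrow> card (C1 \<inter> C2) \<le> r"
  defines "M \<equiv> Pi_pmf A False (\<lambda>_. bernoulli_pmf p)"
  defines "S \<equiv> \<lambda>B C. {f :: 'e \<Rightarrow> bool. (\<forall>e\<in>B. f e) \<and> (\<forall>e\<in>C. \<not> f e)}"
  shows "measure_pmf.prob M (S B1 C1 \<inter> S B2 C2) \<le>
    1 / (1 - p) ^ r * (measure_pmf.prob M (S B1 C1) * measure_pmf.prob M (S B2 C2))"
proof (cases "(B1 \<union> B2) \<inter> (C1 \<union> C2) = {}")
  case False
  then have "S B1 C1 \<inter> S B2 C2 = {}" by (auto simp: S_def)
  then show ?thesis using p by simp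
next
  case True
  then have Cr: "card (C1 \<inter> C2) \<le> r" using C by blast
  have fin: "finite B1" "finite B2" "finite C1" "finite C2"
    using A sub by (auto intro: finite_subset)
  have "S B1 C1 \<inter> S B2 C2 = S (B1 \<union> B2) (C1 \<union> C2)" by (auto simp: S_def)
  then have "measure_pmf.prob M (S B1 C1 \<inter> S B2 C2) = p ^ card (B1 \<union> B2) * (1 - p) ^ card (C1 \<union> C2)"
    unfolding M_def S_def using A sub p True by (simp add: prob_Pi_pmf_present_absent)
  moreover have "measure_pmf.prob M (S B1 C1) = p ^ card B1 * (1 - p) ^ card C1"
      "measure_pmf.prob M (S B2 C2) = p ^ card B2 * (1 - p) ^ card C2"
    unfolding M_def S_def using A sub p by (auto simp: prob_Pi_pmf_present_absent)
  moreover have "card (B1 \<union> B2) = card B1 + card B2"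
    using fin disj by (simp add: card_Un_disjoint)
  moreover have "card (C1 \<union> C2) + card (C1 \<inter> C2) = card C1 + card C2"
    using card_Un_Int[of C1 C2] fin by simp
  then have "(1 - p) ^ card (C1 \<union> C2) * (1 - p) ^ card (C1 \<inter> C2) = (1 - p) ^ card C1 * (1 - p) ^ card C2"
    by (simp flip: power_add)
  moreover have "(1 - p) ^ r \<le> (1 - p) ^ card (C1 \<inter> C2)"
    using Cr p by (intro power_decreasing) auto
  then have "(1 - p) ^ card (C1 \<union> C2) * (1 - p) ^ r \<le> (1 - p) ^ card (C1 \<union> C2) * (1 - p) ^ card (C1 \<inter> C2)"
    using p by (intro mult_left_mono) auto
  ultimately show ?thesis
    using p by (simp add: field_simps power_add mult_left_mono)
qed

lemma concentration_present_absent: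
  fixes p t :: real
  assumes A: "finite A" and I: "finite I" and p: "0 \<le> p" "p < 1" and t: "0 < t"
    and sub: "\<And>i. i \<in> I \<Longrightarrow> B i \<subseteq> A" "\<And>i. i \<in> I \<Longrightarrow> C i \<subseteq> A" "\<And>i. i \<in> I \<Longrightarrow> B i \<inter> C i = {}"
    and disj: "\<And>i j. i \<in> I \<Longrightarrow> j \<in> I \<Longrightarrow> i \<noteq> j \<Longrightarrow> B i \<inter> B j = {}"
    and C: "\<And>i j. i \<in> I \<Longrightarrow> j \<in> I \<Longrightarrow> i \<noteq> j \<Longrightarrow> B i \<inter> C j = {} \<Longrightarrow> B j \<inter> C i = {} \<Longrightarrow> card (C i \<inter> C j) \<le> r"
  defines "\<mu> \<equiv> \<Sum>i\<in>I. p ^ card (B i) * (1 - p) ^ card (C i)"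
  shows "measure_pmf.prob (Pi_pmf A False (\<lambda>_. bernoulli_pmf p))
      {f. t \<le> \<bar>real (card {i \<in> I. (\<forall>e\<in>B i. f e) \<and> (\<forall>e\<in>C i. \<not> f e)}) - \<mu>\<bar>}
    \<le> (\<mu> + (1 / (1 - p) ^ r - 1) * \<mu>\<^sup>2) / t\<^sup>2"
proof -
  define S where "S i = {f. (\<forall>e\<in>B i. f e) \<and> (\<forall>e\<in>C i. \<not> f e)}" for i
  let ?M = "Pi_pmf A False (\<lambda>_. bernoulli_pmf p)"
  have pr: "measure_pmf.prob ?M (S i) = p ^ card (B i) * (1 - p) ^ card (C i)" if "i \<in> I" for i
    unfolding S_def using A p sub that by (simp add: prob_Pi_pmf_present_absent)
  have "measure_pmf.prob ?M {f. t \<le> \<bar>real (card {i \<in> I. f \<in> S i}) - (\<Sum>i\<in>I. measure_pmf.prob ?M (S i))\<bar>}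
     \<le> ((\<Sum>i\<in>I. measure_pmf.prob ?M (S i)) + (1 / (1 - p) ^ r - 1) * (\<Sum>i\<in>I. measure_pmf.prob ?M (S i))\<^sup>2) / t\<^sup>2"
  proof (rule second_moment_bound[OF I _ t])
    show "0 \<le> 1 / (1 - p) ^ r - 1" using p by (simp add: power_le_one)
    show "measure_pmf.prob ?M (S i \<inter> S j) \<le> (1 + (1 / (1 - p) ^ r - 1)) * (measure_pmf.prob ?M (S i) * measure_pmf.prob ?M (S j))"
      if "i \<in> I" "j \<in> I" "i \<noteq> j" for i j
      using prob_present_absent_pair_le[OF A p, of "B i" "C i" "B j" "C j" r] that sub disj C
      by (simp add: S_def)
  qed
  moreover have "(\<Sum>i\<in>I. measure_pmf.prob ?M (S i)) = \<mu>" unfolding \<mu>_def using pr by simp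
  ultimately show ?thesis by (simp add: S_def)
qed

section \<open>Concentration of the numbers of isolated vertices and isolated edges\<close>

lemma isolated_count_graph_of:
  "isolated_count (graph_of n f) = card {v \<in> {1..n}. \<forall>e\<in>(\<lambda>w. {v, w}) ` ({1..n} - {v}). \<not> f e}"
proof -
  interpret pair_graph "graph_of n f" by (rule pair_graph_graph_of)
  have "out_degree (graph_of n f) v = 0 \<longleftrightarrow> (\<forall>w. (v, w) \<notin> parcs (graph_of n f))" for v
    using pair_finite_arcs by (auto simp: out_degree_def out_arcs_def)
  then show ?thesis
    unfolding isolated_count_def by (intro arg_cong[where f=card]) auto
qed

lemma concentration_isolated_count:
  fixes p t :: real
  assumes p: "0 \<le> p" "p < 1" and t: "0 < t"
  shows "measure_pmf.prob (edge_field n p)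
      {f. t \<le> \<bar>real (isolated_count (graph_of n f)) - real n * (1 - p) ^ (n - 1)\<bar>}
    \<le> (real n + (1 / (1 - p) ^ 4 - 1) * (real n)\<^sup>2) / t\<^sup>2"
proof -
  define C where "C v = (\<lambda>w. {v, w}) ` ({1..n} - {v})" for v :: nat
  have inj: "inj_on (\<lambda>w. {v, w}) X" for v :: nat and X by (auto simp: inj_on_def doubleton_eq_iff)
  have cardC: "card (C v) = n - 1" if "v \<in> {1..n}" for v
    using that by (simp add: C_def card_image[OF inj])
  define \<mu> where "\<mu> = (\<Sum>v\<in>{1..n}. p ^ card ({} :: nat set set) * (1 - p) ^ card (C v))"
  have \<mu>: "\<mu> = real n * (1 - p) ^ (n - 1)" using cardC by (simp add: \<mu>_def)
  \<comment> \<open>The only edge forbidden by both vertices is \<open>{i, j}\<close>. The exponent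
    4 is the one that isolated edges require, so a single estimate of \<open>1 / (1 - p) ^ 4\<close>
    serves both counts.\<close>
  have CC: "card (C i \<inter> C j) \<le> 4" if "i \<noteq> j" for i j
  proof -
    have "C i \<inter> C j \<subseteq> {{i, j}}" using that by (auto simp: C_def doubleton_eq_iff)
    then have "card (C i \<inter> C j) \<le> card {{i, j}}" by (intro card_mono) auto
    then show ?thesis by simp
  qed
  have "measure_pmf.prob (edge_field n p)
      {f. t \<le> \<bar>real (card {v \<in> {1..n}. (\<forall>e\<in>{}. f e) \<and> (\<forall>e\<in>C v. \<not> f e)}) - \<mu>\<bar>}
    \<le> (\<mu> + (1 / (1 - p) ^ 4 - 1) * \<mu>\<^sup>2) / t\<^sup>2"
    unfolding edge_field_def \<mu>_def
  proof (rule concentration_present_absent[OF finite_vpairs _ p t])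
    show "C i \<subseteq> vpairs n" if "i \<in> {1..n}" for i using that by (auto simp: C_def)
    show "card (C i \<inter> C j) \<le> 4" if "i \<noteq> j" for i j using CC[OF that] .
  qed auto
  also have "\<dots> \<le> (real n + (1 / (1 - p) ^ 4 - 1) * (real n)\<^sup>2) / t\<^sup>2"
  proof -
    have "0 \<le> 1 / (1 - p) ^ 4 - 1" using p by (simp add: power_le_one)
    moreover have "0 \<le> \<mu>" "\<mu> \<le> real n" unfolding \<mu> using p by (auto simp: mult_left_le power_le_one)
    ultimately show ?thesis by (intro divide_right_mono add_mono mult_left_mono power_mono) auto
  qed
  finally show ?thesis by (simp add: isolated_count_graph_of C_def \<mu>)
qed

text \<open>An inclusion is enough, because components of size 2 are to be bounded from above
  only.\<close>

lemma comps_card_2_subset: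
  "{S \<in> comps (graph_of n f). card S = 2} \<subseteq>
   {e \<in> vpairs n. (\<forall>e'\<in>{e}. f e') \<and> (\<forall>e'\<in>{e' \<in> vpairs n. e' \<noteq> e \<and> e' \<inter> e \<noteq> {}}. \<not> f e')}"
proof
  interpret pair_graph "graph_of n f" by (rule pair_graph_graph_of)
  fix S assume "S \<in> {S \<in> comps (graph_of n f). card S = 2}"
  then have S: "S \<in> comps (graph_of n f)" "card S = 2" by auto
  have sub: "S \<subseteq> {1..n}" using comps_subset[OF S(1)] by simp
  then have Sv: "S \<in> vpairs n" using S by (simp add: vpairs_def)
  obtain u v where uv: "S = {u, v}" "u \<noteq> v" using S(2) by (auto simp: card_2_iff)
  have fS: "f S"
  proof (rule ccontr)
    assume no: "\<not> f S"
    \<comment> \<open>Without the edge \<open>S\<close> the singleton \<open>S - {v}\<close> is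
      closed under adjacency and would contain the whole component.\<close>
    have "S \<subseteq> S - {v}"
      by (rule closed_superset_component[OF S(1), of u])
        (use uv no comps_adj[OF S(1)] in auto)
    then show False using uv by auto
  qed
  have "\<not> f e" if "e \<in> vpairs n" "e \<noteq> S" "e \<inter> S \<noteq> {}" for e
  proof
    assume "f e"
    with that obtain x where e: "e \<in> vpairs n" "e \<noteq> S" "f e" "x \<in> e" "x \<in> S" by auto
  obtain y where y: "e = {x, y}" "x \<noteq> y" using e by (auto simp: vpairs_def card_2_iff)
  have "y \<notin> S" using y e uv by auto
  moreover have "(x, y) \<in> parcs (graph_of n f)" using e y by auto
  ultimately show False using comps_adj[OF S(1) \<open>x \<in> S\<close>] by blast
  qed
  then show "S \<in> {e \<in> vpairs n. (\<forall>e'\<in>{e}. f e') \<and> (\<forall>e'\<in>{e' \<in> vpairs n. e' \<noteq> e \<and> e' \<inter> e \<noteq> {}}. \<not> f e')}"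
    using Sv fS by auto
qed

lemma card_vpairs_touching:
  assumes "e \<in> vpairs n"
  shows "card {e' \<in> vpairs n. e' \<noteq> e \<and> e' \<inter> e \<noteq> {}} = 2 * (n - 2)"
proof -
  obtain u v where uv: "e = {u, v}" "u \<noteq> v" "u \<in> {1..n}" "v \<in> {1..n}"
    using assms by (auto simp: vpairs_def card_2_iff)
  have inj: "inj_on (\<lambda>w. {v, w}) X" for v :: nat and X by (auto simp: inj_on_def doubleton_eq_iff)
  let ?W = "{1..n} - {u, v}"
  have eq: "{e' \<in> vpairs n. e' \<noteq> e \<and> e' \<inter> e \<noteq> {}} = (\<lambda>w. {u, w}) ` ?W \<union> (\<lambda>w. {v, w}) ` ?W"
  proof (intro equalityI subsetI)
    fix e' assume "e' \<in> {e' \<in> vpairs n. e' \<noteq> e \<and> e' \<inter> e \<noteq> {}}"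
    then have e': "e' \<in> vpairs n" "e' \<noteq> e" "e' \<inter> e \<noteq> {}" by auto
    then obtain x where x: "x \<in> e'" "x \<in> e" by auto
    obtain y where y: "e' = {x, y}" "x \<noteq> y" using e' x by (auto simp: vpairs_def card_2_iff)
    have "y \<in> ?W" using x y e' uv by auto
    then show "e' \<in> (\<lambda>w. {u, w}) ` ?W \<union> (\<lambda>w. {v, w}) ` ?W" using x y uv by auto
  qed (use uv in \<open>auto simp: doubleton_eq_iff\<close>)
  have "(\<lambda>w. {u, w}) ` ?W \<inter> (\<lambda>w. {v, w}) ` ?W = {}" using uv by (auto simp: doubleton_eq_iff)
  then have "card {e' \<in> vpairs n. e' \<noteq> e \<and> e' \<inter> e \<noteq> {}} = card ?W + card ?W"
    unfolding eq by (subst card_Un_disjoint) (auto simp: card_image[OF inj])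
  also have "card ?W = n - 2" using uv by (subst card_Diff_subset) auto
  finally show ?thesis by simp
qed

text \<open>Such an edge joins an end of \<open>e1\<close> to an end of \<open>e2\<close>, which
  leaves 2 * 2 choices. This is the origin of the exponent 4 in the variance bounds.\<close>

lemma card_meeting_both:
  assumes "e1 \<in> vpairs n" "e2 \<in> vpairs n" "e1 \<inter> e2 = {}"
  shows "card ({e' \<in> vpairs n. e' \<noteq> e1 \<and> e' \<inter> e1 \<noteq> {}} \<inter> {e' \<in> vpairs n. e' \<noteq> e2 \<and> e' \<inter> e2 \<noteq> {}}) \<le> 4"
    (is "card ?X \<le> 4")
proof -
  have "?X \<subseteq> (\<lambda>(x, y). {x, y}) ` (e1 \<times> e2)"
  proof
    fix e assume "e \<in> ?X"
    then obtain x y where xy: "x \<in> e" "x \<in> e1" "y \<in> e" "y \<in> e2" "e \<in> vpairs n" by auto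
    then have "x \<noteq> y" using assms by auto
    then have "e = {x, y}" using xy by (auto simp: vpairs_def card_2_iff)
    then show "e \<in> (\<lambda>(x, y). {x, y}) ` (e1 \<times> e2)" using xy by (intro image_eqI[of _ _ "(x, y)"]) auto
  qed
  moreover have fin: "finite (e1 \<times> e2)"
    using assms by (auto simp: vpairs_def intro: finite_subset[OF _ finite_atLeastAtMost])
  ultimately have "card ?X \<le> card ((\<lambda>(x, y). {x, y}) ` (e1 \<times> e2))" by (intro card_mono) auto
  also have "\<dots> \<le> card (e1 \<times> e2)" using fin by (rule card_image_le)
  also have "\<dots> = 4" using assms by (simp add: vpairs_def card_cartesian_product)
  finally show ?thesis .
qed

lemma concentration_edge_components:
  fixes p t :: real
  assumes p: "0 \<le> p" "p < 1" and t: "0 < t"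
  shows "measure_pmf.prob (edge_field n p)
      {f. t + real n * (real n * p) / 2 * (1 - p) ^ (2 * (n - 2)) \<le> real (card {S \<in> comps (graph_of n f). card S = 2})}
    \<le> (real n * (real n * p) / 2 + (1 / (1 - p) ^ 4 - 1) * (real n * (real n * p) / 2)\<^sup>2) / t\<^sup>2"
proof -
  define C where "C e = {e' \<in> vpairs n. e' \<noteq> e \<and> e' \<inter> e \<noteq> {}}" for e :: "nat set"
  define \<mu> where "\<mu> = (\<Sum>e\<in>vpairs n. p ^ card {e} * (1 - p) ^ card (C e))"
  have cardv: "card (vpairs n) = n choose 2"
    unfolding vpairs_def by (subst n_subsets) auto
  have n2: "real (n choose 2) \<le> real n * real n / 2"
  proof -
    have "2 * (n choose 2) \<le> n * (n - 1)" by (simp add: choose_two)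
    also have "\<dots> \<le> n * n" by simp
    finally have "2 * (n choose 2) \<le> n * n" .
    then have "real (2 * (n choose 2)) \<le> real (n * n)" by (rule of_nat_mono)
    then show ?thesis by simp
  qed
  have \<mu>: "\<mu> = real (n choose 2) * (p * (1 - p) ^ (2 * (n - 2)))"
    by (simp add: \<mu>_def C_def card_vpairs_touching cardv)
  have \<mu>0: "0 \<le> \<mu>" unfolding \<mu> using p by simp
  have \<mu>1: "\<mu> \<le> real n * (real n * p) / 2 * (1 - p) ^ (2 * (n - 2))"
  proof -
    have "\<mu> \<le> real n * real n / 2 * (p * (1 - p) ^ (2 * (n - 2)))"
      unfolding \<mu> by (intro mult_right_mono n2) (use p in auto)
    then show ?thesis by (simp add: mult_ac)
  qed
  also have "\<dots> \<le> real n * (real n * p) / 2" using p by (intro mult_left_le) (auto simp: power_le_one)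
  finally have \<mu>2: "\<mu> \<le> real n * (real n * p) / 2" .
  let ?Y = "\<lambda>f. card {e \<in> vpairs n. (\<forall>e'\<in>{e}. f e') \<and> (\<forall>e'\<in>C e. \<not> f e')}"
  have le: "card {S \<in> comps (graph_of n f). card S = 2} \<le> ?Y f" for f
    unfolding C_def by (intro card_mono comps_card_2_subset) (use finite_vpairs in auto)
  have "measure_pmf.prob (edge_field n p)
      {f. t + real n * (real n * p) / 2 * (1 - p) ^ (2 * (n - 2)) \<le> real (card {S \<in> comps (graph_of n f). card S = 2})}
    \<le> measure_pmf.prob (edge_field n p) {f. t \<le> \<bar>real (?Y f) - \<mu>\<bar>}"
  proof (intro measure_pmf.finite_measure_mono subsetI CollectI; (elim CollectE)?)
    fix f assume "t + real n * (real n * p) / 2 * (1 - p) ^ (2 * (n - 2)) \<le> real (card {S \<in> comps (graph_of n f). card S = 2})"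
    also have "\<dots> \<le> real (?Y f)" using le[of f] by (rule of_nat_mono)
    finally show "t \<le> \<bar>real (?Y f) - \<mu>\<bar>" using \<mu>1 by linarith
  qed simp
  also have "\<dots> \<le> (\<mu> + (1 / (1 - p) ^ 4 - 1) * \<mu>\<^sup>2) / t\<^sup>2"
    unfolding edge_field_def \<mu>_def
  proof (rule concentration_present_absent)
    \<comment> \<open>Two distinct pairs that meet forbid each other, so compatibility leaves only
      disjoint pairs.\<close>
    fix i j assume ij: "i \<in> vpairs n" "j \<in> vpairs n" "i \<noteq> j" and B: "{i} \<inter> C j = {}"
    then have "i \<inter> j = {}" by (auto simp: C_def)
    then show "card (C i \<inter> C j) \<le> 4" unfolding C_def using ij by (intro card_meeting_both) auto
  qed (use p t finite_vpairs in \<open>auto simp: C_def\<close>)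
  also have "\<dots> \<le> (real n * (real n * p) / 2 + (1 / (1 - p) ^ 4 - 1) * (real n * (real n * p) / 2)\<^sup>2) / t\<^sup>2"
  proof -
    have "0 \<le> 1 / (1 - p) ^ 4 - 1" using p by (simp add: power_le_one)
    then show ?thesis using \<mu>0 \<mu>2 by (intro divide_right_mono add_mono mult_left_mono power_mono) auto
  qed
  finally show ?thesis .
qed

section \<open>The threshold constant\<close>

text \<open>Maclaurin's formula with Lagrange remainder; 9 bounds \<open>exp 2\<close> because
  \<open>exp 1 \<le> 3\<close>.\<close>

lemma exp_Taylor_error:
  fixes x :: real
  assumes "\<bar>x\<bar> \<le> 2"
  shows "\<bar>exp x - (\<Sum>m<n. x ^ m / fact m)\<bar> \<le> 9 * \<bar>x\<bar> ^ n / fact n"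
proof -
  obtain t where t: "\<bar>t\<bar> \<le> \<bar>x\<bar>" "exp x = (\<Sum>m<n. x ^ m / fact m) + exp t / fact n * x ^ n"
    using Maclaurin_exp_le by blast
  have "exp t \<le> exp 2" using t assms by simp
  also have "exp 2 = exp (1 :: real) ^ 2" by (simp add: exp_double[symmetric])
  also have "\<dots> \<le> 3 ^ 2" using exp_le by (intro power_mono) auto
  finally have "exp t \<le> 9" by simp
  then have "exp t * \<bar>x\<bar> ^ n / fact n \<le> 9 * \<bar>x\<bar> ^ n / fact n"
    by (intro divide_right_mono mult_right_mono) auto
  then show ?thesis using t(2) by (simp add: abs_mult power_abs)
qed

text \<open>Twelve terms leave an error below 2 * 10^(-7) for arguments of absolute value at most
  1.1919, enough for bounds to six decimals.\<close>

lemma exp_Taylor_12: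
  fixes x :: real
  assumes "\<bar>x\<bar> \<le> 2"
  defines "S \<equiv> 1 + x + x^2/2 + x^3/6 + x^4/24 + x^5/120 + x^6/720 + x^7/5040 + x^8/40320
      + x^9/362880 + x^10/3628800 + x^11/39916800"
  shows "exp x \<le> S + 9 * x ^ 12 / 479001600" "S - 9 * x ^ 12 / 479001600 \<le> exp x"
proof -
  have "S = (\<Sum>m<12. x ^ m / fact m)"
    by (simp add: S_def lessThan_nat_numeral fact_numeral)
  moreover have "9 * \<bar>x\<bar> ^ 12 / fact 12 = 9 * x ^ 12 / 479001600"
    by (simp add: fact_numeral)
  ultimately have "\<bar>exp x - S\<bar> \<le> 9 * x ^ 12 / 479001600"
    using exp_Taylor_error[OF assms(1), of 12] by simp
  then show "exp x \<le> S + 9 * x ^ 12 / 479001600" "S - 9 * x ^ 12 / 479001600 \<le> exp x"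
    unfolding abs_le_iff by linarith+
qed

text \<open>The arguments 0.36192 and 0.361912 bound \<open>x * exp (- x)\<close> from above at
  \<open>x = 1.1918\<close> and from below at \<open>x = 1.1919\<close>. The sign change of
  \<open>thr\<close> then comes from 0.303673 + 0.696338 > 1 and 0.303644 + 0.696344 < 1.\<close>

lemma exp_neg_numeric_bounds:
  "0.303673 \<le> exp (- 1.1918 :: real)" "exp (- 1.1918 :: real) \<le> 0.303675"
  "0.303643 \<le> exp (- 1.1919 :: real)" "exp (- 1.1919 :: real) \<le> 0.303644"
  "0.696338 \<le> exp (- 0.36192 :: real)" "exp (- 0.361912 :: real) \<le> 0.696344"
proof -
  show "0.303673 \<le> exp (- 1.1918 :: real)"
    by (rule order.trans[OF _ exp_Taylor_12(2)]) (simp_all add: power_divide)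
  show "exp (- 1.1918 :: real) \<le> 0.303675"
    by (rule order.trans[OF exp_Taylor_12(1)]) (simp_all add: power_divide)
  show "0.303643 \<le> exp (- 1.1919 :: real)"
    by (rule order.trans[OF _ exp_Taylor_12(2)]) (simp_all add: power_divide)
  show "exp (- 1.1919 :: real) \<le> 0.303644"
    by (rule order.trans[OF exp_Taylor_12(1)]) (simp_all add: power_divide)
  show "0.696338 \<le> exp (- 0.36192 :: real)"
    by (rule order.trans[OF _ exp_Taylor_12(2)]) (simp_all add: power_divide)
  show "exp (- 0.361912 :: real) \<le> 0.696344"
    by (rule order.trans[OF exp_Taylor_12(1)]) (simp_all add: power_divide)
qed

text \<open>The defining equation of \<alpha>, divided by \<open>exp (x * exp (- x))\<close>. With
  \<open>y = exp (- x)\<close>, \<open>thr x = 0\<close> reads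
  \<open>y = 1 - exp (- (x * y))\<close>: the density of isolated vertices coincides with the share
  of the giant component.\<close>

definition thr :: "real \<Rightarrow> real" where
  "thr x = exp (- x) + exp (- (x * exp (- x))) - 1"

lemma thr_eq_0_iff:
  "exp (- x + x * exp (- x)) + 1 = exp (x * exp (- x)) \<longleftrightarrow> thr x = 0"
proof -
  have "thr x = (exp (- x + x * exp (- x)) + 1 - exp (x * exp (- x))) * exp (- (x * exp (- x)))"
    by (simp add: thr_def algebra_simps flip: exp_add)
  then show ?thesis by simp
qed

lemma thr_strict_decreasing:
  assumes "0 < x" "x < y" "y \<le> 2"
  shows "thr y < thr x"
proof (rule DERIV_neg_imp_decreasing[OF assms(2)])
  fix z assume z: "x \<le> z" "z \<le> y"
  have D: "(thr has_real_derivative - exp (- z) * (1 + (1 - z) * exp (- (z * exp (- z))))) (at z)"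
    unfolding thr_def [abs_def] by (auto intro!: derivative_eq_intros simp: algebra_simps)
  \<comment> \<open>The bound \<open>z \<le> 2\<close> enters here; it gives the derivative its
    sign.\<close>
  have "(z - 1) * exp (- (z * exp (- z))) \<le> 1 * exp (- (z * exp (- z)))"
    using z assms by (intro mult_right_mono) auto
  also have "\<dots> < 1" using z assms by simp
  finally have "0 < 1 + (1 - z) * exp (- (z * exp (- z)))" by (simp add: algebra_simps)
  then show "\<exists>d. (thr has_real_derivative d) (at z) \<and> d < 0"
    using D by (intro exI[of _ "- exp (- z) * (1 + (1 - z) * exp (- (z * exp (- z))))"])
      (simp add: mult_less_0_iff)
qed

text \<open>Covers the range beyond 2, where the monotonicity argument stops. The claim amounts to
  \<open>(1 - exp (- x)) * exp y > 1\<close>, and \<open>exp y \<ge> 1 + y\<close> already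
  suffices.\<close>

lemma thr_neg:
  assumes "2 \<le> x" shows "thr x < 0"
proof -
  define y where "y = x * exp (- x)"
  have y: "0 < y" using assms by (simp add: y_def)
  have "x < exp x" using exp_ge_add_one_self[of x] by linarith
  then have "y < 1" by (simp add: y_def exp_minus field_simps)
  \<comment> \<open>The product \<open>(1 - exp (- x)) * (1 + y)\<close> equals 1 plus this
    quantity, since \<open>y = x * exp (- x)\<close>; \<open>x \<ge> 2\<close> and
    \<open>y < 1\<close> make it positive.\<close>
  then have "0 < exp (- x) * (x - 1 - y)" using assms by simp
  then have "1 < (1 - exp (- x)) * (1 + y)" by (simp add: y_def algebra_simps)
  also have "\<dots> \<le> (1 - exp (- x)) * exp y"
    using assms by (intro mult_left_mono exp_ge_add_one_self) auto
  finally have "1 * exp (- y) < (1 - exp (- x)) * exp y * exp (- y)"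
    by (rule mult_strict_right_mono) simp
  then have "exp (- y) < 1 - exp (- x)" by (simp add: mult.assoc flip: exp_add)
  then show ?thesis by (simp add: thr_def y_def)
qed

lemma thr_root_exists:
  obtains \<alpha> where "1.1918 \<le> \<alpha>" "\<alpha> < 1.1919" "thr \<alpha> = 0"
proof -
  have pos: "0 \<le> thr 1.1918"
  proof -
    have "1.1918 * exp (- 1.1918 :: real) \<le> 0.36192" using exp_neg_numeric_bounds(2) by simp
    then have "exp (- 0.36192 :: real) \<le> exp (- (1.1918 * exp (- 1.1918)))" by simp
    then have "0.303673 + 0.696338 - 1 \<le> thr 1.1918"
      unfolding thr_def
      by (intro diff_mono add_mono exp_neg_numeric_bounds(1) order.trans[OF exp_neg_numeric_bounds(5)] order.refl)
    then show ?thesis by (rule order.trans[rotated]) simp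
  qed
  have neg: "thr 1.1919 < 0"
  proof -
    have "0.361912 \<le> 1.1919 * exp (- 1.1919 :: real)" using exp_neg_numeric_bounds(3) by simp
    then have "exp (- (1.1919 * exp (- 1.1919))) \<le> exp (- 0.361912 :: real)" by simp
    then have "thr 1.1919 \<le> 0.303644 + 0.696344 - 1"
      unfolding thr_def
      by (intro diff_mono add_mono exp_neg_numeric_bounds(4) order.trans[OF _ exp_neg_numeric_bounds(6)] order.refl)
    then show ?thesis by (rule order.strict_trans1) simp
  qed
  have "\<exists>x\<ge>1.1918. x \<le> 1.1919 \<and> thr x = 0"
  proof (rule IVT2')
    show "continuous_on {1.1918..1.1919} thr" unfolding thr_def [abs_def] by (intro continuous_intros)
  qed (use pos neg in auto)
  then obtain x where x: "1.1918 \<le> x" "x \<le> 1.1919" "thr x = 0" by auto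
  then have "x < 1.1919" using neg by (cases "x = 1.1919") auto
  then show ?thesis using x that by blast
qed

lemma thr_root_unique:
  assumes "0 < x" "0 < y" "thr x = 0" "thr y = 0" shows "x = y"
proof -
  have "x < 2" "y < 2" using thr_neg[of x] thr_neg[of y] assms by (auto simp: not_le[symmetric])
  then show ?thesis using thr_strict_decreasing[of x y] thr_strict_decreasing[of y x] assms
    by (cases x y rule: linorder_cases) auto
qed

section \<open>Formulas\<close>

lemma finite_fo_free: "finite (fo_free A)"
  by (induction A) auto

text \<open>A plain \<open>Neg\<close> would put quantifiers under a negation. Pushing the negation
  down to the atoms avoids this and exchanges the two kinds of quantifiers, so the alternation
  number is kept.\<close>

fun dual :: "fo \<Rightarrow> fo" where
  "dual (Equal i j) = Neg (Equal i j)"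
| "dual (Adj i j) = Neg (Adj i j)"
| "dual (Neg A) = A"
| "dual (Conj A B) = Disj (dual A) (dual B)"
| "dual (Disj A B) = Conj (dual A) (dual B)"
| "dual (Forall i A) = Exists i (dual A)"
| "dual (Exists i A) = Forall i (dual A)"

lemma sat_dual [simp]: "sat G s (dual A) \<longleftrightarrow> \<not> sat G s A"
  by (induction A arbitrary: s) auto

lemma fo_free_dual [simp]: "fo_free (dual A) = fo_free A"
  by (induction A) auto

lemma quantifier_depth_dual [simp]: "quantifier_depth (dual A) = quantifier_depth A"
  by (induction A) auto

lemma quantifier_free:
  assumes "quantifier_depth A = 0"
  shows "negations_quantifier_free A" "quantifier_chains A = {[]}"
  using assms by (induction A) auto

fun flip :: "quantifier \<Rightarrow> quantifier" where
  "flip Q_all = Q_ex"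
| "flip Q_ex = Q_all"

lemma negations_quantifier_free_dual: "negations_quantifier_free A \<Longrightarrow> negations_quantifier_free (dual A)"
  by (induction A) (auto simp: quantifier_free)

text \<open>At a negation \<open>dual\<close> returns the body unchanged, where nothing is flipped;
  the hypothesis makes the empty chain the only chain of that body.\<close>

lemma quantifier_chains_dual:
  "negations_quantifier_free A \<Longrightarrow> quantifier_chains (dual A) = map flip ` quantifier_chains A"
  by (induction A) (auto simp: quantifier_free image_Un image_image)

lemma quantifier_chains_finite: "finite (quantifier_chains A)"
  and quantifier_chains_nonempty: "quantifier_chains A \<noteq> {}"
  by (induction A) auto

definition all_chains :: "quantifier list set" where
  "all_chains = {qs. set qs \<subseteq> {Q_all}}"

definition ex_all_chains :: "quantifier list set" where
  "ex_all_chains = {ps @ qs |ps qs. set ps \<subseteq> {Q_ex} \<and> set qs \<subseteq> {Q_all}}"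

text \<open>Upper bounds on depth and chains, instead of exact values, make this closed under
  conjunctions of formulas of different depths. With \<open>ex_all_chains\<close> it describes an
  existential block followed by a universal one along every chain.\<close>

definition shape :: "quantifier list set \<Rightarrow> nat \<Rightarrow> fo \<Rightarrow> bool" where
  "shape X d A \<longleftrightarrow> quantifier_depth A \<le> d \<and> negations_quantifier_free A \<and> quantifier_chains A \<subseteq> X"

lemma all_chains_subset: "all_chains \<subseteq> ex_all_chains"
proof
  fix qs assume "qs \<in> all_chains"
  then show "qs \<in> ex_all_chains" unfolding all_chains_def ex_all_chains_def
    by (intro CollectI exI[of _ "[]"] exI[of _ qs]) auto
qed

lemma shape_mono: "shape X d A \<Longrightarrow> X \<subseteq> Y \<Longrightarrow> d \<le> e \<Longrightarrow> shape Y e A"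
  by (auto simp: shape_def)

lemma shape_quantifier_free: "quantifier_depth A = 0 \<Longrightarrow> shape all_chains d A"
  using quantifier_free[of A] by (auto simp: shape_def all_chains_def)

lemma shape_Forall: "shape all_chains d A \<Longrightarrow> shape all_chains (Suc d) (Forall i A)"
  unfolding shape_def all_chains_def by fastforce

lemma shape_Exists: "shape ex_all_chains d A \<Longrightarrow> shape ex_all_chains (Suc d) (Exists i A)"
proof -
  have "Q_ex # qs \<in> ex_all_chains" if qs: "qs \<in> ex_all_chains" for qs
  proof -
    obtain ps rs where "qs = ps @ rs" "set ps \<subseteq> {Q_ex}" "set rs \<subseteq> {Q_all}"
      using qs by (auto simp: ex_all_chains_def)
    then show ?thesis unfolding ex_all_chains_def
      by (intro CollectI exI[of _ "Q_ex # ps"] exI[of _ rs]) auto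
  qed
  then show "shape ex_all_chains d A \<Longrightarrow> shape ex_all_chains (Suc d) (Exists i A)"
    by (auto simp: shape_def)
qed

lemma shape_Conj: "shape X d A \<Longrightarrow> shape X d B \<Longrightarrow> shape X d (Conj A B)"
  by (auto simp: shape_def)

lemma shape_dual: "shape X d A \<Longrightarrow> shape (map flip ` X) d (dual A)"
  by (auto simp: shape_def negations_quantifier_free_dual quantifier_chains_dual)

lemma quantifier_changes_ex_all:
  assumes "qs \<in> ex_all_chains \<union> map flip ` ex_all_chains"
  shows "quantifier_changes qs \<le> 1"
proof -
  obtain ps rs a b where qs: "qs = ps @ rs" "set ps \<subseteq> {a}" "set rs \<subseteq> {b}"
  proof -
    consider ps rs where "qs = ps @ rs" "set ps \<subseteq> {Q_ex}" "set rs \<subseteq> {Q_all}"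
      | ps rs where "qs = map flip ps @ map flip rs" "set ps \<subseteq> {Q_ex}" "set rs \<subseteq> {Q_all}"
      using assms by (auto simp: ex_all_chains_def)
    then show ?thesis
    proof cases
      case 1 then show ?thesis using that by blast
    next
      case (2 ps rs)
      then have "set (map flip ps) \<subseteq> {flip Q_ex}" "set (map flip rs) \<subseteq> {flip Q_all}" by auto
      then show ?thesis using that 2(1) by blast
    qed
  qed
  \<comment> \<open>A change can occur only at the boundary of the two blocks. For empty
    \<open>ps\<close> the truncated difference is 0, which is harmless for an upper bound.\<close>
  have "{i. Suc i < length qs \<and> qs ! i \<noteq> qs ! Suc i} \<subseteq> {length ps - 1}"
  proof
    fix i assume "i \<in> {i. Suc i < length qs \<and> qs ! i \<noteq> qs ! Suc i}"
    then have i: "Suc i < length qs" "qs ! i \<noteq> qs ! Suc i" by auto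
    have "qs ! j = a" if "j < length ps" for j
      using that qs(1) subsetD[OF qs(2) nth_mem[of j ps]] by (simp add: nth_append)
    moreover have "qs ! j = b" if "\<not> j < length ps" "j < length qs" for j
      using that qs(1) subsetD[OF qs(3) nth_mem[of "j - length ps" rs]] by (simp add: nth_append)
    ultimately have "i < length ps" "\<not> Suc i < length ps"
      using i by (metis Suc_lessD not_less_eq less_SucI, metis Suc_lessD)
    then show "i \<in> {length ps - 1}" by auto
  qed
  then have "quantifier_changes qs \<le> card {length ps - 1}"
    unfolding quantifier_changes_def by (intro card_mono) auto
  then show ?thesis by simp
qed

lemma shape_alternation_number:
  assumes "shape (ex_all_chains \<union> map flip ` ex_all_chains) d A"
  shows "alternation_number A \<le> 1"
  unfolding alternation_number_def
proof (intro Max.boundedI)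
  fix c assume "c \<in> quantifier_changes ` quantifier_chains A"
  then obtain qs where "qs \<in> quantifier_chains A" "c = quantifier_changes qs" by auto
  then show "c \<le> 1" using quantifier_changes_ex_all[of qs] assms unfolding shape_def by blast
qed (simp_all add: quantifier_chains_finite quantifier_chains_nonempty)

text \<open>The language has no constant for truth, so the conjunction ends in an explicit formula,
  usually a trivial equation.\<close>

definition conjs :: "fo \<Rightarrow> fo list \<Rightarrow> fo" where
  "conjs A As = foldr Conj As A"

definition exs :: "nat list \<Rightarrow> fo \<Rightarrow> fo" where
  "exs is A = foldr Exists is A"

lemma sat_conjs [simp]: "sat G s (conjs A As) \<longleftrightarrow> sat G s A \<and> (\<forall>B\<in>set As. sat G s B)"
  by (induction As) (auto simp: conjs_def)

lemma fo_free_conjs [simp]: "fo_free (conjs A As) = fo_free A \<union> (\<Union>B\<in>set As. fo_free B)"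
  by (induction As) (auto simp: conjs_def)

lemma shape_conjs: "shape X d A \<Longrightarrow> (\<And>B. B \<in> set As \<Longrightarrow> shape X d B) \<Longrightarrow> shape X d (conjs A As)"
  by (induction As) (auto simp: conjs_def intro: shape_Conj)

lemma quantifier_depth_conjs_0:
  "quantifier_depth (conjs A As) = 0 \<longleftrightarrow> quantifier_depth A = 0 \<and> (\<forall>B\<in>set As. quantifier_depth B = 0)"
  by (induction As) (auto simp: conjs_def)

lemma fo_free_exs [simp]: "fo_free (exs is A) = fo_free A - set is"
  by (induction "is") (auto simp: exs_def)

lemma shape_exs: "shape ex_all_chains d A \<Longrightarrow> shape ex_all_chains (length is + d) (exs is A)"
  by (induction "is") (auto simp: exs_def intro: shape_Exists)

lemma sat_exs:
  "sat G s (exs is A) \<longleftrightarrow>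
    (\<exists>t. (\<forall>i\<in>set is. t i \<in> pverts G) \<and> (\<forall>i. i \<notin> set is \<longrightarrow> t i = s i) \<and> sat G t A)"
proof (induction "is" arbitrary: s)
  case Nil
  have "(\<exists>t. (\<forall>i. t i = s i) \<and> sat G t A) \<longleftrightarrow> sat G s A" by (auto simp: fun_eq_iff[symmetric])
  then show ?case by (simp add: exs_def)
next
  case (Cons i "is")
  have "sat G s (exs (i # is) A) \<longleftrightarrow> (\<exists>v\<in>pverts G. sat G (s(i := v)) (exs is A))"
    by (simp add: exs_def)
  also have "\<dots> \<longleftrightarrow> (\<exists>t. (\<forall>j\<in>set (i # is). t j \<in> pverts G) \<and> (\<forall>j. j \<notin> set (i # is) \<longrightarrow> t j = s j) \<and> sat G t A)"
    (is "?L \<longleftrightarrow> ?R")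
  proof
    assume ?L
    then obtain v t where v: "v \<in> pverts G" and t: "\<forall>j\<in>set is. t j \<in> pverts G"
      "\<forall>j. j \<notin> set is \<longrightarrow> t j = (s(i := v)) j" "sat G t A"
      unfolding Cons.IH by blast
    have "t i \<in> pverts G" using t v by (cases "i \<in> set is") auto
    then show ?R using t by (intro exI[of _ t]) auto
  next
    assume ?R
    then obtain t where t: "\<forall>j\<in>set (i # is). t j \<in> pverts G" "\<forall>j. j \<notin> set (i # is) \<longrightarrow> t j = s j" "sat G t A"
      by blast
    then show ?L unfolding Cons.IH
      by (intro bexI[of _ "t i"] exI[of _ t]) auto
  qed
  finally show ?case .
qed

section \<open>Adding an isolated vertex\<close>

definition isolated :: "'a pair_pre_digraph \<Rightarrow> 'a set" where
  "isolated G = {v \<in> pverts G. \<forall>w. (v, w) \<notin> parcs G \<and> (w, v) \<notin> parcs G}"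

definition add_vertex :: "'a \<Rightarrow> 'a pair_pre_digraph \<Rightarrow> 'a pair_pre_digraph" where
  "add_vertex z G = \<lparr> pverts = insert z (pverts G), parcs = parcs G \<rparr>"

lemma sat_quantifier_free_cong:
  assumes "quantifier_depth A = 0"
    "\<And>i j. i \<in> fo_free A \<Longrightarrow> j \<in> fo_free A \<Longrightarrow> (s i = s j \<longleftrightarrow> t i = t j) \<and> ((s i, s j) \<in> parcs G \<longleftrightarrow> (t i, t j) \<in> parcs H)"
  shows "sat G s A \<longleftrightarrow> sat H t A"
  using assms
proof (induction A)
  case (Conj A B)
  have "sat G s A \<longleftrightarrow> sat H t A" "sat G s B \<longleftrightarrow> sat H t B"
    by (rule Conj.IH; use Conj.prems in simp)+
  then show ?case by simp
next
  case (Disj A B)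
  have "sat G s A \<longleftrightarrow> sat H t A" "sat G s B \<longleftrightarrow> sat H t B"
    by (rule Disj.IH; use Disj.prems in simp)+
  then show ?case by simp
next
  case (Neg A)
  have "sat G s A \<longleftrightarrow> sat H t A" by (rule Neg.IH) (use Neg.prems in simp_all)
  then show ?case by simp
qed auto

context pair_graph begin

lemma isolated_count_isolated: "isolated_count G = card (isolated G)"
proof -
  have "out_degree G v = 0 \<longleftrightarrow> (\<forall>w. (v, w) \<notin> parcs G \<and> (w, v) \<notin> parcs G)" for v
    using pair_finite_arcs arcs_symmetric by (auto simp: out_degree_def out_arcs_def)
  then show ?thesis by (simp add: isolated_count_def isolated_def)
qed

context
  fixes z :: 'a
  assumes z: "z \<notin> pverts G"
begin

text \<open>Positions of the Ehrenfeucht game between the graph and its extension by an isolated vertex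
  from which Duplicator still wins; \<open>X\<close> is the set of variables in use.\<close>

definition matched :: "nat set \<Rightarrow> (nat \<Rightarrow> 'a) \<Rightarrow> (nat \<Rightarrow> 'a) \<Rightarrow> bool" where
  "matched X s t \<longleftrightarrow> (\<forall>i\<in>X. s i \<in> pverts G \<and>
      (if s i \<in> isolated G then t i \<in> insert z (isolated G) else t i = s i)) \<and>
    (\<forall>i\<in>X. \<forall>j\<in>X. s i = s j \<longleftrightarrow> t i = t j)"

lemma matched_mono: "matched Y s t \<Longrightarrow> X \<subseteq> Y \<Longrightarrow> matched X s t"
  unfolding matched_def by (meson subsetD)

lemma matched_adj:
  assumes "matched X s t" "i \<in> X" "j \<in> X"
  shows "(s i, s j) \<in> parcs G \<longleftrightarrow> (t i, t j) \<in> parcs G"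
proof -
  have no: "(x, y) \<notin> parcs G \<and> (y, x) \<notin> parcs G" if "x \<in> insert z (isolated G)" for x y
    using that z in_arcsD1 in_arcsD2 by (auto simp: isolated_def)
  show ?thesis
    using assms no unfolding matched_def by (cases "s i \<in> isolated G"; cases "s j \<in> isolated G") auto
qed

lemma matched_update:
  assumes "matched (X - {i}) s t" "v \<in> pverts G"
    "if v \<in> isolated G then w \<in> insert z (isolated G) else w = v"
    "\<And>j. j \<in> X - {i} \<Longrightarrow> s j = v \<longleftrightarrow> t j = w"
  shows "matched X (s(i := v)) (t(i := w))"
proof -
  have "s j = v \<longleftrightarrow> t j = w" if "j \<in> X" "j \<noteq> i" for j using assms(4) that by simp
  moreover have "v = s j \<longleftrightarrow> w = t j" if "j \<in> X" "j \<noteq> i" for j using assms(4)[of j] that by auto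
  ultimately show ?thesis using assms(1,2,3) unfolding matched_def by (simp split: if_splits)
qed

lemma finite_isolated: "finite (isolated G)"
  using pair_finite_verts by (simp add: isolated_def)

text \<open>The rounds left, including the present one, plus the number of distinct occupied
  vertices stay within the supply of isolated vertices, plus one if there is an edge. A move in
  \<open>G\<close> always has an answer, since the extension has one more isolated vertex. A move in
  the extension can fail to have a \<open>matched\<close> answer only when all isolated vertices of
  \<open>G\<close> are occupied, and then it is the last round.\<close>

lemma game_step:
  assumes m: "matched (X - {i}) s t" and X: "finite X"
    and bound: "Suc d + card (s ` (X - {i})) \<le> card (isolated G) + (if parcs G = {} then 0 else 1)"
  shows "v \<in> pverts G \<Longrightarrow> \<exists>w\<in>insert z (pverts G). matched X (s(i := v)) (t(i := w))"
    and "w \<in> insert z (pverts G) \<Longrightarrow> (\<exists>v\<in>pverts G. matched X (s(i := v)) (t(i := w))) \<or>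
      (d = 0 \<and> parcs G \<noteq> {} \<and> s ` (X - {i}) = isolated G \<and> w \<in> insert z (isolated G) \<and> w \<notin> t ` (X - {i}))"
proof -
  define Y where "Y = X - {i}"
  have Y: "finite Y" "matched Y s t" using X m by (auto simp: Y_def)
  have iff: "s j = s k \<longleftrightarrow> t j = t k" if "j \<in> Y" "k \<in> Y" for j k
    using Y(2) that unfolding matched_def by blast
  have sV: "s j \<in> pverts G" if "j \<in> Y" for j using Y(2) that unfolding matched_def by blast
  have iso: "t j \<in> insert z (isolated G)" if "j \<in> Y" "s j \<in> isolated G" for j
    using Y(2) that unfolding matched_def by (auto split: if_splits)
  have niso: "t j = s j" if "j \<in> Y" "s j \<notin> isolated G" for j
    using Y(2) that unfolding matched_def by (auto split: if_splits)
  have known: "matched X (s(i := s j)) (t(i := t j))" if "j \<in> Y" for j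
  proof (rule matched_update)
    show "if s j \<in> isolated G then t j \<in> insert z (isolated G) else t j = s j"
      using iso niso that by simp
  qed (use m iff sV that in \<open>auto simp: Y_def\<close>)
  have new: "matched X (s(i := v)) (t(i := w))"
    if "v \<in> pverts G" "if v \<in> isolated G then w \<in> insert z (isolated G) else w = v" "v \<notin> s ` Y" "w \<notin> t ` Y" for v w
    using that m by (intro matched_update) (auto simp: Y_def)
  show "\<exists>w\<in>insert z (pverts G). matched X (s(i := v)) (t(i := w))" if v: "v \<in> pverts G"
  proof (cases "v \<in> s ` Y")
    case True
    then obtain j where j: "j \<in> Y" "v = s j" by auto
    have "t j \<in> insert z (pverts G)" using iso niso sV j(1) by (cases "s j \<in> isolated G") (auto simp: isolated_def)
    then show ?thesis using known[OF j(1)] j(2) by blast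
  next
    case False
    show ?thesis
    proof (cases "v \<in> isolated G")
      case True
      define J where "J = {j \<in> Y. s j \<in> isolated G}"
      \<comment> \<open>On \<open>J\<close> the map \<open>t\<close> factors through
        \<open>s\<close>, so the extension has no more occupied vertices there than
        \<open>G\<close>.\<close>
      have "t ` J = (\<lambda>x. t (inv_into J s x)) ` s ` J"
      proof -
        have "t (inv_into J s (s j)) = t j" if "j \<in> J" for j
          using iff[of "inv_into J s (s j)" j] f_inv_into_f[of "s j" s J] inv_into_into[of "s j" s J] that
          by (auto simp: J_def)
        then show ?thesis by (simp add: image_image)
      qed
      then have "card (t ` J) \<le> card (s ` J)" using Y by (simp add: J_def card_image_le)
      also have "\<dots> \<le> card (isolated G - {v})"
        using False finite_isolated by (intro card_mono) (auto simp: J_def)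
      also have "\<dots> < card (isolated G)" using True finite_isolated by (rule card_Diff1_less[rotated])
      also have "\<dots> < card (insert z (isolated G))" using z finite_isolated by (simp add: isolated_def)
      finally have "\<not> insert z (isolated G) \<subseteq> t ` J"
        using card_mono[of "t ` J" "insert z (isolated G)"] Y(1) by (auto simp: J_def)
      then obtain w where w: "w \<in> insert z (isolated G)" "w \<notin> t ` J" by auto
      have "w \<notin> t ` Y"
      proof
        assume "w \<in> t ` Y"
        then obtain j where j: "j \<in> Y" "w = t j" by auto
        then have "s j \<notin> isolated G" using w by (auto simp: J_def)
        then show False using niso[of j] sV[of j] j w z by auto
      qed
      then have "matched X (s(i := v)) (t(i := w))" using new v True w False by simp
      then show ?thesis using w by (auto simp: isolated_def)
    next
      case niv: False
      have "v \<notin> t ` Y"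
      proof
        assume "v \<in> t ` Y"
        then obtain j where j: "j \<in> Y" "v = t j" by auto
        show False
        proof (cases "s j \<in> isolated G")
          case True
          then show False using iso[of j] j niv v z by auto
        next
          case f: False
          then show False using niso[of j] j False by auto
        qed
      qed
      then have "matched X (s(i := v)) (t(i := v))" using new v niv False by simp
      then show ?thesis using v by auto
    qed
  qed
  show "(\<exists>v\<in>pverts G. matched X (s(i := v)) (t(i := w))) \<or>
      (d = 0 \<and> parcs G \<noteq> {} \<and> s ` (X - {i}) = isolated G \<and> w \<in> insert z (isolated G) \<and> w \<notin> t ` (X - {i}))"
    if w: "w \<in> insert z (pverts G)"
  proof (cases "w \<in> t ` Y")
    case True
    then obtain j where "j \<in> Y" "w = t j" by auto
    then have "matched X (s(i := s j)) (t(i := w))" "s j \<in> pverts G" using known[of j] sV[of j] by auto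
    then show ?thesis by blast
  next
    case wY: False
    show ?thesis
    proof (cases "w \<in> insert z (isolated G)")
      case True
      show ?thesis
      proof (cases "isolated G \<subseteq> s ` Y")
        case False
        then obtain v where v: "v \<in> isolated G" "v \<notin> s ` Y" by auto
        then have "matched X (s(i := v)) (t(i := w))" using new True wY by (auto simp: isolated_def)
        then show ?thesis using v by (auto simp: isolated_def)
      next
        case sub: True
        \<comment> \<open>With all isolated vertices of \<open>G\<close> occupied, the bound leaves
          a single round, and only if there is an edge. The cardinalities then agree, so nothing
          else is occupied.\<close>
        have le: "card (isolated G) \<le> card (s ` Y)" using sub Y by (intro card_mono) auto
        then have "d = 0" "parcs G \<noteq> {}" "card (s ` Y) = card (isolated G)"
          using bound unfolding Y_def by (auto split: if_splits)
        moreover then have "s ` Y = isolated G"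
          using card_subset_eq[of "s ` Y" "isolated G"] sub Y by auto
        ultimately show ?thesis using True wY by (simp add: Y_def)
      qed
    next
      case False
      then have wV: "w \<in> pverts G" using w by auto
      have "w \<notin> s ` Y" using niso wY False by force
      then have "matched X (s(i := w)) (t(i := w))" using new wV False wY by simp
      then show ?thesis using wV by auto
    qed
  qed
qed

text \<open>In the exceptional case of \<open>game_step\<close> the answer is an end
  \<open>a\<close> of an edge. This breaks \<open>matched\<close>, but the formula left is
  quantifier free and all other occupied vertices are isolated, so its atoms cannot tell
  \<open>a\<close> from an isolated vertex. This is how an edge buys Duplicator one more
  round.\<close>

lemma game_quantifier:
  assumes IH: "\<And>s t. matched (fo_free A) s t \<Longrightarrow>
      quantifier_depth A + card (s ` fo_free A) \<le> card (isolated G) + (if parcs G = {} then 0 else 1) \<Longrightarrow>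
      sat G s A \<longleftrightarrow> sat (add_vertex z G) t A"
    and m: "matched (fo_free A - {i}) s t"
    and bound: "Suc (quantifier_depth A) + card (s ` (fo_free A - {i})) \<le> card (isolated G) + (if parcs G = {} then 0 else 1)"
  shows "v \<in> pverts G \<Longrightarrow> \<exists>w\<in>insert z (pverts G). sat G (s(i := v)) A \<longleftrightarrow> sat (add_vertex z G) (t(i := w)) A"
    and "w \<in> insert z (pverts G) \<Longrightarrow> \<exists>v\<in>pverts G. sat G (s(i := v)) A \<longleftrightarrow> sat (add_vertex z G) (t(i := w)) A"
proof -
  have card: "quantifier_depth A + card (s(i := v) ` fo_free A) \<le> card (isolated G) + (if parcs G = {} then 0 else 1)" for v
  proof -
    have "s(i := v) ` fo_free A \<subseteq> insert v (s ` (fo_free A - {i}))" by auto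
    then have "card (s(i := v) ` fo_free A) \<le> card (insert v (s ` (fo_free A - {i})))"
      by (intro card_mono) (auto simp: finite_fo_free)
    also have "\<dots> \<le> Suc (card (s ` (fo_free A - {i})))" by (rule card_insert_le_m1) auto
    finally show ?thesis using bound by linarith
  qed
  note step = game_step[OF m finite_fo_free bound]
  show "\<exists>w\<in>insert z (pverts G). sat G (s(i := v)) A \<longleftrightarrow> sat (add_vertex z G) (t(i := w)) A" if "v \<in> pverts G"
    using step(1)[OF that] IH card by blast
  show "\<exists>v\<in>pverts G. sat G (s(i := v)) A \<longleftrightarrow> sat (add_vertex z G) (t(i := w)) A" if w: "w \<in> insert z (pverts G)"
    using step(2)[OF w]
  proof (elim disjE conjE)
    assume "\<exists>v\<in>pverts G. matched (fo_free A) (s(i := v)) (t(i := w))"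
    then show ?thesis using IH card by blast
  next
    assume last: "quantifier_depth A = 0" "parcs G \<noteq> {}" "s ` (fo_free A - {i}) = isolated G"
      "w \<in> insert z (isolated G)" "w \<notin> t ` (fo_free A - {i})"
    obtain a b where ab: "(a, b) \<in> parcs G" using last(2) by auto
    then have a: "a \<in> pverts G" "a \<notin> isolated G" using in_arcsD1 by (auto simp: isolated_def)
    have noG: "(x, y) \<notin> parcs G \<and> (y, x) \<notin> parcs G" if "x \<in> insert z (isolated G)" for x y
      using that z in_arcsD1 in_arcsD2 by (auto simp: isolated_def)
    have sj: "s j \<in> isolated G" "s j \<noteq> a" "t j \<in> insert z (isolated G)" "t j \<noteq> w" if "j \<in> fo_free A" "j \<noteq> i" for j
    proof -
      show sj: "s j \<in> isolated G" using last(3) that by auto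
      then show "s j \<noteq> a" using a by auto
      show "t j \<in> insert z (isolated G)" using m sj that unfolding matched_def by (auto split: if_splits)
      show "t j \<noteq> w" using last(5) that by auto
    qed
    have "sat G (s(i := a)) A \<longleftrightarrow> sat (add_vertex z G) (t(i := w)) A"
    proof (rule sat_quantifier_free_cong[OF last(1)])
      fix j k assume jk: "j \<in> fo_free A" "k \<in> fo_free A"
      have iff: "s j = s k \<longleftrightarrow> t j = t k" if "j \<noteq> i" "k \<noteq> i"
        using m jk that unfolding matched_def by blast
      have "((s(i := a)) j, (s(i := a)) k) \<notin> parcs G"
        using sj(1)[OF jk(1)] sj(1)[OF jk(2)] noG no_loops'[of a a] by (cases "j = i"; cases "k = i") auto
      moreover have "((t(i := w)) j, (t(i := w)) k) \<notin> parcs G"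
        using sj(3)[OF jk(1)] noG last(4) by (cases "j = i") auto
      moreover have "(s(i := a)) j = (s(i := a)) k \<longleftrightarrow> (t(i := w)) j = (t(i := w)) k"
        using sj(2,4)[OF jk(1)] sj(2,4)[OF jk(2)] iff by (cases "j = i"; cases "k = i") auto
      ultimately show "((s(i := a)) j = (s(i := a)) k \<longleftrightarrow> (t(i := w)) j = (t(i := w)) k) \<and>
        (((s(i := a)) j, (s(i := a)) k) \<in> parcs G \<longleftrightarrow> ((t(i := w)) j, (t(i := w)) k) \<in> parcs (add_vertex z G))"
        by (simp add: add_vertex_def)
    qed
    then show ?thesis using a by blast
  qed
qed

text \<open>Variables may be quantified again, so the invariant counts the distinct values of the
  free variables in place of the rounds already played. Passing to a subformula of a conjunction or
  disjunction can only lower this count.\<close>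

lemma sat_add_vertex:
  assumes "matched (fo_free A) s t"
    and "quantifier_depth A + card (s ` fo_free A) \<le> card (isolated G) + (if parcs G = {} then 0 else 1)"
  shows "sat G s A \<longleftrightarrow> sat (add_vertex z G) t A"
  using assms
proof (induction A arbitrary: s t)
  case (Equal i j) then show ?case by (auto simp: matched_def)
next
  case (Adj i j) then show ?case using matched_adj[OF Adj.prems(1), of i j] by (simp add: add_vertex_def)
next
  case (Neg A) then show ?case by auto
next
  case (Conj A B)
  have "card (s ` fo_free A) \<le> card (s ` fo_free (Conj A B))" "card (s ` fo_free B) \<le> card (s ` fo_free (Conj A B))"
    by (intro card_mono; auto simp: finite_fo_free)+
  then have "sat G s A \<longleftrightarrow> sat (add_vertex z G) t A" "sat G s B \<longleftrightarrow> sat (add_vertex z G) t B"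
    using Conj.prems by (intro Conj.IH; auto intro: matched_mono)+
  then show ?case by simp
next
  case (Disj A B)
  have "card (s ` fo_free A) \<le> card (s ` fo_free (Disj A B))" "card (s ` fo_free B) \<le> card (s ` fo_free (Disj A B))"
    by (intro card_mono; auto simp: finite_fo_free)+
  then have "sat G s A \<longleftrightarrow> sat (add_vertex z G) t A" "sat G s B \<longleftrightarrow> sat (add_vertex z G) t B"
    using Disj.prems by (intro Disj.IH; auto intro: matched_mono)+
  then show ?case by simp
next
  case (Forall i A)
  have m: "matched (fo_free A - {i}) s t"
    and b: "Suc (quantifier_depth A) + card (s ` (fo_free A - {i})) \<le> card (isolated G) + (if parcs G = {} then 0 else 1)"
    using Forall.prems by auto
  have V: "pverts (add_vertex z G) = insert z (pverts G)" by (simp add: add_vertex_def)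
  show ?case unfolding sat.simps V using game_quantifier[OF Forall.IH m b] by blast
next
  case (Exists i A)
  have m: "matched (fo_free A - {i}) s t"
    and b: "Suc (quantifier_depth A) + card (s ` (fo_free A - {i})) \<le> card (isolated G) + (if parcs G = {} then 0 else 1)"
    using Exists.prems by auto
  have V: "pverts (add_vertex z G) = insert z (pverts G)" by (simp add: add_vertex_def)
  show ?case unfolding sat.simps V using game_quantifier[OF Exists.IH m b] by blast
qed

end

lemma pair_graph_add_vertex: "pair_graph (add_vertex z G)"
proof
  show "symmetric (with_proj (add_vertex z G))"
    using arcs_symmetric by (auto simp: symmetric_def sym_def add_vertex_def)
qed (use pair_finite_verts pair_finite_arcs arc_fst_in_verts arc_snd_in_verts pair_no_loops in \<open>auto simp: add_vertex_def\<close>)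

end

text \<open>A sentence of smaller depth would remain true after adding an isolated vertex, although
  the number of vertices has changed.\<close>

lemma defines_graph_depth_ge:
  fixes G :: "nat pair_pre_digraph"
  assumes G: "pair_graph G" and A: "defines_graph A G"
  shows "isolated_count G + (if parcs G = {} then 1 else 2) \<le> quantifier_depth A"
proof (rule ccontr)
  interpret pair_graph G by fact
  assume "\<not> ?thesis"
  then have d: "quantifier_depth A \<le> card (isolated G) + (if parcs G = {} then 0 else 1)"
    by (auto simp: isolated_count_isolated split: if_splits)
  obtain z where z: "z \<notin> pverts G" using ex_new_if_finite[OF infinite_UNIV_nat pair_finite_verts] by auto
  have fr: "fo_free A = {}" using A by (simp add: defines_graph_def fo_sentence_def)
  have "sat G s A" for s using A by (simp add: defines_graph_def models_def)
  then have "sat (add_vertex z G) t A" for t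
    using sat_add_vertex[OF z, of A t t] d by (simp add: fr matched_def[OF z])
  then have "add_vertex z G \<Turnstile> A" by (simp add: models_def)
  moreover have "\<not> digraph_iso (with_proj (add_vertex z G)) (with_proj G)"
  proof
    assume "digraph_iso (with_proj (add_vertex z G)) (with_proj G)"
    then obtain f where f: "pre_digraph.digraph_isomorphism (with_proj (add_vertex z G)) f"
      "with_proj G = app_iso f (with_proj (add_vertex z G))" by (auto simp: digraph_iso_def)
    have "card (verts (with_proj G)) = card (verts (with_proj (add_vertex z G)))"
      unfolding f(2) using card_verts_iso[OF f(1)] by simp
    then show False using z pair_finite_verts by (simp add: add_vertex_def)
  qed
  ultimately show False using A pair_graph_add_vertex unfolding defines_graph_def by blast
qed

section \<open>Isomorphism\<close>

text \<open>A digraph isomorphism carries separate maps for vertices, arcs, tails and heads. When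
  tail and head are the projections on both sides, the arc map is forced by the vertex map.\<close>

lemma digraph_iso_projections_iff:
  assumes wf: "wf_digraph A" and A: "tail A = fst" "head A = snd" and B: "tail B = fst" "head B = snd"
    and wfB: "wf_digraph B"
  shows "digraph_iso A B \<longleftrightarrow> (\<exists>h. bij_betw h (verts A) (verts B) \<and>
     (\<forall>u\<in>verts A. \<forall>v\<in>verts A. (u, v) \<in> arcs A \<longleftrightarrow> (h u, h v) \<in> arcs B))" (is "_ \<longleftrightarrow> (\<exists>h. ?P h)")
proof
  assume "digraph_iso A B"
  then obtain f where f: "pre_digraph.digraph_isomorphism A f" "B = app_iso f A" by (auto simp: digraph_iso_def)
  note d = f(1)[unfolded pre_digraph.digraph_isomorphism_def A]
  have arcs: "iso_arcs f a = map_prod (iso_verts f) (iso_verts f) a" if "a \<in> arcs A" for a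
  proof -
    have "iso_tail f = fst" "iso_head f = snd" using B f(2) by auto
    then show ?thesis using d that by (cases a) (auto simp: prod_eq_iff)
  qed
  have "bij_betw (iso_verts f) (verts A) (verts B)" using d f(2) by (auto simp: bij_betw_def)
  moreover have "(u, v) \<in> arcs A \<longleftrightarrow> (iso_verts f u, iso_verts f v) \<in> arcs B"
    if uv: "u \<in> verts A" "v \<in> verts A" for u v
  proof
    assume "(u, v) \<in> arcs A"
    then show "(iso_verts f u, iso_verts f v) \<in> arcs B" using arcs[of "(u, v)"] f(2) by force
  next
    assume "(iso_verts f u, iso_verts f v) \<in> arcs B"
    then obtain x y where xy: "(x, y) \<in> arcs A" "iso_verts f x = iso_verts f u" "iso_verts f y = iso_verts f v"
      using f(2) arcs by force
    have "x \<in> verts A" "y \<in> verts A" using wf_digraph.wellformed[OF wf xy(1)] A by auto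
    then have "x = u" "y = v" using xy uv d by (auto dest: inj_onD)
    then show "(u, v) \<in> arcs A" using xy by simp
  qed
  ultimately show "\<exists>h. ?P h" by blast
next
  assume "\<exists>h. ?P h"
  then obtain h where h: "bij_betw h (verts A) (verts B)"
    "\<And>u v. u \<in> verts A \<Longrightarrow> v \<in> verts A \<Longrightarrow> (u, v) \<in> arcs A \<longleftrightarrow> (h u, h v) \<in> arcs B" by blast
  define f where "f = \<lparr>iso_verts = h, iso_arcs = map_prod h h, iso_head = snd, iso_tail = fst\<rparr>"
  have inj: "inj_on h (verts A)" using h(1) by (simp add: bij_betw_def)
  have sub: "arcs A \<subseteq> verts A \<times> verts A" using wf_digraph.wellformed[OF wf] A by fastforce
  have "inj_on (map_prod h h) (arcs A)"
    using inj_on_subset[OF map_prod_inj_on[OF inj inj] sub] .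
  then have iso: "pre_digraph.digraph_isomorphism A f"
    using wf inj by (auto simp: pre_digraph.digraph_isomorphism_def f_def A)
  have subB: "arcs B \<subseteq> verts B \<times> verts B" using wf_digraph.wellformed[OF wfB] B by fastforce
  have "map_prod h h ` arcs A = arcs B"
  proof (intro equalityI subsetI)
    fix e assume "e \<in> map_prod h h ` arcs A"
    then obtain u v where "(u, v) \<in> arcs A" "e = (h u, h v)" by auto
    then show "e \<in> arcs B" using h(2)[of u v] sub by auto
  next
    fix e assume e: "e \<in> arcs B"
    then obtain x y where xy: "e = (x, y)" "x \<in> verts B" "y \<in> verts B" using subB by (cases e) auto
    then obtain u v where uv: "u \<in> verts A" "x = h u" "v \<in> verts A" "y = h v"
      using h(1) by (metis bij_betw_imp_surj_on imageE)
    then show "e \<in> map_prod h h ` arcs A" using h(2)[of u v] e xy by (intro image_eqI[of _ _ "(u, v)"]) auto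
  qed
  then have "B = app_iso f A"
    using h(1) B by (intro pre_digraph.equality) (auto simp: f_def bij_betw_def)
  then show "digraph_iso A B" using iso by (auto simp: digraph_iso_def)
qed

lemma (in pair_graph) induced_iso_iff:
  "digraph_iso (with_proj G \<restriction> S) (with_proj G \<restriction> T) \<longleftrightarrow> (\<exists>h. bij_betw h S T \<and>
     (\<forall>u\<in>S. \<forall>v\<in>S. (u, v) \<in> parcs G \<longleftrightarrow> (h u, h v) \<in> parcs G))" (is "?L \<longleftrightarrow> (\<exists>h. ?P h)")
proof -
  have "?L \<longleftrightarrow> (\<exists>h. bij_betw h S T \<and>
     (\<forall>u\<in>S. \<forall>v\<in>S. (u, v) \<in> arcs (with_proj G \<restriction> S) \<longleftrightarrow> (h u, h v) \<in> arcs (with_proj G \<restriction> T)))"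
    using digraph_iso_projections_iff[OF wellformed_induce_subgraph[of S] _ _ _ _ wellformed_induce_subgraph[of T]]
    by (simp add: induce_subgraph_def)
  also have "\<dots> \<longleftrightarrow> (\<exists>h. ?P h)"
  proof (intro iff_exI conj_cong refl ball_cong)
    fix h u v assume "bij_betw h S T" "u \<in> S" "v \<in> S"
    then have "h u \<in> T" "h v \<in> T" by (auto simp: bij_betwE)
    with \<open>u \<in> S\<close> \<open>v \<in> S\<close> show "((u, v) \<in> arcs (with_proj G \<restriction> S)) = ((h u, h v) \<in> arcs (with_proj G \<restriction> T))
       \<longleftrightarrow> ((u, v) \<in> parcs G) = ((h u, h v) \<in> parcs G)"
      by simp
  qed
  finally show ?thesis .
qed

lemma digraph_iso_with_proj_iff:
  assumes "pair_graph G" "pair_graph H"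
  shows "digraph_iso (with_proj G) (with_proj H) \<longleftrightarrow> (\<exists>h. bij_betw h (pverts G) (pverts H) \<and>
     (\<forall>u\<in>pverts G. \<forall>v\<in>pverts G. (u, v) \<in> parcs G \<longleftrightarrow> (h u, h v) \<in> parcs H))"
proof -
  interpret G: pair_graph G by fact
  interpret H: pair_graph H by fact
  show ?thesis by (subst digraph_iso_projections_iff) (simp_all add: G.wf_digraph_axioms H.wf_digraph_axioms)
qed

section \<open>Ordered patterns\<close>

text \<open>In a searchable pattern every vertex but the first has an earlier neighbour. This makes
  connectedness visible without quantification over paths.\<close>

definition searchable :: "nat \<Rightarrow> (nat \<times> nat) set \<Rightarrow> bool" where
  "searchable m R \<longleftrightarrow> 0 < m \<and> (\<forall>j<m. 0 < j \<longrightarrow> (\<exists>i<j. (i, j) \<in> R))"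

definition enum_of :: "'a pair_pre_digraph \<Rightarrow> nat \<Rightarrow> (nat \<times> nat) set \<Rightarrow> (nat \<Rightarrow> 'a) \<Rightarrow> 'a set \<Rightarrow> bool" where
  "enum_of G m R h S \<longleftrightarrow> bij_betw h {..<m} S \<and> (\<forall>i<m. \<forall>j<m. (i, j) \<in> R \<longleftrightarrow> (h i, h j) \<in> parcs G)"

definition fits :: "'a pair_pre_digraph \<Rightarrow> nat \<Rightarrow> (nat \<times> nat) set \<Rightarrow> 'a set \<Rightarrow> bool" where
  "fits G m R S \<longleftrightarrow> (\<exists>h. enum_of G m R h S)"

definition fit_count :: "'a pair_pre_digraph \<Rightarrow> nat \<Rightarrow> (nat \<times> nat) set \<Rightarrow> nat" where
  "fit_count G m R = card {S \<in> comps G. fits G m R S}"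

lemma fits_card: "fits G m R S \<Longrightarrow> card S = m"
  unfolding fits_def enum_of_def using bij_betw_same_card by fastforce

lemma fits_transfer:
  assumes "fits G m R S" "fits H m R T"
  obtains h where "bij_betw h S T" "\<And>u v. u \<in> S \<Longrightarrow> v \<in> S \<Longrightarrow> (u, v) \<in> parcs G \<longleftrightarrow> (h u, h v) \<in> parcs H"
proof -
  obtain a b where a: "enum_of G m R a S" and b: "enum_of H m R b T" using assms by (auto simp: fits_def)
  have bij: "bij_betw a {..<m} S" "bij_betw b {..<m} T" using a b by (auto simp: enum_of_def)
  define h where "h = b \<circ> inv_into {..<m} a"
  have "bij_betw h S T" unfolding h_def by (rule bij_betw_trans[OF bij_betw_inv_into[OF bij(1)] bij(2)])
  moreover have "(u, v) \<in> parcs G \<longleftrightarrow> (h u, h v) \<in> parcs H" if uv: "u \<in> S" "v \<in> S" for u v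
  proof -
    obtain i j where "i < m" "u = a i" "j < m" "v = a j"
      using bij(1) uv by (metis bij_betw_imp_surj_on imageE lessThan_iff)
    moreover then have "h u = b i" "h v = b j"
      using bij(1) by (auto simp: h_def bij_betw_def inv_into_f_f)
    ultimately show ?thesis using a b by (auto simp: enum_of_def)
  qed
  ultimately show ?thesis using that by blast
qed

lemma fits_iso:
  assumes "fits G m R S" "bij_betw h S T" "\<And>u v. u \<in> S \<Longrightarrow> v \<in> S \<Longrightarrow> (u, v) \<in> parcs G \<longleftrightarrow> (h u, h v) \<in> parcs H"
  shows "fits H m R T"
proof -
  obtain a where a: "enum_of G m R a S" using assms by (auto simp: fits_def)
  then have "bij_betw (h \<circ> a) {..<m} T" using assms(2) by (auto simp: enum_of_def intro: bij_betw_trans)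
  moreover have "a i \<in> S" if "i < m" for i using a that by (auto simp: enum_of_def bij_betwE)
  ultimately have "enum_of H m R (h \<circ> a) T" using a assms(3) by (auto simp: enum_of_def)
  then show ?thesis by (auto simp: fits_def)
qed

text \<open>One common pattern is already an isomorphism, so it forces agreement on all patterns:
  the set of all patterns that fit determines the isomorphism type as soon as it is
  nonempty.\<close>

lemma fits_same:
  assumes "fits G m R S" "fits H m R T" "fits G k Q S" shows "fits H k Q T"
proof -
  obtain h where "bij_betw h S T" "\<And>u v. u \<in> S \<Longrightarrow> v \<in> S \<Longrightarrow> (u, v) \<in> parcs G \<longleftrightarrow> (h u, h v) \<in> parcs H"
    using fits_transfer[OF assms(1,2)] by blast
  then show ?thesis by (rule fits_iso[OF assms(3)])
qed

text \<open>Only some earlier neighbour is prescribed and all other adjacencies are left open, so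
  existence tests the size of a component and not its type.\<close>

definition search_seq :: "'a pair_pre_digraph \<Rightarrow> nat \<Rightarrow> (nat \<Rightarrow> 'a) \<Rightarrow> bool" where
  "search_seq G k t \<longleftrightarrow> (\<forall>i<k. t i \<in> pverts G) \<and> inj_on t {..<k} \<and>
     (\<forall>j<k. 0 < j \<longrightarrow> (\<exists>i<j. (t i, t j) \<in> parcs G))"

context pair_graph begin

lemma search_seq_reach:
  assumes "search_seq G k t" "j < k" shows "t 0 \<rightarrow>\<^sup>*\<^bsub>with_proj G\<^esub> t j"
  using assms(2)
proof (induction j rule: less_induct)
  case (less j)
  show ?case
  proof (cases "j = 0")
    case True
    then show ?thesis using assms less.prems by (auto simp: search_seq_def)
  next
    case False
    then obtain i where "i < j" "(t i, t j) \<in> parcs G" using assms less.prems by (auto simp: search_seq_def)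
    then show ?thesis using less by (meson less_trans reachable_adj_trans with_proj_simps(3))
  qed
qed

lemma search_seq_component:
  assumes "search_seq G k t" "0 < k"
  obtains S where "S \<in> comps G" "t ` {..<k} \<subseteq> S"
proof -
  have "t 0 \<in> pverts G" using assms by (auto simp: search_seq_def)
  then have "{v. t 0 \<rightarrow>\<^sup>*\<^bsub>with_proj G\<^esub> v} \<in> comps G" by (auto simp: comps_conv)
  then show ?thesis using that search_seq_reach[OF assms(1)] by blast
qed

lemma search_seq_exists:
  assumes S: "S \<in> comps G" and k: "0 < k" "k \<le> card S"
  shows "\<exists>t. search_seq G k t \<and> t ` {..<k} \<subseteq> S"
  using k
proof (induction k)
  case (Suc k)
  show ?case
  proof (cases "k = 0")
    case True
    obtain v where "v \<in> S" using comps_nonempty[OF S] by auto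
    then show ?thesis using True comps_subset[OF S]
      by (intro exI[of _ "\<lambda>_. v"]) (auto simp: search_seq_def inj_on_def)
  next
    case False
    then obtain t where t: "search_seq G k t" "t ` {..<k} \<subseteq> S" using Suc by auto
    \<comment> \<open>Otherwise the vertices found so far would be closed under adjacency and
      contain \<open>S\<close>, which has more than \<open>k\<close> elements.\<close>
    have "\<exists>i<k. \<exists>w. (t i, w) \<in> parcs G \<and> w \<notin> t ` {..<k}"
    proof (rule ccontr)
      assume no: "\<not> ?thesis"
      have "S \<subseteq> t ` {..<k}"
        by (rule closed_superset_component[OF S, of "t 0"]) (use False t no in auto)
      then have "card S \<le> card (t ` {..<k})" by (intro card_mono) auto
      also have "\<dots> \<le> k" using card_image_le[of "{..<k}" t] by simp
      finally show False using Suc.prems by simp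
    qed
    then obtain i w where w: "i < k" "(t i, w) \<in> parcs G" "w \<notin> t ` {..<k}" by blast
    have wS: "w \<in> S" using comps_adj[OF S, of "t i" w] w t by auto
    have "search_seq G (Suc k) (t(k := w))" unfolding search_seq_def
    proof (intro conjI allI impI)
      show "(t(k := w)) j \<in> pverts G" if "j < Suc k" for j
        using that t wS comps_subset[OF S] by (auto simp: search_seq_def)
      have "inj_on t {..<k}" using t by (simp add: search_seq_def)
      then show "inj_on (t(k := w)) {..<Suc k}"
        using w by (auto simp: inj_on_def lessThan_Suc)
      show "\<exists>i<j. ((t(k := w)) i, (t(k := w)) j) \<in> parcs G" if j: "j < Suc k" "0 < j" for j
      proof (cases "j = k")
        case True
        then show ?thesis using w by (intro exI[of _ i]) auto
      next
        case False
        then have "j < k" using j by simp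
        then obtain l where "l < j" "(t l, t j) \<in> parcs G" using j t unfolding search_seq_def by blast
        then show ?thesis using j False by (intro exI[of _ l]) auto
      qed
    qed
    moreover have "(t(k := w)) ` {..<Suc k} \<subseteq> S" using t wS by (auto simp: lessThan_Suc)
    ultimately show ?thesis by blast
  qed
qed simp

lemma component_fits:
  assumes S: "S \<in> comps G"
  obtains R where "R \<subseteq> {..<card S} \<times> {..<card S}" "searchable (card S) R" "fits G (card S) R S"
proof -
  have pos: "0 < card S" using comps_card_pos[OF S] .
  obtain t where t: "search_seq G (card S) t" "t ` {..<card S} \<subseteq> S"
    using search_seq_exists[OF S pos] by auto
  have inj: "inj_on t {..<card S}" using t by (simp add: search_seq_def)
  then have "card (t ` {..<card S}) = card S" by (simp add: card_image)
  then have im: "t ` {..<card S} = S" using card_subset_eq[OF comps_finite_elem[OF S] t(2)] by simp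
  define R where "R = {(i, j). i < card S \<and> j < card S \<and> (t i, t j) \<in> parcs G}"
  have "enum_of G (card S) R t S" using inj im by (auto simp: enum_of_def R_def bij_betw_def)
  moreover have "searchable (card S) R"
    using t pos unfolding searchable_def search_seq_def R_def by fastforce
  moreover have "R \<subseteq> {..<card S} \<times> {..<card S}" by (auto simp: R_def)
  ultimately show ?thesis using that by (auto simp: fits_def)
qed

text \<open>By \<open>searchable\<close> the enumeration is a search sequence, so \<open>S\<close>
  lies within one component; \<open>cl\<close> gives the other inclusion. Universal quantification
  over a single further vertex thus suffices to express being a component.\<close>

lemma closed_fit_component:
  assumes h: "enum_of G m R h S" and R: "searchable m R" and S: "S \<subseteq> pverts G"
    and cl: "\<And>u v. u \<in> S \<Longrightarrow> v \<in> pverts G \<Longrightarrow> v \<notin> S \<Longrightarrow> (u, v) \<notin> parcs G"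
  shows "S \<in> comps G"
proof -
  have im: "h ` {..<m} = S" and inj: "inj_on h {..<m}" using h by (auto simp: enum_of_def bij_betw_def)
  have "search_seq G m h" unfolding search_seq_def
  proof (intro conjI allI impI)
    show "\<exists>i<j. (h i, h j) \<in> parcs G" if j: "j < m" "0 < j" for j
    proof -
      obtain i where "i < j" "(i, j) \<in> R" using R j by (auto simp: searchable_def)
      then show ?thesis using h j by (intro exI[of _ i]) (auto simp: enum_of_def)
    qed
  qed (use im inj S in auto)
  moreover have "0 < m" using R by (simp add: searchable_def)
  ultimately obtain T where T: "T \<in> comps G" "h ` {..<m} \<subseteq> T" by (rule search_seq_component)
  have "T \<subseteq> S"
  proof (rule closed_superset_component[OF T(1), of "h 0"])
    show "h 0 \<in> T" "h 0 \<in> S" using T(2) im \<open>0 < m\<close> by auto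
    show "y \<in> S" if "x \<in> S" "(x, y) \<in> parcs G" for x y
      using cl[of x y] that in_arcsD2 by auto
  qed
  then show ?thesis using T im by auto
qed

lemma component_count_fits:
  assumes F: "F \<in> graph_components G" and fits: "fits G m R (verts F)"
  shows "component_count F G = fit_count G m R" "card (verts F) = m"
proof -
  obtain T where T: "T \<in> comps G" "F = with_proj G \<restriction> T" using F by (auto simp: sccs_conv_sccs_verts)
  have iff: "digraph_iso (with_proj G \<restriction> S) F \<longleftrightarrow> fits G m R S" for S
  proof
    assume "digraph_iso (with_proj G \<restriction> S) F"
    then obtain h where h: "bij_betw h S T" "\<And>u v. u \<in> S \<Longrightarrow> v \<in> S \<Longrightarrow> (u, v) \<in> parcs G \<longleftrightarrow> (h u, h v) \<in> parcs G"
      unfolding T induced_iso_iff by blast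
    have "bij_betw (inv_into S h) T S" using h(1) by (rule bij_betw_inv_into)
    moreover have "(u, v) \<in> parcs G \<longleftrightarrow> (inv_into S h u, inv_into S h v) \<in> parcs G" if "u \<in> T" "v \<in> T" for u v
    proof -
      have "u \<in> h ` S" "v \<in> h ` S" using h(1) that by (auto simp: bij_betw_def)
      then show ?thesis using h(2)[of "inv_into S h u" "inv_into S h v"]
        by (simp add: inv_into_into f_inv_into_f)
    qed
    ultimately show "fits G m R S" using fits_iso[of G m R T "inv_into S h" S G] fits T(2) by simp
  next
    assume "fits G m R S"
    moreover have "fits G m R T" using fits T(2) by simp
    ultimately obtain h where "bij_betw h S T"
      "\<And>u v. u \<in> S \<Longrightarrow> v \<in> S \<Longrightarrow> (u, v) \<in> parcs G \<longleftrightarrow> (h u, h v) \<in> parcs G"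
      using fits_transfer by blast
    then show "digraph_iso (with_proj G \<restriction> S) F" unfolding T(2) induced_iso_iff by blast
  qed
  have "{C \<in> graph_components G. digraph_iso C F} = induce_subgraph (with_proj G) ` {S \<in> comps G. fits G m R S}"
    by (auto simp: sccs_conv_sccs_verts iff)
  moreover have "inj_on (induce_subgraph (with_proj G)) X" for X
    by (rule inj_on_inverseI[of _ verts]) simp
  ultimately show "component_count F G = fit_count G m R"
    by (simp add: component_count_def fit_count_def card_image)
  show "card (verts F) = m" using fits by (rule fits_card)
qed

lemma component_count_le:
  assumes F: "F \<in> graph_components G"
  shows "component_count F G \<le> card {S \<in> comps G. card S = card (verts F)}" "verts F \<in> comps G"
proof -
  obtain T where T: "T \<in> comps G" "F = with_proj G \<restriction> T" using F by (auto simp: sccs_conv_sccs_verts)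
  then show V: "verts F \<in> comps G" by simp
  obtain R where R: "fits G (card T) R T" using component_fits[OF T(1)] by blast
  have "component_count F G = fit_count G (card T) R"
    using component_count_fits[OF F, of "card T" R] R T by simp
  also have "\<dots> \<le> card {S \<in> comps G. card S = card T}"
    unfolding fit_count_def using comps_finite fits_card by (intro card_mono) auto
  finally show "component_count F G \<le> card {S \<in> comps G. card S = card (verts F)}" using T by simp
qed

end

section \<open>Isomorphism of graphs with equal component counts\<close>

lemma bij_betw_fibers:
  assumes fin: "finite A" "finite B"
    and card: "\<And>c. card {x \<in> A. f x = c} = card {y \<in> B. g y = c}"
  obtains h where "bij_betw h A B" "\<And>x. x \<in> A \<Longrightarrow> g (h x) = f x"
proof -
  have "\<exists>h. bij_betw h {x \<in> A. f x = c} {y \<in> B. g y = c}" for c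
    using fin card by (intro finite_same_card_bij) auto
  then obtain h where h: "\<And>c. bij_betw (h c) {x \<in> A. f x = c} {y \<in> B. g y = c}" by metis
  define k where "k x = h (f x) x" for x
  have k: "k x \<in> B \<and> g (k x) = f x" if "x \<in> A" for x
    using bij_betwE[OF h[of "f x"]] that by (auto simp: k_def)
  have "inj_on k A"
  proof (rule inj_onI)
    fix x y assume xy: "x \<in> A" "y \<in> A" "k x = k y"
    then have "f x = f y" using k[of x] k[of y] by simp
    then show "x = y" using xy h[of "f x"] by (auto simp: k_def bij_betw_def inj_on_def)
  qed
  moreover have "y \<in> k ` A" if "y \<in> B" for y
  proof -
    have "y \<in> h (g y) ` {x \<in> A. f x = g y}" using h[of "g y"] that by (auto simp: bij_betw_def)
    then obtain x where "x \<in> A" "f x = g y" "y = h (g y) x" by auto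
    then show ?thesis by (intro image_eqI[of _ _ x]) (simp_all add: k_def)
  qed
  ultimately have "bij_betw k A B" using k by (auto simp: bij_betw_def)
  then show ?thesis using that k by blast
qed

text \<open>Equal counts for every type give a type-preserving bijection between the components, and
  the isomorphisms of matched components are glued. The bound \<open>M\<close> on both sides reduces
  the comparison to finitely many patterns.\<close>

lemma iso_if_fit_counts_eq:
  assumes G: "pair_graph G" and H: "pair_graph H"
    and GM: "\<And>S. S \<in> comps G \<Longrightarrow> card S \<le> M" and HM: "\<And>S. S \<in> comps H \<Longrightarrow> card S \<le> M"
    and eq: "\<And>m R. 0 < m \<Longrightarrow> m \<le> M \<Longrightarrow> R \<subseteq> {..<m} \<times> {..<m} \<Longrightarrow> searchable m R \<Longrightarrow> fit_count G m R = fit_count H m R"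
  shows "digraph_iso (with_proj G) (with_proj H)"
proof -
  interpret G: pair_graph G by fact
  interpret H: pair_graph H by fact
  \<comment> \<open>The type of a set is the collection of all patterns that fit it, which avoids
    choosing a canonical one.\<close>
  define tG where "tG S = {(m, R). fits G m R S}" for S
  define tH where "tH S = {(m, R). fits H m R S}" for S
  have key: "card {S \<in> comps G. tG S = c} = card {S \<in> comps H. tH S = c}" if "(m, R) \<in> c" "0 < m" "m \<le> M" "R \<subseteq> {..<m} \<times> {..<m}" "searchable m R"
    "(\<exists>S\<in>comps G. tG S = c) \<or> (\<exists>S\<in>comps H. tH S = c)" for c m R
  proof -
    \<comment> \<open>By \<open>fits_same\<close>, a single pattern of an occurring type decides the
      whole type, so fibres of \<open>tG\<close> are what \<open>fit_count\<close> counts.\<close>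
    have cG: "tG S = c \<longleftrightarrow> fits G m R S" for S
    proof
      assume f: "fits G m R S"
      from that(6) show "tG S = c"
      proof
        assume "\<exists>S\<in>comps G. tG S = c"
        then obtain T where T: "c = tG T" by auto
        then have "fits G m R T" using that(1) by (auto simp: tG_def)
        then show ?thesis unfolding T tG_def using fits_same[OF f] fits_same[OF _ f] by blast
      next
        assume "\<exists>S\<in>comps H. tH S = c"
        then obtain T where T: "c = tH T" by auto
        then have "fits H m R T" using that(1) by (auto simp: tH_def)
        then show ?thesis unfolding T tG_def tH_def using fits_same[OF f] fits_same[OF _ f] by blast
      qed
    qed (use that(1) in \<open>auto simp: tG_def\<close>)
    have cH: "tH S = c \<longleftrightarrow> fits H m R S" for S
    proof
      assume f: "fits H m R S"
      from that(6) show "tH S = c"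
      proof
        assume "\<exists>S\<in>comps G. tG S = c"
        then obtain T where T: "c = tG T" by auto
        then have "fits G m R T" using that(1) by (auto simp: tG_def)
        then show ?thesis unfolding T tG_def tH_def using fits_same[OF f] fits_same[OF _ f] by blast
      next
        assume "\<exists>S\<in>comps H. tH S = c"
        then obtain T where T: "c = tH T" by auto
        then have "fits H m R T" using that(1) by (auto simp: tH_def)
        then show ?thesis unfolding T tH_def using fits_same[OF f] fits_same[OF _ f] by blast
      qed
    qed (use that(1) in \<open>auto simp: tH_def\<close>)
    show ?thesis unfolding cG cH using eq[OF that(2-5)] by (simp add: fit_count_def)
  qed
  have "card {S \<in> comps G. tG S = c} = card {S \<in> comps H. tH S = c}" for c
  proof (cases "(\<exists>S\<in>comps G. tG S = c) \<or> (\<exists>S\<in>comps H. tH S = c)")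
    case False
    then have "{S \<in> comps G. tG S = c} = {}" "{S \<in> comps H. tH S = c} = {}" by blast+
    then show ?thesis by (simp only: card.empty)
  next
    case True
    have "\<exists>m R. (m, R) \<in> c \<and> 0 < m \<and> m \<le> M \<and> R \<subseteq> {..<m} \<times> {..<m} \<and> searchable m R"
      using True
    proof
      assume "\<exists>S\<in>comps G. tG S = c"
      then obtain S where S: "S \<in> comps G" "c = tG S" by auto
      obtain R where "R \<subseteq> {..<card S} \<times> {..<card S}" "searchable (card S) R" "fits G (card S) R S"
        using G.component_fits[OF S(1)] .
      then show ?thesis using GM[OF S(1)] G.comps_card_pos[OF S(1)] S(2)
        by (intro exI[of _ "card S"] exI[of _ R]) (simp add: tG_def)
    next
      assume "\<exists>S\<in>comps H. tH S = c"
      then obtain S where S: "S \<in> comps H" "c = tH S" by auto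
      obtain R where "R \<subseteq> {..<card S} \<times> {..<card S}" "searchable (card S) R" "fits H (card S) R S"
        using H.component_fits[OF S(1)] .
      then show ?thesis using HM[OF S(1)] H.comps_card_pos[OF S(1)] S(2)
        by (intro exI[of _ "card S"] exI[of _ R]) (simp add: tH_def)
    qed
    then show ?thesis using key True by blast
  qed
  then obtain k where k: "bij_betw k (comps G) (comps H)" "\<And>S. S \<in> comps G \<Longrightarrow> tH (k S) = tG S"
    using bij_betw_fibers[OF G.comps_finite H.comps_finite, of tG tH] by blast
  have "\<exists>h. bij_betw h S (k S) \<and> (\<forall>u\<in>S. \<forall>v\<in>S. (u, v) \<in> parcs G \<longleftrightarrow> (h u, h v) \<in> parcs H)" if S: "S \<in> comps G" for S
  proof -
    obtain R where "fits G (card S) R S" using G.component_fits[OF S] by blast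
    moreover then have "fits H (card S) R (k S)" using k(2)[OF S] by (auto simp: tG_def tH_def)
    ultimately show ?thesis using fits_transfer[of G "card S" R S H "k S"] by metis
  qed
  then obtain h where h: "\<And>S. S \<in> comps G \<Longrightarrow> bij_betw (h S) S (k S)"
    "\<And>S u v. S \<in> comps G \<Longrightarrow> u \<in> S \<Longrightarrow> v \<in> S \<Longrightarrow> (u, v) \<in> parcs G \<longleftrightarrow> (h S u, h S v) \<in> parcs H" by metis
  have "\<exists>S. S \<in> comps G \<and> v \<in> S" if "v \<in> pverts G" for v using that G.comps_Union by blast
  then obtain cl where cl: "\<And>v. v \<in> pverts G \<Longrightarrow> cl v \<in> comps G \<and> v \<in> cl v" by metis
  have cl_eq: "cl v = S" if "S \<in> comps G" "v \<in> S" for S v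
    using cl[of v] G.comps_disjoint[of "cl v" S] that G.comps_subset by blast
  define g where "g v = h (cl v) v" for v
  have gk: "g v \<in> k S" if "S \<in> comps G" "v \<in> S" for S v
    using bij_betwE[OF h(1)[OF that(1)]] that cl_eq by (auto simp: g_def)
  have kH: "k S \<in> comps H" if "S \<in> comps G" for S using k(1) that by (auto simp: bij_betwE)
  have same: "cl u = cl v" if "u \<in> pverts G" "v \<in> pverts G" "g u \<in> k (cl v)" for u v
  proof (rule ccontr)
    assume ne: "cl u \<noteq> cl v"
    have "inj_on k (comps G)" using k(1) by (simp add: bij_betw_def)
    then have "k (cl u) \<noteq> k (cl v)" using ne cl that inj_onD by metis
    then have "k (cl u) \<inter> k (cl v) = {}" using H.comps_disjoint kH cl that by blast
    then show False using gk[of "cl u" u] cl that by blast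
  qed
  have "bij_betw g (pverts G) (pverts H)"
  proof (rule bij_betwI')
    fix u v assume uv: "u \<in> pverts G" "v \<in> pverts G"
    show "g u = g v \<longleftrightarrow> u = v"
    proof
      assume eq: "g u = g v"
      then have "cl u = cl v" using same[OF uv] gk[of "cl v" v] cl uv by simp
      then show "u = v" using eq h(1)[of "cl v"] cl[OF uv(1)] cl[OF uv(2)]
        by (auto simp: g_def bij_betw_def inj_on_def)
    qed simp
  next
    fix v assume "v \<in> pverts G"
    then show "g v \<in> pverts H" using gk[of "cl v" v] cl kH H.comps_subset by blast
  next
    fix w assume "w \<in> pverts H"
    then obtain T where T: "T \<in> comps H" "w \<in> T" using H.comps_Union by blast
    then obtain S where S: "S \<in> comps G" "T = k S" using k(1) by (auto simp: bij_betw_def)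
    then obtain v where "v \<in> S" "w = h S v" using h(1)[of S] T by (auto simp: bij_betw_def)
    then show "\<exists>v\<in>pverts G. w = g v"
      using cl_eq[OF S(1)] G.comps_subset[OF S(1)] by (auto simp: g_def)
  qed
  moreover have "(u, v) \<in> parcs G \<longleftrightarrow> (g u, g v) \<in> parcs H" if uv: "u \<in> pverts G" "v \<in> pverts G" for u v
  proof (cases "cl u = cl v")
    case True
    then show ?thesis using h(2)[of "cl v" u v] cl[OF uv(1)] cl[OF uv(2)] by (simp add: g_def)
  next
    case False
    have "(u, v) \<notin> parcs G"
      using G.comps_adj[of "cl u" u v] cl[OF uv(1)] cl_eq[of "cl u" v] False by blast
    moreover have "(g u, g v) \<notin> parcs H"
    proof
      assume "(g u, g v) \<in> parcs H"
      then have "g u \<in> k (cl v)"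
        using H.comps_adj_iff[OF kH, of "cl v" "g u" "g v"] gk[of "cl v" v] cl uv by blast
      then show False using same uv False by blast
    qed
    ultimately show ?thesis by simp
  qed
  ultimately show ?thesis unfolding digraph_iso_with_proj_iff[OF G H] by blast
qed

section \<open>The defining sentence\<close>

lemma ball_bex_upt [simp]:
  "(\<forall>x\<in>{0..<m::nat}. P x) \<longleftrightarrow> (\<forall>x<m. P x)"
  "(\<exists>x\<in>{0..<m::nat}. P x) \<longleftrightarrow> (\<exists>x<m. P x)"
  "(\<forall>x\<in>{Suc 0..<m}. P x) \<longleftrightarrow> (\<forall>x<m. 0 < x \<longrightarrow> P x)"
  by auto

definition pair_literals :: "(nat \<times> nat) set \<Rightarrow> (nat \<Rightarrow> nat) \<Rightarrow> nat \<Rightarrow> nat \<Rightarrow> fo" where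
  "pair_literals R \<sigma> i j = Conj (if i = j then Equal (\<sigma> i) (\<sigma> i) else Neg (Equal (\<sigma> i) (\<sigma> j)))
     (if (i, j) \<in> R then Adj (\<sigma> i) (\<sigma> j) else Neg (Adj (\<sigma> i) (\<sigma> j)))"

definition pattern :: "nat \<Rightarrow> (nat \<times> nat) set \<Rightarrow> (nat \<Rightarrow> nat) \<Rightarrow> fo" where
  "pattern m R \<sigma> = conjs (Equal (\<sigma> 0) (\<sigma> 0))
     (map (\<lambda>(i, j). pair_literals R \<sigma> i j) (List.product [0..<m] [0..<m]))"

text \<open>The \<open>dual\<close> of a conjunction of inequalities serves as the disjunction
  stating that \<open>z\<close> is one of the enumerated vertices.\<close>

definition no_exit :: "nat \<Rightarrow> (nat \<Rightarrow> nat) \<Rightarrow> nat \<Rightarrow> fo" where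
  "no_exit m \<sigma> z = Forall z (Disj
     (dual (conjs (Equal z z) (map (\<lambda>i. Neg (Equal z (\<sigma> i))) [0..<m])))
     (conjs (Equal z z) (map (\<lambda>i. Neg (Adj (\<sigma> i) z)) [0..<m])))"

definition avoids :: "nat \<Rightarrow> nat \<Rightarrow> nat \<Rightarrow> (nat \<Rightarrow> nat) \<Rightarrow> fo" where
  "avoids c i m \<sigma> = conjs (Equal i i)
     (map (\<lambda>(k, j). if k = i then Equal i i else Neg (Equal k (\<sigma> j))) (List.product [0..<c] [0..<m]))"

text \<open>Pattern vertex 0 is the root in variable \<open>i\<close>; the others occupy
  \<open>c\<close> to \<open>c + m - 2\<close>, the same variables for every root. The universal
  variable \<open>c + m\<close> of \<open>no_exit\<close> lies outside this range.\<close>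

definition vars :: "nat \<Rightarrow> nat \<Rightarrow> nat \<Rightarrow> nat" where
  "vars c i j = (if j = 0 then i else c + j - 1)"

text \<open>Its depth is \<open>m\<close>: one existential quantifier for each of the
  \<open>m - 1\<close> vertices besides the root, and one universal quantifier from
  \<open>no_exit\<close>.\<close>

definition rooted :: "nat \<Rightarrow> nat \<Rightarrow> (nat \<times> nat) set \<Rightarrow> nat \<Rightarrow> fo" where
  "rooted c m R i = exs [c..<c + m - 1]
     (Conj (pattern m R (vars c i)) (Conj (avoids c i m (vars c i)) (no_exit m (vars c i) (c + m))))"

text \<open>Each of the \<open>c\<close> roots lies in a component of its own; sharing the variables of the remaining
  \<open>m - 1\<close> vertices among the roots keeps the depth at \<open>c + m\<close>.\<close>

definition at_least :: "nat \<Rightarrow> nat \<Rightarrow> (nat \<times> nat) set \<Rightarrow> fo" where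
  "at_least c m R = exs [0..<c] (conjs (Equal 0 0) (map (rooted c m R) [0..<c]))"

definition distinct_vars :: "nat \<Rightarrow> fo" where
  "distinct_vars k = conjs (Equal 0 0)
     (map (\<lambda>(i, j). if i = j then Equal i i else Neg (Equal i j)) (List.product [0..<k] [0..<k]))"

definition has_search :: "nat \<Rightarrow> fo" where
  "has_search k = exs [0..<k] (conjs (distinct_vars k)
     (map (\<lambda>j. dual (conjs (Equal j j) (map (\<lambda>i. Neg (Adj i j)) [0..<j]))) [1..<k]))"

section \<open>Meaning and shape of the counting sentences\<close>

lemma sat_pattern:
  "sat G s (pattern m R \<sigma>) \<longleftrightarrow> inj_on (\<lambda>i. s (\<sigma> i)) {..<m} \<and>
     (\<forall>i<m. \<forall>j<m. (i, j) \<in> R \<longleftrightarrow> (s (\<sigma> i), s (\<sigma> j)) \<in> parcs G)"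
proof -
  have "sat G s (pair_literals R \<sigma> i j) \<longleftrightarrow> (i \<noteq> j \<longrightarrow> s (\<sigma> i) \<noteq> s (\<sigma> j)) \<and>
      ((i, j) \<in> R \<longleftrightarrow> (s (\<sigma> i), s (\<sigma> j)) \<in> parcs G)" for i j
    by (simp add: pair_literals_def)
  then show ?thesis by (auto simp: pattern_def inj_on_def)
qed

lemma sat_no_exit:
  assumes "\<And>i. i < m \<Longrightarrow> \<sigma> i \<noteq> z"
  shows "sat G s (no_exit m \<sigma> z) \<longleftrightarrow>
    (\<forall>v\<in>pverts G. v \<in> (\<lambda>i. s (\<sigma> i)) ` {..<m} \<or> (\<forall>i<m. (s (\<sigma> i), v) \<notin> parcs G))"
proof -
  have "sat G s (no_exit m \<sigma> z) \<longleftrightarrow>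
      (\<forall>v\<in>pverts G. (\<exists>i<m. v = (s(z := v)) (\<sigma> i)) \<or> (\<forall>i<m. ((s(z := v)) (\<sigma> i), v) \<notin> parcs G))"
    by (simp add: no_exit_def)
  also have "\<dots> \<longleftrightarrow> (\<forall>v\<in>pverts G. (\<exists>i<m. v = s (\<sigma> i)) \<or> (\<forall>i<m. (s (\<sigma> i), v) \<notin> parcs G))"
  proof (intro ball_cong refl)
    fix v
    have "(s(z := v)) (\<sigma> i) = s (\<sigma> i)" if "i < m" for i using assms[OF that] by simp
    then show "((\<exists>i<m. v = (s(z := v)) (\<sigma> i)) \<or> (\<forall>i<m. ((s(z := v)) (\<sigma> i), v) \<notin> parcs G)) =
      ((\<exists>i<m. v = s (\<sigma> i)) \<or> (\<forall>i<m. (s (\<sigma> i), v) \<notin> parcs G))" by metis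
  qed
  finally show ?thesis by auto
qed

lemma sat_avoids:
  "sat G s (avoids c i m \<sigma>) \<longleftrightarrow> (\<forall>k<c. k \<noteq> i \<longrightarrow> s k \<notin> (\<lambda>j. s (\<sigma> j)) ` {..<m})"
proof -
  have "sat G s (if k = i then Equal i i else Neg (Equal k (\<sigma> j))) \<longleftrightarrow> (k \<noteq> i \<longrightarrow> s k \<noteq> s (\<sigma> j))" for k j
    by simp
  then show ?thesis by (auto simp: avoids_def)
qed

lemma sat_rooted:
  assumes i: "i < c" and m: "0 < m" and V: "\<And>k. k < c \<Longrightarrow> s k \<in> pverts G"
  shows "sat G s (rooted c m R i) \<longleftrightarrow> (\<exists>S h. enum_of G m R h S \<and> S \<subseteq> pverts G \<and> h 0 = s i \<and>
     (\<forall>v\<in>pverts G. v \<in> S \<or> (\<forall>u\<in>S. (u, v) \<notin> parcs G)) \<and> (\<forall>k<c. k \<noteq> i \<longrightarrow> s k \<notin> S))"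
proof -
  have z: "vars c i j \<noteq> c + m" if "j < m" for j using that i by (auto simp: vars_def)
  have ne: "sat G t (no_exit m (vars c i) (c + m)) \<longleftrightarrow>
    (\<forall>v\<in>pverts G. v \<in> (\<lambda>j. t (vars c i j)) ` {..<m} \<or> (\<forall>j<m. (t (vars c i j), v) \<notin> parcs G))" for t
    by (rule sat_no_exit) (rule z)
  have vm: "vars c i j \<in> set [c..<c + m - 1]" if "0 < j" "j < m" for j using that by (auto simp: vars_def)
  have v0: "vars c i 0 = i" by (simp add: vars_def)
  show ?thesis (is "?L \<longleftrightarrow> ?R")
  proof
    assume ?L
    then obtain t where t: "\<forall>k\<in>set [c..<c + m - 1]. t k \<in> pverts G" "\<forall>k. k \<notin> set [c..<c + m - 1] \<longrightarrow> t k = s k"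
      and sat: "sat G t (pattern m R (vars c i))" "sat G t (avoids c i m (vars c i))" "sat G t (no_exit m (vars c i) (c + m))"
      unfolding rooted_def sat_exs by auto
    define h where "h j = t (vars c i j)" for j
    have tk: "t k = s k" if "k < c" for k using t(2) that by auto
    have hV: "h j \<in> pverts G" if "j < m" for j
    proof (cases "j = 0")
      case True then show ?thesis using tk[OF i] V[OF i] by (simp add: h_def v0)
    next
      case False then show ?thesis using t(1) vm[of j] that by (simp add: h_def)
    qed
    have "enum_of G m R h (h ` {..<m})"
      using sat(1) unfolding sat_pattern enum_of_def h_def by (simp add: inj_on_imp_bij_betw)
    moreover have "h ` {..<m} \<subseteq> pverts G" using hV by auto
    moreover have "h 0 = s i" using tk[OF i] by (simp add: h_def v0)
    moreover have "\<forall>v\<in>pverts G. v \<in> h ` {..<m} \<or> (\<forall>u\<in>h ` {..<m}. (u, v) \<notin> parcs G)"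
      using sat(3) unfolding ne h_def by auto
    moreover have "\<forall>k<c. k \<noteq> i \<longrightarrow> s k \<notin> h ` {..<m}"
      using sat(2) tk unfolding sat_avoids h_def by simp
    ultimately show ?R by blast
  next
    assume ?R
    then obtain S h where h: "enum_of G m R h S" "S \<subseteq> pverts G" "h 0 = s i"
      "\<forall>v\<in>pverts G. v \<in> S \<or> (\<forall>u\<in>S. (u, v) \<notin> parcs G)" "\<forall>k<c. k \<noteq> i \<longrightarrow> s k \<notin> S" by blast
    \<comment> \<open>Pattern vertex \<open>j \<ge> 1\<close> sits in variable
      \<open>c + j - 1\<close>, so variable \<open>k\<close> must hold
      \<open>h (k - c + 1)\<close>.\<close>
    define t where "t k = (if c \<le> k \<and> k < c + m - 1 then h (k - c + 1) else s k)" for k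
    have S: "h ` {..<m} = S" "inj_on h {..<m}" using h(1) by (auto simp: enum_of_def bij_betw_def)
    have th: "t (vars c i j) = h j" if "j < m" for j
      using that i h(3) by (auto simp: t_def vars_def)
    have tk: "t k = s k" if "k < c" for k using that by (simp add: t_def)
    have im: "(\<lambda>j. t (vars c i j)) ` {..<m} = S" using th S(1) by auto
    have "sat G t (pattern m R (vars c i))"
      unfolding sat_pattern using h(1) S(2) th inj_on_cong[of "{..<m}" "\<lambda>j. t (vars c i j)" h] by (simp add: enum_of_def)
    moreover have "sat G t (avoids c i m (vars c i))"
      unfolding sat_avoids im using h(5) tk by simp
    moreover have "sat G t (no_exit m (vars c i) (c + m))"
      unfolding ne im using h(4) S(1) th by auto
    moreover have "t k \<in> pverts G" if "k \<in> set [c..<c + m - 1]" for k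
      using that S(1) h(2) by (auto simp: t_def)
    ultimately show ?L unfolding rooted_def sat_exs
      by (intro exI[of _ t]) (auto simp: t_def)
  qed
qed

text \<open>The component of each root contains no other root, so the \<open>c\<close> components
  are distinct. Conversely, distinct components are disjoint, and any choice of one enumeration per
  component supplies the roots.\<close>

lemma sat_at_least:
  assumes G: "pair_graph G" and c: "0 < c" and R: "searchable m R"
  shows "sat G s (at_least c m R) \<longleftrightarrow> c \<le> fit_count G m R"
proof -
  interpret pair_graph G by fact
  have m: "0 < m" using R by (simp add: searchable_def)
  let ?X = "{S \<in> comps G. fits G m R S}"
  have fin: "finite ?X" using comps_finite by simp
  show ?thesis
  proof
    assume "sat G s (at_least c m R)"
    then obtain t where t0: "\<forall>k\<in>{0..<c}. t k \<in> pverts G" "\<forall>i\<in>{0..<c}. sat G t (rooted c m R i)"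
      unfolding at_least_def sat_exs by auto
    then have t: "\<And>k. k < c \<Longrightarrow> t k \<in> pverts G" "\<And>i. i < c \<Longrightarrow> sat G t (rooted c m R i)" by auto
    have "\<exists>S. S \<in> ?X \<and> t i \<in> S \<and> (\<forall>k<c. k \<noteq> i \<longrightarrow> t k \<notin> S)" if i: "i < c" for i
    proof -
      have "\<exists>S h. enum_of G m R h S \<and> S \<subseteq> pverts G \<and> h 0 = t i \<and>
         (\<forall>v\<in>pverts G. v \<in> S \<or> (\<forall>u\<in>S. (u, v) \<notin> parcs G)) \<and> (\<forall>k<c. k \<noteq> i \<longrightarrow> t k \<notin> S)"
        using t(2)[OF i] sat_rooted[OF i m, of t G R] t(1) by blast
      then obtain S h where h: "enum_of G m R h S" "S \<subseteq> pverts G" "h 0 = t i"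
        "\<And>v. v \<in> pverts G \<Longrightarrow> v \<in> S \<or> (\<forall>u\<in>S. (u, v) \<notin> parcs G)" "\<And>k. k < c \<Longrightarrow> k \<noteq> i \<Longrightarrow> t k \<notin> S" by blast
      have "S \<in> comps G" by (rule closed_fit_component[OF h(1) R h(2)]) (use h(4) in blast)
      moreover have "h 0 \<in> S" using bij_betwE[of h "{..<m}" S] h(1) m by (simp add: enum_of_def)
      then have "t i \<in> S" using h(3) by simp
      moreover have "fits G m R S" using h(1) by (auto simp: fits_def)
      ultimately show ?thesis using h(5) by blast
    qed
    then obtain T where T: "\<And>i. i < c \<Longrightarrow> T i \<in> ?X" "\<And>i. i < c \<Longrightarrow> t i \<in> T i"
      "\<And>i k. i < c \<Longrightarrow> k < c \<Longrightarrow> k \<noteq> i \<Longrightarrow> t k \<notin> T i" by metis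
    have "inj_on T {..<c}"
    proof (rule inj_onI)
      fix x y assume "x \<in> {..<c}" "y \<in> {..<c}" "T x = T y"
      then show "x = y" using T(2)[of y] T(3)[of x y] by auto
    qed
    then have "card {..<c} \<le> card ?X" using T(1) fin by (intro card_inj_on_le) auto
    then show "c \<le> fit_count G m R" by (simp add: fit_count_def)
  next
    assume "c \<le> fit_count G m R"
    then have "card {..<c} \<le> card ?X" by (simp add: fit_count_def)
    then obtain T where T: "inj_on T {..<c}" "T ` {..<c} \<subseteq> ?X"
      using card_le_inj[OF _ fin, of "{..<c}"] by auto
    have "\<exists>h. enum_of G m R h (T i)" if "i < c" for i using T(2) that by (auto simp: fits_def)
    then obtain h where h: "\<And>i. i < c \<Longrightarrow> enum_of G m R (h i) (T i)" by metis
    define t where "t k = (if k < c then h k 0 else s k)" for k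
    have Tc: "T i \<in> comps G" if "i < c" for i using T(2) that by auto
    have tT: "t i \<in> T i" if "i < c" for i 
      using bij_betwE[of "h i" "{..<m}" "T i"] h[OF that] m that by (auto simp: t_def enum_of_def)
    have tV: "t i \<in> pverts G" if "i < c" for i using tT[OF that] comps_subset[OF Tc[OF that]] by auto
    have "sat G t (rooted c m R i)" if i: "i < c" for i
    proof -
      have "\<forall>v\<in>pverts G. v \<in> T i \<or> (\<forall>u\<in>T i. (u, v) \<notin> parcs G)"
        using comps_adj[OF Tc[OF i]] by blast
      moreover have "\<forall>k<c. k \<noteq> i \<longrightarrow> t k \<notin> T i"
      proof (intro allI impI notI)
        fix k assume k: "k < c" "k \<noteq> i" "t k \<in> T i"
        then have "T k \<noteq> T i" using T(1) i by (auto dest: inj_onD)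
        then show False using comps_disjoint[OF Tc[OF k(1)] Tc[OF i]] tT[OF k(1)] k(3) by blast
      qed
      moreover have "h i 0 = t i" using i by (simp add: t_def)
      ultimately show ?thesis
        using sat_rooted[OF i m, of t G R] tV h[OF i] comps_subset[OF Tc[OF i]] by blast
    qed
    then show "sat G s (at_least c m R)" unfolding at_least_def sat_exs
      by (intro exI[of _ t]) (use tV in \<open>auto simp: t_def\<close>)
  qed
qed

lemma sat_distinct_vars: "sat G s (distinct_vars k) \<longleftrightarrow> inj_on s {..<k}"
proof -
  have "sat G s (if i = j then Equal i i else Neg (Equal i j)) \<longleftrightarrow> (i \<noteq> j \<longrightarrow> s i \<noteq> s j)" for i j
    by simp
  then show ?thesis by (auto simp: distinct_vars_def inj_on_def)
qed

lemma sat_has_search: "sat G s (has_search k) \<longleftrightarrow> (\<exists>t. search_seq G k t)"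
proof -
  have inner: "sat G t (conjs (distinct_vars k)
     (map (\<lambda>j. dual (conjs (Equal j j) (map (\<lambda>i. Neg (Adj i j)) [0..<j]))) [1..<k])) \<longleftrightarrow>
     inj_on t {..<k} \<and> (\<forall>j<k. 0 < j \<longrightarrow> (\<exists>i<j. (t i, t j) \<in> parcs G))" for t
    by (auto simp: sat_distinct_vars)
  show ?thesis
  proof
    assume "sat G s (has_search k)"
    then obtain t where "\<forall>i\<in>set [0..<k]. t i \<in> pverts G" "inj_on t {..<k}"
      "\<forall>j<k. 0 < j \<longrightarrow> (\<exists>i<j. (t i, t j) \<in> parcs G)"
      unfolding has_search_def sat_exs inner by blast
    then have "search_seq G k t" by (simp add: search_seq_def)
    then show "\<exists>t. search_seq G k t" by blast
  next
    assume "\<exists>t. search_seq G k t"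
    then obtain t where t: "search_seq G k t" by blast
    define t' where "t' i = (if i < k then t i else s i)" for i
    have "inj_on t' {..<k}"
      using t inj_on_cong[of "{..<k}" t' t] by (simp add: t'_def search_seq_def)
    moreover have "\<forall>j<k. 0 < j \<longrightarrow> (\<exists>i<j. (t' i, t' j) \<in> parcs G)"
    proof (intro allI impI)
      fix j assume j: "j < k" "0 < j"
      then obtain i where "i < j" "(t i, t j) \<in> parcs G" using t unfolding search_seq_def by blast
      then show "\<exists>i<j. (t' i, t' j) \<in> parcs G" using j by (intro exI[of _ i]) (simp add: t'_def)
    qed
    moreover have "\<forall>i\<in>set [0..<k]. t' i \<in> pverts G" "\<forall>i. i \<notin> set [0..<k] \<longrightarrow> t' i = s i"
      using t by (simp_all add: t'_def search_seq_def)
    ultimately show "sat G s (has_search k)" unfolding has_search_def sat_exs inner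
      by (intro exI[of _ t'] conjI) simp_all
  qed
qed

lemma (in pair_graph) sat_has_search_iff:
  "0 < k \<Longrightarrow> sat G s (has_search k) \<longleftrightarrow> (\<exists>S\<in>comps G. k \<le> card S)"
proof
  assume k: "0 < k" and "sat G s (has_search k)"
  then obtain t where t: "search_seq G k t" by (auto simp: sat_has_search)
  then obtain S where S: "S \<in> comps G" "t ` {..<k} \<subseteq> S" using k by (rule search_seq_component)
  have "card (t ` {..<k}) = k" using t by (simp add: search_seq_def card_image)
  then show "\<exists>S\<in>comps G. k \<le> card S"
    using S card_mono[OF comps_finite_elem[OF S(1)] S(2)] by auto
next
  assume "0 < k" "\<exists>S\<in>comps G. k \<le> card S"
  then obtain S where "S \<in> comps G" "k \<le> card S" by blast
  then obtain t where "search_seq G k t" using search_seq_exists[of S k] \<open>0 < k\<close> by blast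
  then show "sat G s (has_search k)" unfolding sat_has_search by blast
qed

lemma shape_at_least:
  assumes "0 < m" shows "shape ex_all_chains (c + m) (at_least c m R)"
proof -
  have qf: "quantifier_depth (pattern m R \<sigma>) = 0" "quantifier_depth (avoids c i m \<sigma>) = 0" for \<sigma> i
    by (auto simp: pattern_def pair_literals_def avoids_def quantifier_depth_conjs_0)
  have "shape all_chains (Suc 0) (no_exit m \<sigma> z)" for \<sigma> z
    unfolding no_exit_def
    by (intro shape_Forall shape_quantifier_free) (auto simp: quantifier_depth_conjs_0)
  then have "shape all_chains (Suc 0) (Conj (pattern m R \<sigma>) (Conj (avoids c i m \<sigma>) (no_exit m \<sigma> z)))" for \<sigma> i z
    by (rule shape_Conj[OF shape_quantifier_free[OF qf(1)] shape_Conj[OF shape_quantifier_free[OF qf(2)]]])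
  then have "shape ex_all_chains 1 (Conj (pattern m R \<sigma>) (Conj (avoids c i m \<sigma>) (no_exit m \<sigma> z)))" for \<sigma> i z
    by (rule shape_mono[OF _ all_chains_subset]) simp
  then have "shape ex_all_chains (length [c..<c + m - 1] + 1) (rooted c m R i)" for i
    unfolding rooted_def by (intro shape_exs) 
  then have "shape ex_all_chains m (rooted c m R i)" for i using assms by simp
  then have "shape ex_all_chains (length [0..<c] + m) (at_least c m R)"
    unfolding at_least_def
    by (intro shape_exs shape_conjs) (auto intro: shape_mono[OF shape_quantifier_free all_chains_subset order.refl])
  then show ?thesis by simp
qed

lemma shape_has_search: "shape ex_all_chains k (has_search k)"
proof -
  have "shape ex_all_chains (length [0..<k] + 0) (has_search k)"
    unfolding has_search_def
    by (intro shape_exs shape_mono[OF shape_quantifier_free all_chains_subset order.refl])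
      (auto simp: quantifier_depth_conjs_0 distinct_vars_def)
  then show ?thesis by simp
qed

text \<open>The trivial equation that ends \<open>at_least\<close> mentions variable 0, which the
  block of root quantifiers binds only for positive \<open>c\<close>.\<close>

lemma fo_free_at_least:
  assumes "0 < c" "0 < m" shows "fo_free (at_least c m R) = {}"
proof -
  have "fo_free (rooted c m R i) \<subseteq> {..<c}" if i: "i < c" for i
  proof -
    define W where "W = {..<c} \<union> {c..<c + m - 1}"
    have v: "vars c i j \<in> W" if "j < m" for j using that i by (auto simp: vars_def W_def)
    have l: "k \<in> W" if "k < c" for k using that by (simp add: W_def)
    have "fo_free (pair_literals R (vars c i) a b) \<subseteq> W" if "a < m" "b < m" for a b
      using v that by (auto simp: pair_literals_def)
    then have "fo_free (pattern m R (vars c i)) \<subseteq> W"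
      unfolding pattern_def using v[OF assms(2)] by fastforce
    moreover have "fo_free (if k = i then Equal i i else Neg (Equal k (vars c i b))) \<subseteq> W" if "k < c" "b < m" for k b
      using v l that i by auto
    then have "fo_free (avoids c i m (vars c i)) \<subseteq> W"
      unfolding avoids_def using l[OF i] by fastforce
    moreover have "fo_free (no_exit m (vars c i) (c + m)) \<subseteq> W"
      unfolding no_exit_def using v by auto
    moreover have "W - set [c..<c + m - 1] \<subseteq> {..<c}" by (auto simp: W_def)
    ultimately show ?thesis unfolding rooted_def by auto
  qed
  then have "(\<Union>B\<in>set (map (rooted c m R) [0..<c]). fo_free B) \<subseteq> {..<c}" by fastforce
  then show ?thesis unfolding at_least_def using assms(1) by auto
qed

lemma fo_free_distinct_vars: "0 < k \<Longrightarrow> fo_free (distinct_vars k) \<subseteq> {..<k}"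
  by (auto simp: distinct_vars_def split: if_splits)

lemma fo_free_has_search: "0 < k \<Longrightarrow> fo_free (has_search k) = {}"
  using fo_free_distinct_vars[of k] by (auto simp: has_search_def)


definition valid :: fo where
  "valid = Forall 0 (Equal 0 0)"

lemma valid_simps: "sat G s valid" "fo_free valid = {}" "shape ex_all_chains 1 valid"
proof -
  have "shape all_chains (Suc 0) valid" unfolding valid_def
    by (intro shape_Forall shape_quantifier_free) simp
  then show "shape ex_all_chains 1 valid" by (rule shape_mono[OF _ all_chains_subset]) simp
qed (auto simp: valid_def)

section \<open>Assembly of the defining sentences and the depth theorem\<close>

abbreviation two_blocks :: "quantifier list set" where
  "two_blocks \<equiv> ex_all_chains \<union> map flip ` ex_all_chains"

lemma shape_two_blocks:
  assumes "shape ex_all_chains d A" "d \<le> e"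
  shows "shape two_blocks e A" "shape two_blocks e (dual A)"
  using shape_mono[OF assms(1) _ assms(2), of two_blocks] shape_mono[OF shape_dual[OF assms(1)] _ assms(2), of two_blocks]
  by auto

text \<open>For \<open>c = 0\<close> the lower bound says nothing and would leave variable 0 free,
  so it is left out.\<close>

definition exactly :: "nat \<Rightarrow> nat \<Rightarrow> (nat \<times> nat) set \<Rightarrow> fo" where
  "exactly c m R = conjs (dual (at_least (Suc c) m R)) (if c = 0 then [] else [at_least c m R])"

lemma sat_exactly:
  assumes "pair_graph G" "searchable m R"
  shows "sat G s (exactly c m R) \<longleftrightarrow> fit_count G m R = c"
  using sat_at_least[OF assms(1) _ assms(2)] by (auto simp: exactly_def not_le)

lemma shape_exactly: "0 < m \<Longrightarrow> Suc c + m \<le> d \<Longrightarrow> shape two_blocks d (exactly c m R)"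
  unfolding exactly_def
  by (intro shape_conjs) (auto intro: shape_two_blocks[OF shape_at_least] split: if_splits)

lemma fo_free_exactly: "0 < m \<Longrightarrow> fo_free (exactly c m R) = {}"
  using fo_free_at_least[of c m R] fo_free_at_least[of "Suc c" m R] by (simp add: exactly_def)

lemma (in pair_graph) fit_count_pos_component:
  assumes "0 < fit_count G m R"
  obtains F where "F \<in> graph_components G" "component_count F G = fit_count G m R" "card (verts F) = m"
proof -
  obtain S where S: "S \<in> comps G" "fits G m R S"
    using assms unfolding fit_count_def card_gt_0_iff by auto
  then have F: "with_proj G \<restriction> S \<in> graph_components G" by (auto simp: sccs_conv_sccs_verts)
  show ?thesis using that F component_count_fits[OF F] S by simp
qed

text \<open>The depth \<open>t + 2\<close> arises from the types present: excluding
  \<open>c + 1\<close> copies of size \<open>m\<close> costs \<open>c + 1 + m\<close>, at most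
  \<open>t + 2\<close> by \<open>cond\<close>. Excluding an absent type of size
  \<open>m \<le> M\<close> costs \<open>1 + m\<close>, and bounding the component size costs
  \<open>M + 1\<close>; both are at most \<open>t + 1\<close>.\<close>

lemma defining_sentence_with_edges:
  fixes G :: "nat pair_pre_digraph"
  assumes G: "pair_graph G" and ne: "pverts G \<noteq> {}"
    and cond: "\<And>F. F \<in> graph_components G \<Longrightarrow> component_count F G + card (verts F) \<le> isolated_count G + 1"
  obtains A where "defines_graph A G" "shape two_blocks (isolated_count G + 2) A"
proof -
  interpret pair_graph G by fact
  let ?t = "isolated_count G"
  have cne: "comps G \<noteq> {}" using ne comps_Union by auto
  define M where "M = Max (card ` comps G)"
  have M: "card S \<le> M" if "S \<in> comps G" for S
    unfolding M_def using comps_finite that by (intro Max_ge) auto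
  have "M \<in> card ` comps G" unfolding M_def using comps_finite cne by (intro Max_in) auto
  then obtain S0 where S0: "S0 \<in> comps G" "card S0 = M" by auto
  have Mpos: "0 < M" using comps_card_pos[OF S0(1)] S0(2) by simp
  \<comment> \<open>A largest component is counted at least once, so \<open>cond\<close> gives
    \<open>1 + M \<le> ?t + 1\<close>.\<close>
  have Mt: "M \<le> ?t"
  proof -
    obtain R where R: "fits G (card S0) R S0" using component_fits[OF S0(1)] by blast
    then have "0 < fit_count G M R" unfolding fit_count_def card_gt_0_iff using S0 comps_finite by auto
    then obtain F where "F \<in> graph_components G" "component_count F G = fit_count G M R" "card (verts F) = M"
      by (rule fit_count_pos_component)
    then show ?thesis using cond[of F] \<open>0 < fit_count G M R\<close> by simp
  qed
  \<comment> \<open>All patterns of size up to \<open>M\<close> are listed, also those absent from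
    \<open>G\<close>: their absence has to be asserted as well.\<close>
  define P where "P = {(m, R). 0 < m \<and> m \<le> M \<and> R \<subseteq> {..<m} \<times> {..<m} \<and> searchable m R}"
  have "P \<subseteq> {..M} \<times> Pow ({..<M} \<times> {..<M})" by (fastforce simp: P_def)
  then have "finite P" by (rule finite_subset) simp
  then obtain ps where ps: "set ps = P" using finite_list by blast
  define A where "A = conjs (Conj valid (dual (has_search (Suc M)))) (map (\<lambda>(m, R). exactly (fit_count G m R) m R) ps)"
  have satA: "sat H s A \<longleftrightarrow> (\<forall>S\<in>comps H. card S \<le> M) \<and> (\<forall>(m, R)\<in>P. fit_count H m R = fit_count G m R)"
    if H: "pair_graph H" for H :: "nat pair_pre_digraph" and s
  proof -
    have "\<not> sat H s (has_search (Suc M)) \<longleftrightarrow> (\<forall>S\<in>comps H. card S \<le> M)"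
      using pair_graph.sat_has_search_iff[OF H, of "Suc M" s] by (auto simp: not_less_eq_eq)
    moreover have "(\<forall>x\<in>P. sat H s (case x of (m, R) \<Rightarrow> exactly (fit_count G m R) m R)) \<longleftrightarrow>
        (\<forall>(m, R)\<in>P. fit_count H m R = fit_count G m R)"
      by (rule ball_cong) (auto simp: P_def sat_exactly[OF H])
    ultimately show ?thesis by (simp add: A_def ps valid_simps)
  qed
  have sent: "fo_sentence A"
    by (auto simp: fo_sentence_def A_def ps P_def valid_simps fo_free_has_search fo_free_exactly)
  have "defines_graph A G" unfolding defines_graph_def
  proof (intro conjI allI impI)
    show "G \<Turnstile> A" unfolding models_def using satA[OF G] M by auto
    fix H :: "nat pair_pre_digraph"
    assume "pair_graph H \<and> \<not> digraph_iso (with_proj H) (with_proj G)"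
    then have H: "pair_graph H" "\<not> digraph_iso (with_proj H) (with_proj G)" by auto
    show "\<not> H \<Turnstile> A"
    proof
      assume "H \<Turnstile> A"
      then have "sat H undefined A" by (simp add: models_def)
      then have "(\<forall>S\<in>comps H. card S \<le> M)" "(\<forall>(m, R)\<in>P. fit_count H m R = fit_count G m R)"
        using satA[OF H(1)] by auto
      then have "digraph_iso (with_proj H) (with_proj G)"
        using M by (intro iso_if_fit_counts_eq[OF H(1) G, of M]) (auto simp: P_def)
      then show False using H(2) by simp
    qed
  qed (rule sent)
  moreover have "shape two_blocks (?t + 2) A" unfolding A_def
  proof (intro shape_conjs shape_Conj)
    show "shape two_blocks (?t + 2) valid" by (rule shape_two_blocks[OF valid_simps(3)]) simp
    show "shape two_blocks (?t + 2) (dual (has_search (Suc M)))"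
      by (rule shape_two_blocks[OF shape_has_search]) (use Mt in simp)
    fix B assume "B \<in> set (map (\<lambda>(m, R). exactly (fit_count G m R) m R) ps)"
    then obtain m R where B: "B = exactly (fit_count G m R) m R" and mR: "(m, R) \<in> P" by (auto simp: ps)
    have "Suc (fit_count G m R) + m \<le> ?t + 2"
    proof (cases "fit_count G m R = 0")
      case True
      then show ?thesis using mR Mt by (simp add: P_def)
    next
      case False
      then obtain F where "F \<in> graph_components G" "component_count F G = fit_count G m R" "card (verts F) = m"
        using fit_count_pos_component[of m R] by auto
      then show ?thesis using cond[of F] by simp
    qed
    then show "shape two_blocks (?t + 2) B" unfolding B
      using mR by (intro shape_exactly) (auto simp: P_def)
  qed
  ultimately show ?thesis by (rule that)
qed

lemma sat_exs_distinct_vars: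
  assumes "finite (pverts G)"
  shows "sat G s (exs [0..<k] (distinct_vars k)) \<longleftrightarrow> k \<le> card (pverts G)"
proof
  assume "sat G s (exs [0..<k] (distinct_vars k))"
  then obtain t where "\<forall>i\<in>set [0..<k]. t i \<in> pverts G" "inj_on t {..<k}"
    unfolding sat_exs sat_distinct_vars by blast
  then have "card {..<k} \<le> card (pverts G)" using assms by (intro card_inj_on_le) auto
  then show "k \<le> card (pverts G)" by simp
next
  assume "k \<le> card (pverts G)"
  then have "card {..<k} \<le> card (pverts G)" by simp
  then obtain t where t: "inj_on t {..<k}" "t ` {..<k} \<subseteq> pverts G"
    using card_le_inj[OF _ assms, of "{..<k}"] by auto
  define t' where "t' i = (if i < k then t i else s i)" for i
  have "inj_on t' {..<k}" using t inj_on_cong[of "{..<k}" t' t] by (simp add: t'_def)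
  then show "sat G s (exs [0..<k] (distinct_vars k))" unfolding sat_exs sat_distinct_vars
    using t(2) by (intro exI[of _ t'] conjI) (auto simp: t'_def)
qed

text \<open>Here every vertex is isolated and the lower bound is only \<open>t + 1\<close>. Saying
  that there is no edge and exactly \<open>t\<close> vertices meets it: the edge sentence has depth
  2, and excluding \<open>t + 1\<close> distinct vertices has depth \<open>t + 1\<close>.\<close>

lemma defining_sentence_without_edges:
  fixes G :: "nat pair_pre_digraph"
  assumes G: "pair_graph G" and ne: "pverts G \<noteq> {}" and E: "parcs G = {}"
  obtains A where "defines_graph A G" "shape two_blocks (card (pverts G) + 1) A"
proof -
  interpret pair_graph G by fact
  let ?n = "card (pverts G)"
  have n: "0 < ?n" using ne pair_finite_verts by (simp add: card_gt_0_iff)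
  define edge where "edge = exs [0, 1] (Adj 0 1)"
  define A where "A = conjs (dual edge)
     [exs [0..<?n] (distinct_vars ?n), dual (exs [0..<Suc ?n] (distinct_vars (Suc ?n)))]"
  have sat_edge: "sat H s edge \<longleftrightarrow> parcs H \<noteq> {}" if H: "pair_graph H" for H :: "nat pair_pre_digraph" and s
  proof -
    interpret H: pair_graph H by fact
    have "sat H s edge \<longleftrightarrow> (\<exists>u\<in>pverts H. \<exists>v\<in>pverts H. (u, v) \<in> parcs H)" by (simp add: edge_def exs_def)
    also have "\<dots> \<longleftrightarrow> (\<exists>u v. (u, v) \<in> parcs H)" using H.in_arcsD1 H.in_arcsD2 by blast
    finally show ?thesis by auto
  qed
  have satA: "sat H s A \<longleftrightarrow> parcs H = {} \<and> card (pverts H) = ?n" if H: "pair_graph H" for H :: "nat pair_pre_digraph" and s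
  proof -
    interpret H: pair_graph H by fact
    show ?thesis by (auto simp: A_def sat_edge[OF H] sat_exs_distinct_vars[OF H.pair_finite_verts] simp del: upt_Suc)
  qed
  have "fo_sentence A"
    using fo_free_distinct_vars[of ?n] fo_free_distinct_vars[of "Suc ?n"] n
    by (auto simp: fo_sentence_def A_def edge_def)
  moreover have "digraph_iso (with_proj H) (with_proj G)" if H: "pair_graph H" "sat H s A" for H :: "nat pair_pre_digraph" and s
  proof -
    interpret H: pair_graph H by fact
    have e: "parcs H = {}" "card (pverts H) = ?n" using satA[OF H(1)] H(2) by auto
    then obtain h where "bij_betw h (pverts H) (pverts G)"
      using finite_same_card_bij[OF H.pair_finite_verts pair_finite_verts] by blast
    then show ?thesis unfolding digraph_iso_with_proj_iff[OF H(1) G] using E e by auto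
  qed
  ultimately have "defines_graph A G"
    unfolding defines_graph_def models_def using satA[OF G] E by auto
  moreover have "shape two_blocks (?n + 1) A" unfolding A_def
  proof (intro shape_conjs)
    have qf: "shape ex_all_chains 0 (distinct_vars k)" for k
      by (rule shape_mono[OF shape_quantifier_free all_chains_subset order.refl])
        (auto simp: distinct_vars_def quantifier_depth_conjs_0)
    have d: "shape ex_all_chains k (exs [0..<k] (distinct_vars k))" for k
      using shape_exs[OF qf, of "[0..<k]"] by simp
    have "shape ex_all_chains 0 (Adj 0 1)"
      by (rule shape_mono[OF shape_quantifier_free all_chains_subset order.refl]) simp
    from shape_exs[OF this, of "[0, 1]"] have "shape ex_all_chains 2 edge" by (simp add: edge_def numeral_2_eq_2)
    then show "shape two_blocks (?n + 1) (dual edge)" using n by (intro shape_two_blocks) auto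
    fix B assume "B \<in> set [exs [0..<?n] (distinct_vars ?n), dual (exs [0..<Suc ?n] (distinct_vars (Suc ?n)))]"
    then show "shape two_blocks (?n + 1) B"
      using shape_two_blocks(1)[OF d[of ?n], of "?n + 1"] shape_two_blocks(2)[OF d[of "Suc ?n"], of "?n + 1"] by auto
  qed
  ultimately show ?thesis by (rule that)
qed

text \<open>The lower bound concerns all defining sentences, while the sentence that attains it has
  alternation number at most 1, so both minima equal \<open>d\<close>.\<close>

theorem fo_depth_eq:
  fixes G :: "nat pair_pre_digraph"
  assumes G: "pair_graph G" and ne: "pverts G \<noteq> {}"
    and cond: "\<And>F. F \<in> graph_components G \<Longrightarrow> component_count F G + card (verts F) \<le> isolated_count G + 1"
  defines "d \<equiv> isolated_count G + (if parcs G = {} then 1 else 2)"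
  shows "fo_depth G = d" "fo_depth1 G = d"
proof -
  interpret pair_graph G by fact
  obtain A where A: "defines_graph A G" "shape two_blocks d A"
  proof (cases "parcs G = {}")
    case True
    have "isolated G = pverts G" using True by (auto simp: isolated_def)
    then have "d = card (pverts G) + 1" using True by (simp add: d_def isolated_count_isolated)
    then show ?thesis using defining_sentence_without_edges[OF G ne True] that by metis
  next
    case False
    then show ?thesis using defining_sentence_with_edges[OF G ne cond] that by (simp add: d_def) metis
  qed
  have lower: "d \<le> quantifier_depth B" if "defines_graph B G" for B
    using defines_graph_depth_ge[OF G that] by (simp add: d_def)
  have "quantifier_depth A \<le> d" using A(2) by (simp add: shape_def)
  then have Ad: "quantifier_depth A = d" using lower[OF A(1)] by simp
  have A1: "negations_quantifier_free A" "alternation_number A \<le> 1"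
    using A(2) shape_alternation_number by (auto simp: shape_def)
  show "fo_depth G = d" unfolding fo_depth_def
    by (rule Least_equality) (use A(1) Ad lower in auto)
  show "fo_depth1 G = d" unfolding fo_depth1_def
    by (rule Least_equality) (use A(1) A1 Ad lower in auto)
qed

section \<open>Component sizes and multiplicities\<close>

text \<open>Four ranges of the size \<open>k\<close>. For \<open>k = 1\<close> the claim holds with
  equality even for the count of all components of that size; \<open>k = 2\<close> is the hypothesis
  \<open>two\<close>. Sizes from 3 to \<open>K\<close> share the vertices left over by the isolated
  ones, and a type of size above \<open>K\<close> has at most \<open>n / K\<close> copies.\<close>

lemma (in pair_graph) component_condition:
  fixes L :: real and K :: nat
  defines "t \<equiv> isolated_count G" and "n \<equiv> card (pverts G)"
  assumes L: "\<And>S. S \<in> comps G \<Longrightarrow> real (card S) \<le> L"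
    and two: "card {S \<in> comps G. card S = 2} + 1 \<le> t"
    and small: "real n + 3 * real K \<le> 4 * real t"
    and large: "0 < K" "real n / real K + L \<le> real t"
    and F: "F \<in> graph_components G"
  shows "component_count F G + card (verts F) \<le> t + 1"
proof -
  define k where "k = card (verts F)"
  define N where "N = card {S \<in> comps G. card S = k}"
  have cc: "component_count F G \<le> N" and FS: "verts F \<in> comps G"
    using component_count_le[OF F] by (auto simp: N_def k_def)
  have k: "0 < k" using comps_card_pos[OF FS] by (simp add: k_def)
  have cardU: "(\<Sum>S\<in>X. card S) \<le> n" if "X \<subseteq> comps G" for X
    unfolding n_def comps_sum_card[OF that] using that comps_Union pair_finite_verts by (intro card_mono) auto
  have kN: "k * N \<le> n" using cardU[of "{S \<in> comps G. card S = k}"] by (simp add: N_def mult.commute)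
  consider "k = 1" | "k = 2" | "3 \<le> k" "k \<le> K" | "K < k" using k by linarith
  then have "real N + real k \<le> real t + 1"
  proof cases
    case 1
    then show ?thesis by (simp add: N_def t_def isolated_count_conv)
  next
    case 2
    then show ?thesis using two by (simp add: N_def)
  next
    case 3
    let ?X = "{S \<in> comps G. card S = 1}" and ?Y = "{S \<in> comps G. card S = k}"
    \<comment> \<open>Isolated vertices and components of size \<open>k \<ge> 3\<close> together
      give \<open>t + 3 N \<le> n\<close>. With \<open>k \<le> K\<close>, the hypothesis
      \<open>small\<close> is what turns this into \<open>N + k \<le> t\<close>.\<close>
    have "(\<Sum>S\<in>?X \<union> ?Y. card S) = (\<Sum>S\<in>?X. card S) + (\<Sum>S\<in>?Y. card S)"
      using comps_finite 3 by (intro sum.union_disjoint) auto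
    then have "t + k * N \<le> n"
      using cardU[of "?X \<union> ?Y"] by (simp add: N_def t_def isolated_count_conv mult.commute)
    moreover have "3 * N \<le> k * N" using 3 by simp
    ultimately have "t + 3 * N \<le> n" by linarith
    then have "real t + 3 * real N \<le> real n" by (metis of_nat_add of_nat_le_iff of_nat_mult of_nat_numeral)
    then show ?thesis using small 3 by linarith
  next
    case 4
    have "real K * real N \<le> real k * real N" using 4 by (intro mult_right_mono) auto
    also have "\<dots> \<le> real n" using kN by (metis of_nat_le_iff of_nat_mult)
    finally have "real N \<le> real n / real K" using large(1) by (simp add: field_simps)
    moreover have "real k \<le> L" using L[OF FS] by (simp add: k_def)
    ultimately show ?thesis using large(2) by linarith
  qed
  then show ?thesis using cc unfolding k_def by linarith
qed

section \<open>Estimates in the sparse range\<close>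

lemma one_minus_power_lower:
  fixes p :: real
  assumes "0 \<le> p" "p \<le> 1/2"
  shows "exp (- (real m * (p + 2 * p\<^sup>2))) \<le> (1 - p) ^ m"
proof -
  have "- p - 2 * p\<^sup>2 \<le> ln (1 - p)" using assms by (rule ln_one_minus_pos_lower_bound)
  then have "real m * (- p - 2 * p\<^sup>2) \<le> real m * ln (1 - p)" by (intro mult_left_mono) auto
  then have "exp (- (real m * (p + 2 * p\<^sup>2))) \<le> exp (real m * ln (1 - p))" by (simp add: algebra_simps)
  also have "\<dots> = (1 - p) ^ m" using assms by (simp add: exp_of_nat_mult)
  finally show ?thesis .
qed

lemma one_minus_power_upper:
  fixes p :: real
  assumes "0 \<le> p" "p \<le> 1"
  shows "(1 - p) ^ m \<le> exp (- (real m * p))"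
proof -
  have "(1 - p) ^ m \<le> exp (- p) ^ m" using assms exp_ge_add_one_self[of "- p"] by (intro power_mono) auto
  also have "\<dots> = exp (- (real m * p))" by (simp flip: exp_of_nat_mult)
  finally show ?thesis .
qed

text \<open>Lowering the exponent from \<open>n\<close> to \<open>n - 1\<close> costs at most
  \<open>p\<close>, and the second order term of the logarithm at most
  \<open>2 * p\<^sup>2 * n\<close>. Both are of order \<open>1 / n\<close>, uniformly for
  \<open>p \<le> c / n\<close>.\<close>

lemma one_minus_power_approx:
  fixes p c :: real
  assumes p: "0 \<le> p" "p \<le> 1/2" "p \<le> c / real n" and n: "0 < n"
  shows "\<bar>(1 - p) ^ (n - 1) - exp (- (p * real n))\<bar> \<le> (c + 2 * c\<^sup>2) / real n"
proof -
  have pn: "p * real n \<le> c" using p(3) n by (simp add: field_simps)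
  have c: "0 \<le> c" using pn mult_nonneg_nonneg[OF p(1) of_nat_0_le_iff[of n]] by linarith
  have "(1 - p) ^ (n - 1) - (1 - p) ^ n = (1 - p) ^ (n - 1) * p"
    using n by (cases n) (auto simp: algebra_simps)
  also have "\<dots> \<le> 1 * p" using p by (intro mult_right_mono power_le_one) auto
  finally have up: "(1 - p) ^ (n - 1) \<le> exp (- (p * real n)) + p"
    using one_minus_power_upper[of p n] p by (simp add: mult.commute)
  have "exp (- (p * real n)) - 2 * p\<^sup>2 * real n \<le> exp (- (p * real n)) * (1 - 2 * p\<^sup>2 * real n)"
    using p mult_left_le_one_le[of "2 * p\<^sup>2 * real n" "exp (- (p * real n))"] by (simp add: algebra_simps)
  also have "\<dots> \<le> exp (- (p * real n)) * exp (- (2 * p\<^sup>2 * real n))"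
    using exp_ge_add_one_self[of "- (2 * p\<^sup>2 * real n)"] by (intro mult_left_mono) auto
  also have "\<dots> = exp (- (real n * (p + 2 * p\<^sup>2)))" by (simp add: algebra_simps flip: exp_add)
  also have "\<dots> \<le> (1 - p) ^ n" using p by (intro one_minus_power_lower)
  also have "\<dots> \<le> (1 - p) ^ (n - 1)" using p by (intro power_decreasing) auto
  finally have lo: "exp (- (p * real n)) - 2 * p\<^sup>2 * real n \<le> (1 - p) ^ (n - 1)" .
  have "p\<^sup>2 * real n = p * (p * real n)" by (simp add: power2_eq_square)
  also have "\<dots> \<le> c / real n * c" using p pn c by (intro mult_mono) auto
  finally have p2: "p\<^sup>2 * real n \<le> c\<^sup>2 / real n" by (simp add: power2_eq_square)
  have "0 \<le> c\<^sup>2 / real n" "0 \<le> c / real n" using c by auto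
  moreover have "(c + 2 * c\<^sup>2) / real n = c / real n + 2 * (c\<^sup>2 / real n)" by (simp add: add_divide_distrib)
  ultimately show ?thesis using up lo p2 p(3) unfolding abs_le_iff by linarith
qed

text \<open>Bernoulli's inequality together with
  \<open>(1 + 8 p) (1 - 4 p) = 1 + 4 p (1 - 8 p)\<close>, which is at least 1 for
  \<open>p \<le> 1/8\<close>.\<close>

lemma inverse_power4_le:
  fixes p :: real
  assumes "0 \<le> p" "p \<le> 1/8"
  shows "1 / (1 - p) ^ 4 - 1 \<le> 8 * p"
proof -
  have "1 + real 4 * (- p) \<le> (1 + - p) ^ 4" using assms by (intro Bernoulli_inequality) auto
  then have b: "1 - 4 * p \<le> (1 - p) ^ 4" by simp
  have "1 \<le> (1 + 8 * p) * (1 - 4 * p)" using assms mult_nonneg_nonneg[of p "1 - 8 * p"] by (simp add: algebra_simps power2_eq_square)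
  also have "\<dots> \<le> (1 + 8 * p) * (1 - p) ^ 4" using b assms by (intro mult_left_mono) auto
  finally have "1 \<le> (1 + 8 * p) * (1 - p) ^ 4" .
  moreover have "0 < (1 - p) ^ 4" using assms by simp
  ultimately show ?thesis by (simp add: field_simps)
qed

text \<open>The limit \<open>x\<close> of the giant component's share solves \<open>x - 1 + exp (- c * x) = 0\<close>, and this
  convex function is bounded away from zero beyond \<open>exp (- \<alpha>) - \<kappa>\<close>.\<close>

lemma giant_share_gap:
  assumes \<alpha>: "thr \<alpha> = 0" and c: "0 < c" "c < \<alpha>"
  obtains \<kappa> where "0 < \<kappa>" "\<kappa> < exp (- \<alpha>)"
    "\<And>x. exp (- \<alpha>) - \<kappa> \<le> x \<Longrightarrow> \<kappa> \<le> x - 1 + exp (- (c * x))"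
proof -
  define h where "h x = x - 1 + exp (- (c * x))" for x
  \<comment> \<open>Moving left from \<open>exp (- \<alpha>)\<close> by half the value of
    \<open>h\<close> there costs at most that half, so \<kappa> remains at
    \<open>x0\<close>.\<close>
  define \<kappa> where "\<kappa> = h (exp (- \<alpha>)) / 2"
  define x0 where "x0 = exp (- \<alpha>) - \<kappa>"
  \<comment> \<open>With \<alpha> in place of \<open>c\<close> the value would vanish because
    \<open>thr \<alpha> = 0\<close>; \<open>c < \<alpha>\<close> makes it positive.\<close>
  have "h (exp (- \<alpha>)) = exp (- (c * exp (- \<alpha>))) - exp (- (\<alpha> * exp (- \<alpha>)))"
    using \<alpha> by (simp add: h_def thr_def)
  also have "\<dots> > 0" using c by simp
  finally have \<kappa>: "0 < \<kappa>" by (simp add: \<kappa>_def)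
  have "h (exp (- \<alpha>)) \<le> exp (- \<alpha>)" using c by (simp add: h_def)
  then have x0: "0 < x0" and \<kappa>': "\<kappa> < exp (- \<alpha>)" using exp_gt_zero[of "- \<alpha>"] \<kappa> unfolding x0_def \<kappa>_def by linarith+
  have "exp (- (c * exp (- \<alpha>))) \<le> exp (- (c * x0))" using c \<kappa> by (simp add: x0_def)
  moreover have "exp (- \<alpha>) - 1 + exp (- (c * exp (- \<alpha>))) = 2 * \<kappa>" by (simp add: \<kappa>_def h_def)
  ultimately have h0: "\<kappa> \<le> h x0" unfolding h_def x0_def by linarith
  have tangent: "exp (- (c * x0)) * (1 - c * (x - x0)) \<le> exp (- (c * x))" for x
  proof -
    have "exp (- (c * x0)) * (1 + - (c * (x - x0))) \<le> exp (- (c * x0)) * exp (- (c * (x - x0)))"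
      by (intro mult_left_mono exp_ge_add_one_self) auto
    then show ?thesis by (simp add: algebra_simps flip: exp_add)
  qed
  \<comment> \<open>The tangent at \<open>x0\<close>, evaluated at 0 where \<open>h\<close>
    vanishes: a positive value at \<open>x0\<close> forces a positive slope there. By convexity
    \<open>h\<close> stays above this increasing tangent to the right of \<open>x0\<close>.\<close>
  have "h x0 \<le> x0 * (1 - c * exp (- (c * x0)))"
    using tangent[of 0] by (simp add: h_def algebra_simps)
  then have "0 < x0 * (1 - c * exp (- (c * x0)))" using h0 \<kappa> by linarith
  then have slope: "0 < 1 - c * exp (- (c * x0))" using x0 by (simp add: zero_less_mult_iff)
  have "\<kappa> \<le> h x" if "x0 \<le> x" for x
  proof -
    have "h x0 + (x - x0) * (1 - c * exp (- (c * x0))) \<le> h x"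
      using tangent[of x] by (simp add: h_def algebra_simps)
    moreover have "0 \<le> (x - x0) * (1 - c * exp (- (c * x0)))" using that slope by simp
    ultimately show ?thesis using h0 by linarith
  qed
  then show ?thesis using that[OF \<kappa> \<kappa>'] by (simp add: h_def x0_def)
qed

lemma prob_giant_le:
  fixes p c :: real
  assumes p: "0 \<le> p" "p \<le> 1/2" "real n * (p + 2 * p\<^sup>2) \<le> c" and n: "2 \<le> n"
    and \<kappa>: "0 < \<kappa>" "\<And>x. x0 \<le> x \<Longrightarrow> \<kappa> \<le> x - 1 + exp (- (c * x))" "0 < x0" and n\<kappa>: "2 \<le> real n * \<kappa>"
  shows "measure_pmf.prob (edge_field n p) {f. \<exists>S\<in>comps (graph_of n f). x0 * real n \<le> real (card S)}
    \<le> real n ^ 2 * exp (- (\<kappa>\<^sup>2 / 2 * real n))"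
proof -
  define k where "k = nat \<lceil>x0 * real n\<rceil>"
  have k1: "1 \<le> k" using \<kappa>(3) n by (simp add: k_def Suc_le_eq)
  \<comment> \<open>The mean lies \<open>n * \<kappa>\<close> below \<open>m\<close>. Half of this
    gap is the deviation \<open>t\<close>, and the other half, at least 1, absorbs the passage from
    \<open>m\<close> to \<open>m - 1\<close>.\<close>
  define t where "t = real n * \<kappa> / 2"
  have gap: "real (n - 1) * (1 - (1 - p) ^ m) + t \<le> real (m - 1)" if m: "m \<in> {k..n}" for m
  proof -
    define x where "x = real m / real n"
    have "x0 * real n \<le> real m" using m unfolding k_def by (simp add: nat_ceiling_le_eq)
    then have x: "x0 \<le> x" using n by (simp add: x_def field_simps)
    have "real m * (p + 2 * p\<^sup>2) = x * (real n * (p + 2 * p\<^sup>2))" using n by (simp add: x_def)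
    also have "\<dots> \<le> x * c" using p(3) by (intro mult_left_mono) (auto simp: x_def)
    finally have "real m * (p + 2 * p\<^sup>2) \<le> c * x" by (simp add: mult.commute)
    then have "exp (- (c * x)) \<le> exp (- (real m * (p + 2 * p\<^sup>2)))" by simp
    also have "\<dots> \<le> (1 - p) ^ m" by (rule one_minus_power_lower[OF p(1,2)])
    finally have q: "1 - (1 - p) ^ m \<le> x - \<kappa>" using \<kappa>(2)[OF x] by linarith
    have "real (n - 1) * (1 - (1 - p) ^ m) \<le> real n * (1 - (1 - p) ^ m)"
      using p by (intro mult_right_mono) (auto simp: power_le_one)
    also have "\<dots> \<le> real n * (x - \<kappa>)" using q by (intro mult_left_mono) auto
    also have "\<dots> = real m - real n * \<kappa>" using n by (simp add: x_def algebra_simps)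
    finally have "real (n - 1) * (1 - (1 - p) ^ m) + t \<le> real m - 1"
      using n\<kappa> unfolding t_def by linarith
    then show ?thesis using m k1 by (simp add: of_nat_diff)
  qed
  have "measure_pmf.prob (edge_field n p) {f. \<exists>S\<in>comps (graph_of n f). x0 * real n \<le> real (card S)}
      = measure_pmf.prob (edge_field n p) {f. \<exists>S\<in>comps (graph_of n f). k \<le> card S}"
    by (simp add: k_def nat_ceiling_le_eq)
  also have "\<dots> \<le> real n ^ 2 * exp (- (2 * t\<^sup>2 / real (n - 1)))"
    using p k1 n \<kappa> gap by (intro prob_large_component_le) (auto simp: t_def)
  also have "\<dots> \<le> real n ^ 2 * exp (- (\<kappa>\<^sup>2 / 2 * real n))"
  proof -
    have "\<kappa>\<^sup>2 / 2 * real n = 2 * t\<^sup>2 / real n" using n by (simp add: t_def power2_eq_square)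
    also have "\<dots> \<le> 2 * t\<^sup>2 / real (n - 1)" using n by (intro divide_left_mono) auto
    finally show ?thesis by (intro mult_left_mono) auto
  qed
  finally show ?thesis .
qed

lemma prob_tendsto_1:
  fixes M :: "nat \<Rightarrow> 'a pmf"
  assumes "eventually (\<lambda>n. measure_pmf.prob (M n) {f. \<not> T n f} \<le> b n) sequentially" "b \<longlonglongrightarrow> 0"
    and "eventually (\<lambda>n. \<forall>f. T n f \<longrightarrow> P n f) sequentially"
  shows "(\<lambda>n. measure_pmf.prob (M n) {f. P n f}) \<longlonglongrightarrow> 1"
proof (rule tendsto_sandwich)
  show "(\<lambda>n. 1 - b n) \<longlonglongrightarrow> 1" using tendsto_diff[OF tendsto_const assms(2), of 1] by simp
  show "(\<lambda>n. 1) \<longlonglongrightarrow> (1 :: real)" by simp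
  show "eventually (\<lambda>n. 1 - b n \<le> measure_pmf.prob (M n) {f. P n f}) sequentially"
    using assms(1,3)
  proof eventually_elim
    case (elim n)
    have "1 - measure_pmf.prob (M n) {f. \<not> T n f} = measure_pmf.prob (M n) {f. T n f}"
      using measure_pmf.prob_compl[of "{f. \<not> T n f}" "M n"] by (simp add: Collect_neg_eq Compl_eq_Diff_UNIV[symmetric])
    also have "\<dots> \<le> measure_pmf.prob (M n) {f. P n f}"
      using elim(2) by (intro measure_pmf.finite_measure_mono) auto
    finally show ?case using elim(1) by linarith
  qed
qed (simp add: measure_pmf.prob_le_1)

section \<open>The theorem\<close>

context
  fixes \<alpha> c :: real and \<epsilon> :: real and p :: "nat \<Rightarrow> real"
  assumes \<alpha>: "thr \<alpha> = 0" "1.1918 \<le> \<alpha>" "\<alpha> < 1.1919" and \<epsilon>: "0 < \<epsilon>"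
    and p: "\<And>n. 1 \<le> n \<Longrightarrow> 0 \<le> p n" "\<And>n. 1 \<le> n \<Longrightarrow> p n \<le> (\<alpha> - \<epsilon>) / real n"
  defines "c \<equiv> \<alpha> - \<epsilon>"
begin

text \<open>The exponent is chosen so that \<open>err n\<close> tends to 0 while
  \<open>(err n)\<^sup>2 * n\<close> tends to infinity: the window is \<open>o(n)\<close> and
  Chebyshev's bound still vanishes.\<close>

definition err :: "nat \<Rightarrow> real" where
  "err n = real n powr (- 1 / 4)"

definition typical :: "real \<Rightarrow> nat \<Rightarrow> (nat set \<Rightarrow> bool) \<Rightarrow> bool" where
  "typical x0 n f \<longleftrightarrow>
     \<bar>real (isolated_count (graph_of n f)) - real n * (1 - p n) ^ (n - 1)\<bar> < err n * real n \<and>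
     real (card {S \<in> comps (graph_of n f). card S = 2}) <
       err n * real n + real n * (real n * p n) / 2 * (1 - p n) ^ (2 * (n - 2)) \<and>
     (\<forall>S\<in>comps (graph_of n f). real (card S) < x0 * real n)"

text \<open>Nonnegativity of \<open>c\<close> comes from the given sequence:
  \<open>0 \<le> p 1 \<le> \<alpha> - \<epsilon>\<close>.\<close>

lemma c_range: "0 \<le> c" "c < 1.1919"
  using p(1,2)[of 1] \<alpha> \<epsilon> by (auto simp: c_def)

lemma np_le: "1 \<le> n \<Longrightarrow> real n * p n \<le> c"
  using p(2)[of n] by (simp add: c_def field_simps)

text \<open>The giant component is handled with the constant
  \<open>\<alpha> - \<epsilon> / 2\<close> in place of \<open>c = \<alpha> - \<epsilon>\<close>; the
  slack pays for the second order term of \<open>ln (1 - p)\<close>.\<close>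

lemma prob_atypical_le:
  assumes n: "2 \<le> n" "8 * c \<le> real n" "4 * c\<^sup>2 \<le> \<epsilon> * real n"
    and \<kappa>: "0 < \<kappa>" "\<And>x. x0 \<le> x \<Longrightarrow> \<kappa> \<le> x - 1 + exp (- ((\<alpha> - \<epsilon> / 2) * x))" "0 < x0" and n\<kappa>: "2 \<le> real n * \<kappa>"
  shows "measure_pmf.prob (edge_field n (p n)) {f. \<not> typical x0 n f} \<le>
    (1 + 9 * c + 2 * c ^ 3) / ((err n)\<^sup>2 * real n) + real n ^ 2 * exp (- (\<kappa>\<^sup>2 / 2 * real n))"
proof -
  let ?M = "edge_field n (p n)" and ?q = "1 - p n" and ?t = "err n * real n"
  have p0: "0 \<le> p n" using p(1)[of n] n by simp
  have pc: "p n \<le> c / real n" using p(2)[of n] n by (simp add: c_def)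
  also have "\<dots> \<le> 1 / 8" using n by (simp add: field_simps)
  finally have p8: "p n \<le> 1 / 8" .
  have np: "real n * p n \<le> c" using np_le n by simp
  have e: "1 / ?q ^ 4 - 1 \<le> 8 * p n" using p0 p8 by (rule inverse_power4_le)
  have e0: "0 < err n" using n by (simp add: err_def)
  have t: "0 < ?t" using n by (simp add: err_def)
  let ?A = "{f. ?t \<le> \<bar>real (isolated_count (graph_of n f)) - real n * ?q ^ (n - 1)\<bar>}"
  let ?B = "{f. ?t + real n * (real n * p n) / 2 * ?q ^ (2 * (n - 2)) \<le> real (card {S \<in> comps (graph_of n f). card S = 2})}"
  let ?C = "{f. \<exists>S\<in>comps (graph_of n f). x0 * real n \<le> real (card S)}"
  have A: "measure_pmf.prob ?M ?A \<le> (1 + 8 * c) / ((err n)\<^sup>2 * real n)"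
  proof -
    have "measure_pmf.prob ?M ?A \<le> (real n + (1 / ?q ^ 4 - 1) * (real n)\<^sup>2) / ?t\<^sup>2"
      using p0 p8 t by (intro concentration_isolated_count) auto
    also have "\<dots> \<le> (real n + 8 * p n * (real n)\<^sup>2) / ?t\<^sup>2"
      using e by (intro divide_right_mono add_left_mono mult_right_mono) auto
    also have "8 * p n * (real n)\<^sup>2 = 8 * (real n * p n) * real n" by (simp add: power2_eq_square)
    also have "(real n + 8 * (real n * p n) * real n) / ?t\<^sup>2 \<le> (real n + 8 * c * real n) / ?t\<^sup>2"
      using np by (intro divide_right_mono add_left_mono mult_right_mono) auto
    also have "\<dots> = (1 + 8 * c) / ((err n)\<^sup>2 * real n)"
      using n e0 by (simp add: power2_eq_square divide_simps) (simp add: algebra_simps)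
    finally show ?thesis .
  qed
  have B: "measure_pmf.prob ?M ?B \<le> (c + 2 * c ^ 3) / ((err n)\<^sup>2 * real n)"
  proof -
    let ?m = "real n * (real n * p n) / 2"
    have m: "0 \<le> ?m" "?m \<le> real n * c" using p0 np c_range(1) n by (auto simp: mult_left_mono intro: order.trans[of _ "real n * (real n * p n)"])
    have m2: "?m \<le> real n * c / 2" using np by (simp add: mult_left_mono)
    have "measure_pmf.prob ?M ?B \<le> (?m + (1 / ?q ^ 4 - 1) * ?m\<^sup>2) / ?t\<^sup>2"
      using p0 p8 t by (intro concentration_edge_components) auto
    also have "\<dots> \<le> (real n * c + 8 * p n * (real n * c / 2)\<^sup>2) / ?t\<^sup>2"
      using p0 by (intro divide_right_mono add_mono[OF m(2)] mult_mono[OF e power_mono[OF m2 m(1)]]) auto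
    also have "8 * p n * (real n * c / 2)\<^sup>2 = real n * p n * (2 * real n * c\<^sup>2)" by (simp add: power2_eq_square)
    also have "(real n * c + real n * p n * (2 * real n * c\<^sup>2)) / ?t\<^sup>2 \<le> (real n * c + c * (2 * real n * c\<^sup>2)) / ?t\<^sup>2"
      using np by (intro divide_right_mono add_left_mono mult_right_mono) auto
    also have "\<dots> = (c + 2 * c ^ 3) / ((err n)\<^sup>2 * real n)"
      using n e0 by (simp add: power2_eq_square power3_eq_cube divide_simps) (simp add: algebra_simps)
    finally show ?thesis .
  qed
  have C: "measure_pmf.prob ?M ?C \<le> real n ^ 2 * exp (- (\<kappa>\<^sup>2 / 2 * real n))"
  proof (rule prob_giant_le[OF p0 _ _ n(1) \<kappa>(1) \<kappa>(2) \<kappa>(3) n\<kappa>])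
    show "p n \<le> 1 / 2" using p8 by simp
    \<comment> \<open>This term enters twice: bounded by \<open>\<epsilon> / 4\<close>, it raises
      the total from at most \<open>c\<close> to at most \<open>c + \<epsilon> / 2\<close>.\<close>
    have "real n * (p n)\<^sup>2 = (real n * p n) * p n" by (simp add: power2_eq_square)
    also have "\<dots> \<le> c * (c / real n)" using np pc p0 c_range(1) by (intro mult_mono) auto
    also have "\<dots> \<le> \<epsilon> / 4" using n by (simp add: field_simps power2_eq_square)
    finally show "real n * (p n + 2 * (p n)\<^sup>2) \<le> \<alpha> - \<epsilon> / 2" using np by (simp add: algebra_simps c_def)
  qed
  have "{f. \<not> typical x0 n f} \<subseteq> ?A \<union> ?B \<union> ?C"
    by (auto simp: typical_def not_less)
  then have "measure_pmf.prob ?M {f. \<not> typical x0 n f} \<le> measure_pmf.prob ?M (?A \<union> ?B \<union> ?C)"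
    by (intro measure_pmf.finite_measure_mono) auto
  also have "\<dots> \<le> measure_pmf.prob ?M ?A + measure_pmf.prob ?M ?B + measure_pmf.prob ?M ?C"
    by (intro order.trans[OF measure_Un_le] add_right_mono measure_Un_le) auto
  also have "\<dots> \<le> (1 + 8 * c) / ((err n)\<^sup>2 * real n) + (c + 2 * c ^ 3) / ((err n)\<^sup>2 * real n)
      + real n ^ 2 * exp (- (\<kappa>\<^sup>2 / 2 * real n))"
    using A B C by (intro add_mono)
  also have "(1 + 8 * c) / ((err n)\<^sup>2 * real n) + (c + 2 * c ^ 3) / ((err n)\<^sup>2 * real n)
      = (1 + 9 * c + 2 * c ^ 3) / ((err n)\<^sup>2 * real n)" by (simp flip: add_divide_distrib)
  finally show ?thesis by simp
qed

text \<open>Relative error of the isolated vertex count: the Chebyshev window plus the replacement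
  of \<open>(1 - p) ^ (n - 1)\<close> by \<open>exp (- p n)\<close>.\<close>

definition dev :: "nat \<Rightarrow> real" where
  "dev n = err n + (c + 2 * c\<^sup>2) / real n"

text \<open>The density of isolated vertices is at least \<open>exp (- \<alpha>) - dev n\<close>,
  where \<open>exp (- \<alpha>) \<ge> 3/10\<close>. The margins of 1/50 leave it above 1/4 and leave
  room between isolated edges and isolated vertices.\<close>

lemma typical_component_condition:
  assumes n: "3 \<le> n" "8 * c \<le> real n"
    and x0: "x0 = exp (- \<alpha>) - \<kappa>" and K: "0 < K" "2 \<le> \<kappa> * real K"
    and small: "dev n \<le> \<kappa> / 2" "dev n + real K / real n \<le> 1/50" "dev n + 1 / real n \<le> 1/50"
    and f: "typical x0 n f"
  shows "\<bar>real (isolated_count (graph_of n f)) - exp (- (p n * real n)) * real n\<bar> \<le> dev n * real n"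
    and "F \<in> graph_components (graph_of n f) \<Longrightarrow>
      component_count F (graph_of n f) + card (verts F) \<le> isolated_count (graph_of n f) + 1"
proof -
  interpret pair_graph "graph_of n f" by (rule pair_graph_graph_of)
  define t where "t = isolated_count (graph_of n f)"
  let ?q = "1 - p n"
  have p0: "0 \<le> p n" using p(1)[of n] n by simp
  have pc: "p n \<le> c / real n" using p(2)[of n] n by (simp add: c_def)
  also have "\<dots> \<le> 1 / 8" using n by (simp add: field_simps)
  finally have p8: "p n \<le> 1 / 8" .
  have np: "real n * p n \<le> c" using np_le n by simp
  have ap: "\<bar>?q ^ (n - 1) - exp (- (p n * real n))\<bar> \<le> (c + 2 * c\<^sup>2) / real n"
    using p0 p8 pc n by (intro one_minus_power_approx) auto
  have "real n * ?q ^ (n - 1) - exp (- (p n * real n)) * real n = (?q ^ (n - 1) - exp (- (p n * real n))) * real n"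
    by (simp only: left_diff_distrib mult.commute[of "real n"])
  then have "\<bar>real n * ?q ^ (n - 1) - exp (- (p n * real n)) * real n\<bar> = \<bar>?q ^ (n - 1) - exp (- (p n * real n))\<bar> * real n"
    by (simp only: abs_mult abs_of_nat)
  also have "\<dots> \<le> (c + 2 * c\<^sup>2) / real n * real n" using ap by (intro mult_right_mono) auto
  finally have ap': "\<bar>real n * ?q ^ (n - 1) - exp (- (p n * real n)) * real n\<bar> \<le> (c + 2 * c\<^sup>2) / real n * real n" .
  have iso: "\<bar>real t - real n * ?q ^ (n - 1)\<bar> < err n * real n" using f by (simp add: typical_def t_def)
  have dn: "dev n * real n = err n * real n + (c + 2 * c\<^sup>2) / real n * real n" by (simp add: dev_def algebra_simps)
  show D: "\<bar>real (isolated_count (graph_of n f)) - exp (- (p n * real n)) * real n\<bar> \<le> dev n * real n"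
    unfolding dn using iso ap' unfolding t_def by linarith
  have "exp (- \<alpha>) \<le> exp (- (p n * real n))" using np \<epsilon> by (simp add: c_def mult.commute)
  then have "exp (- \<alpha>) * real n \<le> exp (- (p n * real n)) * real n" by (intro mult_right_mono) auto
  then have t1: "(exp (- \<alpha>) - dev n) * real n \<le> real t"
    using D unfolding t_def by (simp add: algebra_simps) 
  have "3/10 \<le> exp (- 1.1919 :: real)" using exp_neg_numeric_bounds(3) by (rule order.trans[rotated]) simp
  also have "\<dots> \<le> exp (- \<alpha>)" using \<alpha> by simp
  finally have e3: "3/10 \<le> exp (- \<alpha>)" .
  have npos: "0 < real n" using n by simp
  have dn1: "dev n * real n + 1 \<le> 1/50 * real n" using mult_right_mono[OF small(3), of "real n"] npos by (simp add: algebra_simps)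
  have dnK: "dev n * real n + real K \<le> 1/50 * real n" using mult_right_mono[OF small(2), of "real n"] npos by (simp add: algebra_simps)
  have en: "3/10 * real n \<le> exp (- \<alpha>) * real n" using e3 by (intro mult_right_mono) auto
  have two: "card {S \<in> comps (graph_of n f). card S = 2} + 1 \<le> t"
  proof -
    have "real (card {S \<in> comps (graph_of n f). card S = 2}) <
       err n * real n + real n * (real n * p n) / 2 * ?q ^ (2 * (n - 2))" using f by (simp add: typical_def)
    \<comment> \<open>Here \<open>np \<le> c < 6/5\<close>, and \<open>2 (n - 2) \<ge> n - 1\<close>
      for \<open>n \<ge> 3\<close>: up to the windows there are at most 3/5 as many isolated edges
      as isolated vertices.\<close>
    also have "real n * (real n * p n) / 2 * ?q ^ (2 * (n - 2)) \<le> real n * (6/5) / 2 * ?q ^ (n - 1)"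
      using np c_range n p0 p8 by (intro mult_mono divide_right_mono mult_left_mono power_decreasing) auto
    finally have c2: "real (card {S \<in> comps (graph_of n f). card S = 2}) < err n * real n + 3/5 * (real n * ?q ^ (n - 1))"
      by simp
    have "0 \<le> err n * real n" "0 \<le> (c + 2 * c\<^sup>2) / real n * real n" using c_range by (auto simp: err_def)
    then have "real (card {S \<in> comps (graph_of n f). card S = 2}) + 1 \<le> real t"
      using c2 iso t1 dn dn1 en ap' unfolding left_diff_distrib abs_less_iff abs_le_iff by linarith
    then show ?thesis by linarith
  qed
  have small': "real n + 3 * real K \<le> 4 * real t"
    using t1 dnK en unfolding left_diff_distrib by linarith
  have large: "real n / real K + x0 * real n \<le> real t"
  proof -
    \<comment> \<open>The distance \<kappa> from \<open>x0\<close> to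
      \<open>exp (- \<alpha>)\<close> is spent in halves: one on the multiplicity
      \<open>n / K\<close>, one on the deviation.\<close>
    have "1 / real K \<le> \<kappa> / 2" using K by (simp add: field_simps)
    then have "1 / real K + x0 \<le> exp (- \<alpha>) - dev n" using small(1) x0 by linarith
    then have "(1 / real K + x0) * real n \<le> (exp (- \<alpha>) - dev n) * real n" by (intro mult_right_mono) auto
    then show ?thesis using t1 by (simp add: algebra_simps)
  qed
  show "component_count F (graph_of n f) + card (verts F) \<le> isolated_count (graph_of n f) + 1"
    if "F \<in> graph_components (graph_of n f)"
    using component_condition[of "x0 * real n" K F] that two small' large K(1) f
    unfolding t_def typical_def by (auto intro: less_imp_le)
qed

lemma asymptotic_statements:
  shows "(\<lambda>n. measure_pmf.prob (gnp n (p n))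
      {G. \<forall>F \<in> graph_components G. component_count F G + card (verts F) \<le> isolated_count G + 1}) \<longlonglongrightarrow> 1"
    and "\<exists>\<delta> :: nat \<Rightarrow> real. \<delta> \<longlonglongrightarrow> 0 \<and> (\<lambda>n. measure_pmf.prob (gnp n (p n))
      {G. fo_depth G = fo_depth1 G \<and> \<bar>real (fo_depth G) - exp (- (p n * real n)) * real n\<bar> \<le> \<delta> n * real n}) \<longlonglongrightarrow> 1"
proof -
  have "0 < \<alpha> - \<epsilon> / 2" "\<alpha> - \<epsilon> / 2 < \<alpha>" using c_range(1) \<epsilon> by (auto simp: c_def)
  then obtain \<kappa> where \<kappa>: "0 < \<kappa>" "\<kappa> < exp (- \<alpha>)"
    "\<And>x. exp (- \<alpha>) - \<kappa> \<le> x \<Longrightarrow> \<kappa> \<le> x - 1 + exp (- ((\<alpha> - \<epsilon> / 2) * x))"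
    using giant_share_gap[OF \<alpha>(1)] by blast
  define x0 where "x0 = exp (- \<alpha>) - \<kappa>"
  have x0: "0 < x0" using \<kappa> by (simp add: x0_def)
  define K where "K = Suc (nat \<lceil>2 / \<kappa>\<rceil>)"
  have "2 / \<kappa> \<le> real K" unfolding K_def by linarith
  then have K: "0 < K" "2 \<le> \<kappa> * real K" using \<kappa>(1) by (auto simp: K_def field_simps)
  define b where "b n = (1 + 9 * c + 2 * c ^ 3) / ((err n)\<^sup>2 * real n) + real n ^ 2 * exp (- (\<kappa>\<^sup>2 / 2 * real n))" for n
  have b: "b \<longlonglongrightarrow> 0"
  proof -
    define k where "k = \<kappa>\<^sup>2 / 2"
    have k: "k > 0" using \<kappa>(1) by (simp add: k_def)
    have "(\<lambda>n. real n ^ 2 * exp (- (k * real n))) \<longlonglongrightarrow> 0" using k by real_asymp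
    moreover have "(\<lambda>n. (1 + 9 * c + 2 * c ^ 3) * (1 / ((real n powr (- 1 / 4))\<^sup>2 * real n))) \<longlonglongrightarrow> (1 + 9 * c + 2 * c ^ 3) * 0"
      by (intro tendsto_mult tendsto_const) real_asymp
    ultimately show ?thesis unfolding b_def err_def k_def[symmetric] by (auto intro: tendsto_add_zero)
  qed
  have err0: "err \<longlonglongrightarrow> 0" unfolding err_def by real_asymp
  have inv0: "(\<lambda>n. a / real n) \<longlonglongrightarrow> 0" for a by (rule lim_const_over_n)
  have dev0: "dev \<longlonglongrightarrow> 0" unfolding dev_def using tendsto_add[OF err0 inv0] by simp
  have large: "eventually (\<lambda>n. a \<le> real n) sequentially" for a
    by (meson eventually_sequentiallyI nat_le_real_less order.trans real_arch_simple of_nat_mono)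
  have atyp: "eventually (\<lambda>n. measure_pmf.prob (edge_field n (p n)) {f. \<not> typical x0 n f} \<le> b n) sequentially"
    using large[of 2] large[of "8 * c"] large[of "4 * c\<^sup>2 / \<epsilon>"] large[of "2 / \<kappa>"]
  proof eventually_elim
    case (elim n)
    then show ?case unfolding b_def
      using \<kappa> x0 \<epsilon> by (intro prob_atypical_le) (auto simp: x0_def field_simps)
  qed
  have e1: "eventually (\<lambda>n. dev n \<le> \<kappa> / 2) sequentially"
    using order_tendstoD(2)[OF dev0, of "\<kappa> / 2"] \<kappa>(1) by (auto elim: eventually_mono)
  have e2: "eventually (\<lambda>n. dev n + a / real n \<le> 1/50) sequentially" for a
    using order_tendstoD(2)[OF tendsto_add[OF dev0 inv0[of a]], of "1/50"] by (auto elim: eventually_mono)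
  have cond: "eventually (\<lambda>n. \<forall>f. typical x0 n f \<longrightarrow>
      \<bar>real (isolated_count (graph_of n f)) - exp (- (p n * real n)) * real n\<bar> \<le> dev n * real n \<and>
      (\<forall>F \<in> graph_components (graph_of n f). component_count F (graph_of n f) + card (verts F) \<le> isolated_count (graph_of n f) + 1))
      sequentially"
    using large[of 3] large[of "8 * c"] e1 e2[of "real K"] e2[of 1]
  proof eventually_elim
    case (elim n)
    then have n: "3 \<le> n" by simp
    show ?case
      using typical_component_condition[OF n elim(2) x0_def K elim(3,4,5)] by blast
  qed
  show "(\<lambda>n. measure_pmf.prob (gnp n (p n))
      {G. \<forall>F \<in> graph_components G. component_count F G + card (verts F) \<le> isolated_count G + 1}) \<longlonglongrightarrow> 1"
    unfolding prob_gnp by (rule prob_tendsto_1[OF atyp b]) (use cond in \<open>auto elim: eventually_mono\<close>)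
  \<comment> \<open>The added \<open>2 / n\<close> covers the excess of the depth over the isolated
    vertex count, which is 1 or 2.\<close>
  define \<delta> where "\<delta> n = dev n + 2 / real n" for n
  have "\<delta> \<longlonglongrightarrow> 0" unfolding \<delta>_def using tendsto_add[OF dev0 inv0] by simp
  moreover have "(\<lambda>n. measure_pmf.prob (gnp n (p n))
      {G. fo_depth G = fo_depth1 G \<and> \<bar>real (fo_depth G) - exp (- (p n * real n)) * real n\<bar> \<le> \<delta> n * real n}) \<longlonglongrightarrow> 1"
    unfolding prob_gnp
  proof (rule prob_tendsto_1[OF atyp b])
    show "eventually (\<lambda>n. \<forall>f. typical x0 n f \<longrightarrow> fo_depth (graph_of n f) = fo_depth1 (graph_of n f) \<and>
        \<bar>real (fo_depth (graph_of n f)) - exp (- (p n * real n)) * real n\<bar> \<le> \<delta> n * real n) sequentially"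
      using cond large[of 1]
    proof eventually_elim
      case (elim n)
      show ?case
      proof (intro allI impI)
        fix f assume "typical x0 n f"
        then have t: "\<bar>real (isolated_count (graph_of n f)) - exp (- (p n * real n)) * real n\<bar> \<le> dev n * real n"
          and c: "\<And>F. F \<in> graph_components (graph_of n f) \<Longrightarrow>
            component_count F (graph_of n f) + card (verts F) \<le> isolated_count (graph_of n f) + 1"
          using elim(1) by auto
        have ne: "pverts (graph_of n f) \<noteq> {}" using elim(2) by simp
        have d: "fo_depth (graph_of n f) = isolated_count (graph_of n f) + (if parcs (graph_of n f) = {} then 1 else 2)"
          "fo_depth1 (graph_of n f) = isolated_count (graph_of n f) + (if parcs (graph_of n f) = {} then 1 else 2)"
          by (rule fo_depth_eq[OF pair_graph_graph_of ne c], assumption)+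
        have "\<delta> n * real n = dev n * real n + 2" using elim(2) by (simp add: \<delta>_def algebra_simps)
        moreover have "real (isolated_count (graph_of n f)) \<le> real (fo_depth (graph_of n f))"
          "real (fo_depth (graph_of n f)) \<le> real (isolated_count (graph_of n f)) + 2"
          unfolding d(1) by auto
        ultimately have "\<bar>real (fo_depth (graph_of n f)) - exp (- (p n * real n)) * real n\<bar> \<le> \<delta> n * real n"
          using t by linarith
        then show "fo_depth (graph_of n f) = fo_depth1 (graph_of n f) \<and>
          \<bar>real (fo_depth (graph_of n f)) - exp (- (p n * real n)) * real n\<bar> \<le> \<delta> n * real n"
          using d by simp
      qed
    qed
  qed
  ultimately show "\<exists>\<delta> :: nat \<Rightarrow> real. \<delta> \<longlonglongrightarrow> 0 \<and> (\<lambda>n. measure_pmf.prob (gnp n (p n))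
      {G. fo_depth G = fo_depth1 G \<and> \<bar>real (fo_depth G) - exp (- (p n * real n)) * real n\<bar> \<le> \<delta> n * real n}) \<longlonglongrightarrow> 1"
    by blast
qed

end

text \<open>The \<open>o(1)\<close> term is a deterministic null sequence \<delta>, which may depend
  on the sequence \<open>p\<close>.\<close>

theorem theorem5p2:
  shows "\<exists>\<alpha>::real.
    \<alpha> > 0 \<and> exp (- \<alpha> + \<alpha> * exp (- \<alpha>)) + 1 = exp (\<alpha> * exp (- \<alpha>)) \<and>
    (\<forall>\<beta>>0. exp (- \<beta> + \<beta> * exp (- \<beta>)) + 1 = exp (\<beta> * exp (- \<beta>)) \<longrightarrow> \<beta> = \<alpha>) \<and>
    1.1918 \<le> \<alpha> \<and> \<alpha> < 1.1919 \<and>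
    (\<forall>(\<epsilon>::real) (p :: nat \<Rightarrow> real).
       \<epsilon> > 0 \<and> (\<forall>n\<ge>1. 0 \<le> p n \<and> p n \<le> 1 \<and> p n \<le> (\<alpha> - \<epsilon>) / real n) \<longrightarrow>
         (\<lambda>n. measure_pmf.prob (gnp n (p n))
            {G. \<forall>F \<in> graph_components G. component_count F G + card (verts F) \<le> isolated_count G + 1})
           \<longlonglongrightarrow> 1 \<and>
         (\<exists>\<delta> :: nat \<Rightarrow> real. \<delta> \<longlonglongrightarrow> 0 \<and>
            (\<lambda>n. measure_pmf.prob (gnp n (p n))
               {G. fo_depth G = fo_depth1 G \<and>
                   \<bar>real (fo_depth G) - exp (- (p n * real n)) * real n\<bar> \<le> \<delta> n * real n})
              \<longlonglongrightarrow> 1))"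
proof -
  obtain \<alpha> where \<alpha>: "1.1918 \<le> \<alpha>" "\<alpha> < 1.1919" "thr \<alpha> = 0" using thr_root_exists by blast
  then have pos: "0 < \<alpha>" by (rule_tac order.strict_trans2[rotated]) auto
  show ?thesis
  proof (intro exI[of _ \<alpha>] conjI allI impI)
    show "0 < \<alpha>" by (rule pos)
    show "exp (- \<alpha> + \<alpha> * exp (- \<alpha>)) + 1 = exp (\<alpha> * exp (- \<alpha>))" unfolding thr_eq_0_iff by (rule \<alpha>(3))
    show "\<beta> = \<alpha>" if "0 < \<beta>" "exp (- \<beta> + \<beta> * exp (- \<beta>)) + 1 = exp (\<beta> * exp (- \<beta>))" for \<beta>
      using that thr_root_unique[OF _ pos _ \<alpha>(3)] unfolding thr_eq_0_iff by blast
    show "1.1918 \<le> \<alpha>" "\<alpha> < 1.1919" by (rule \<alpha>)+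
    fix \<epsilon> :: real and p :: "nat \<Rightarrow> real"
    assume "\<epsilon> > 0 \<and> (\<forall>n\<ge>1. 0 \<le> p n \<and> p n \<le> 1 \<and> p n \<le> (\<alpha> - \<epsilon>) / real n)"
    then have \<epsilon>: "0 < \<epsilon>" and p: "\<And>n. 1 \<le> n \<Longrightarrow> 0 \<le> p n" "\<And>n. 1 \<le> n \<Longrightarrow> p n \<le> (\<alpha> - \<epsilon>) / real n" by auto
    note result = asymptotic_statements[OF \<alpha>(3,1,2) \<epsilon> p]
    show "(\<lambda>n. measure_pmf.prob (gnp n (p n))
        {G. \<forall>F \<in> graph_components G. component_count F G + card (verts F) \<le> isolated_count G + 1}) \<longlonglongrightarrow> 1"
      by (rule result(1))
    show "\<exists>\<delta> :: nat \<Rightarrow> real. \<delta> \<longlonglongrightarrow> 0 \<and> (\<lambda>n. measure_pmf.prob (gnp n (p n))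
        {G. fo_depth G = fo_depth1 G \<and> \<bar>real (fo_depth G) - exp (- (p n * real n)) * real n\<bar> \<le> \<delta> n * real n}) \<longlonglongrightarrow> 1"
      by (rule result(2))
  qed
qed

end
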